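(* Let $N\ge1$ be an integer and suppose $a>\max\{0,2-N\}$. Let $h_a(x,y;t)$ be the $a$-deformed heat kernel on $\mathbb{R}^N$, let $\lambda_a=\frac{N-2}{a}$ and $M=(a-1)\frac{N-2}{2}+a$. Then: 1. $h_a(x,y;t)$ is real valued and symmetric in $x,y$, i.e. $h_a(x,y;t)=h_a(y,x;t)$ for all $x,y\in\mathbb{R}^N$, $t>0$. 2. There exists a constant $C=C_a>0$ such that for all $x,y\in\mathbb{R}^N$ and $t>0$, writing $r=|x|$ and $s=|y|$, $$|h_a(x,y;t)|\le C\,t^{-(\lambda_a+1)}\,e^{-\frac{(r^{a/2}-s^{a/2})^2}{at}}\left(1+\left(\frac{(rs)^{a/2}}{at}\right)^{\frac{2M}{a}}\right).$$
   Context: Normalized I-Bessel function: for $\mu\in\mathbb{R}$ and $w\in\mathbb{C}$, $\tilde I_\mu(w)=\sum_{j=0}^\infty\frac{(w/2)^{2j}}{j!\,\Gamma(\mu+j+1)}$ (with $1/\Gamma=0$ at the poles of $\Gamma$). Normalized Gegenbauer polynomials $\check C^\nu_m(t)$ are defined by the formal power series expansion $\frac{1-x^2}{(1-2tx+x^2)^{\nu+1}}=\sum_{m=0}^\infty\check C^\nu_m(t)x^m$. For $b>0$, $\nu\in\mathbb{R}$ with $1+b\nu>0$, $w\in\mathbb{C}$, $t\in[-1,1]$, $$\mathscr{I}(b,\nu,w,t):=\Gamma(b\nu+1)\sum_{m=0}^\infty\left(\frac w2\right)^{bm}\tilde I_{b(m+\nu)}(w)\,\check C^\nu_m(t),$$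 where $(w/2)^s=(|w|/2)^se^{i\theta s}$ for $w=|w|e^{i\theta}$, $\theta\in(-\pi,\pi]$; the series converges absolutely and locally uniformly. For $a>\max\{0,2-N\}$ put $B_a(r\omega,s\mu)=\mathscr{I}\left(\frac2a,\frac{N-2}{2},\frac{2(rs)^{a/2}}{ai},\langle\omega,\mu\rangle\right)$ for $r,s\ge0$, $\omega,\mu\in S^{N-1}$ (the kernel of the $(0,a)$-generalized Fourier transform), and $c_a=\left(\int_{\mathbb{R}^N}e^{-\frac1a|x|^a}\frac{dx}{|x|^{2-a}}\right)^{-1}$. The $a$-deformed heat kernel is $$h_a(x,y;t)=c_a\int_{\mathbb{R}^N}\overline{B_a(x,\xi)}\,B_a(y,\xi)\,e^{-\frac ta|\xi|^a}\frac{d\xi}{|\xi|^{2-a}}\qquad(x,y\in\mathbb{R}^N,\ t>0),$$ an absolutely convergent integral. *)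

theory Defs
  imports
    "HOL-Analysis.Analysis"
    "HOL-Computational_Algebra.Formal_Power_Series"
begin

text \<open>
  The library's \<^const>\<open>rGamma\<close> is \<open>1/\<Gamma>\<close>, with value \<open>0\<close> at the poles of \<open>\<Gamma>\<close>.
\<close>

definition I_tilde :: "real \<Rightarrow> complex \<Rightarrow> complex" where
  "I_tilde \<mu> w =
     (\<Sum>j. (w / 2) ^ (2 * j) * complex_of_real (rGamma (\<mu> + real j + 1) / fact j))"

text \<open>
  \<open>fps_binomial \<alpha>\<close> is the binomial series of \<open>(1 + X) powr \<alpha>\<close>; composing it with a series
  \<open>u\<close> without constant term gives the formal power \<open>(1 + u) powr \<alpha>\<close>.
\<close>

definition gegenbauer_check :: "real \<Rightarrow> nat \<Rightarrow> real \<Rightarrow> real" where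
  "gegenbauer_check \<nu> m t =
     fps_nth ((1 - fps_X ^ 2) /
       fps_compose (fps_binomial (\<nu> + 1)) (fps_X ^ 2 - fps_const (2 * t) * fps_X)) m"

text \<open>
  The power \<open>z\<^sup>s = \<bar>z\<bar>\<^sup>s e\<^bsup>i s Arg z\<^esup>\<close> with the argument in \<open>(-\<pi>, \<pi>]\<close>. The case distinction is
  needed because \<^const>\<open>powr\<close> has \<open>0 powr 0 = 0\<close>, while \<open>0\<^sup>0\<close> must be \<open>1\<close> in the term
  \<open>m = 0\<close> below.
\<close>

definition principal_power :: "complex \<Rightarrow> real \<Rightarrow> complex" where
  "principal_power z s = (if s = 0 then 1 else rcis (cmod z powr s) (Arg z * s))"

definition script_I :: "real \<Rightarrow> real \<Rightarrow> complex \<Rightarrow> real \<Rightarrow> complex" where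
  "script_I b \<nu> w t =
     complex_of_real (Gamma (b * \<nu> + 1)) *
     (\<Sum>m. principal_power (w / 2) (b * real m) * I_tilde (b * (real m + \<nu>)) w *
           complex_of_real (gegenbauer_check \<nu> m t))"

text \<open>
  The kernel is given in polar coordinates; \<open>sgn x = x / norm x\<close> is the direction of \<open>x\<close>.
  For \<open>x = 0\<close> or \<open>y = 0\<close> the direction is irrelevant, see \<open>B_kernel_polar\<close> below.
\<close>

definition B_kernel :: "real \<Rightarrow> real ^ 'n \<Rightarrow> real ^ 'n \<Rightarrow> complex" where
  "B_kernel a x y =
     script_I (2 / a) ((real CARD('n) - 2) / 2)
       (complex_of_real (2 * (norm x * norm y) powr (a / 2)) / (complex_of_real a * \<i>))
       (sgn x \<bullet> sgn y)"

definition c_const :: "'n::finite itself \<Rightarrow> real \<Rightarrow> real" where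
  "c_const _ a =
     inverse (LINT x|lborel. exp (- (1 / a) * norm (x :: real ^ 'n) powr a) / norm x powr (2 - a))"

definition heat_kernel :: "real \<Rightarrow> real ^ 'n \<Rightarrow> real ^ 'n \<Rightarrow> real \<Rightarrow> complex" where
  "heat_kernel a x y t =
     complex_of_real (c_const TYPE('n) a) *
     (LINT \<xi>|lborel. cnj (B_kernel a x \<xi>) * B_kernel a y \<xi> *
        complex_of_real (exp (- (t / a) * norm \<xi> powr a) / norm \<xi> powr (2 - a)))"

lemma gegenbauer_check_0: "gegenbauer_check \<nu> 0 t = 1"
  by (simp add: gegenbauer_check_def fps_divide_unit)

lemma script_I_zero:
  assumes "b > 0"
  shows "script_I b \<nu> 0 t = script_I b \<nu> 0 t'"
proof -
  have "principal_power 0 (b * real m) * I_tilde (b * (real m + \<nu>)) 0 *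
          complex_of_real (gegenbauer_check \<nu> m t) =
        principal_power 0 (b * real m) * I_tilde (b * (real m + \<nu>)) 0 *
          complex_of_real (gegenbauer_check \<nu> m t')" for m
    using assms by (cases "m = 0") (auto simp: gegenbauer_check_0 principal_power_def)
  then show ?thesis
    by (simp only: script_I_def div_0)
qed

lemma B_kernel_polar:
  fixes \<omega> \<mu> :: "real ^ 'n"
  assumes "a > 0" "r \<ge> 0" "s \<ge> 0" "norm \<omega> = 1" "norm \<mu> = 1"
  shows "B_kernel a (r *\<^sub>R \<omega>) (s *\<^sub>R \<mu>) =
         script_I (2 / a) ((real CARD('n) - 2) / 2)
           (complex_of_real (2 * (r * s) powr (a / 2)) / (complex_of_real a * \<i>)) (\<omega> \<bullet> \<mu>)"
proof (cases "r = 0 \<or> s = 0")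
  case True
  then show ?thesis
    using script_I_zero[of "2 / a"] assms by (auto simp: B_kernel_def)
next
  case False
  then have "sgn (r *\<^sub>R \<omega>) = \<omega>" "sgn (s *\<^sub>R \<mu>) = \<mu>"
    using assms by (auto simp: sgn_div_norm)
  then show ?thesis
    using assms by (simp add: B_kernel_def)
qed

end

theory Submission
  imports Defs
begin

text \<open>
  On a ray the kernel \<open>B\<^sub>a\<close> is a series of zonal functions \<open>C\<^sub>m(\<langle>\<omega>, \<mu>\<rangle>)\<close> with radial Bessel
  coefficients. The zonal functions reproduce under averaging over the sphere, so in the
  integral defining the heat kernel only the diagonal terms survive; there the phases
  \<open>e\<^bsup>-i\<pi>m/a\<^esup>\<close> cancel, and the radial integrals are given by Weber's second exponential
  integral. Hence \<open>h\<^sub>a\<close> is \<open>t\<^bsup>-(\<lambda>+1)\<^esup> e\<^bsup>-(r\<^sup>a + s\<^sup>a)/(at)\<^esup>\<close> times a real symmetric series in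
  \<open>y\<^bsup>bm\<^esup> I(2y) C\<^sub>m\<close> with \<open>y = (rs)\<^bsup>a/2\<^esup>/(at)\<close>, which \<open>y\<^sup>x / \<Gamma>(x + 1) \<le> e\<^sup>y\<close> and polynomial bounds
  for \<open>C\<^sub>m\<close> dominate by \<open>e\<^bsup>2y\<^esup>(1 + y\<^sup>p)\<close>. The orthogonality relations come from Gaussian moments:
  polynomial moments against \<open>e\<^bsup>-|x|\<^sup>2/2\<^esup>\<close> are explicit, and the alternating sums arising from the
  coefficients of \<open>C\<^sub>m\<close> are finite differences of ratios of Gamma values.
\<close>

section \<open>Normalized Gegenbauer polynomials\<close>

unbundle no vec_syntax
unbundle fps_syntax

text \<open>The exponent \<open>2M/a\<close> equals \<open>N - \<lambda>\<close>. The
  \<open>N\<close> arises because \<open>C_m(1)\<close> grows at most like \<open>m^(N-2)\<close>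
  and two further powers of \<open>1 + m\<close> make the series over \<open>m\<close> converge;
  each of these \<open>N\<close> factors is traded for a factor \<open>1 + y\<close> by means of
  \<open>x / Gamma (x+1) = 1 / Gamma x\<close>. The \<open>-\<lambda>\<close> is the mismatch
  between the power \<open>y^(bm)\<close> and the Bessel order
  \<open>b(m + \<nu>) = bm + \<lambda>\<close>. As \<open>y^(-\<lambda>)\<close> may be singular at
  \<open>0\<close>, small \<open>y\<close> is handled by monotonicity in \<open>y\<close>. The
  hypothesis \<open>a > 2 - N\<close> says that \<open>\<lambda> > -1\<close>, so that all Bessel
  orders exceed \<open>-1\<close>, and equally that \<open>|x|^(a-2)\<close> is integrable at the
  origin. The Gaussian weight is chosen because translation makes the generating function of its
  moments explicit, while its radial part divides out again. For the kernel, limits and integrals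
  are interchanged by one device: truncated series are bounded by a constant times
  \<open>e^(3y)\<close>, and with \<open>y\<close> a multiple of \<open>|x|^(a/2)\<close> this is
  absorbed by \<open>exp (- \<tau> |x|^a)\<close>, a Gaussian in the same variable.\<close>

lemma inverse_fps_binomial: "inverse (fps_binomial c) = fps_binomial (- c :: 'a::field_char_0)"
proof -
  have "fps_binomial c * fps_binomial (- c) = 1"
    using fps_binomial_add_mult[of c "- c"] by (simp add: fps_binomial_0)
  then show ?thesis by (rule fps_inverse_unique)
qed

lemma fps_X_plus_const_power_nth:
  "((fps_X + fps_const c) ^ i :: 'a::comm_ring_1 fps) $ n = of_nat (i choose n) * c ^ (i - n)"
proof -
  have "((fps_X + fps_const c) ^ i :: 'a fps) $ n = (\<Sum>k\<le>i. (of_nat (i choose k) * fps_X ^ k * fps_const c ^ (i - k)) $ n)"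
    by (simp add: binomial_ring fps_sum_nth)
  also have "\<dots> = (\<Sum>k\<le>i. if k = n then of_nat (i choose n) * c ^ (i - n) else 0)"
    by (intro sum.cong refl)
      (simp add: fps_const_power mult.assoc fps_X_power_mult_nth fps_of_nat[symmetric] del: fps_of_nat)
  finally show ?thesis by (auto simp: binomial_eq_0)
qed

text \<open>The series is the generating function \<open>(1 - 2tX + X^2)^(-c)\<close> of the
  classical Gegenbauer polynomials. Since \<open>u = X(X - 2t)\<close>, the coefficient of
  \<open>X^m\<close> in \<open>u^i\<close> is that of \<open>X^(m-i)\<close> in
  \<open>(X - 2t)^i\<close>; the substitution \<open>i = m - k\<close> gives the sum over
  \<open>k\<close>.\<close>

lemma binomial_power_nth:
  fixes t :: real
  shows "inverse (fps_compose (fps_binomial c) (fps_X ^ 2 - fps_const (2 * t) * fps_X)) $ m =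
    (\<Sum>k\<le>m div 2. (-1) ^ k * pochhammer c (m - k) / (fact k * fact (m - 2 * k)) * (2 * t) ^ (m - 2 * k))"
proof -
  define u :: "real fps" where "u = fps_X ^ 2 - fps_const (2 * t) * fps_X"
  have u: "u = fps_X * (fps_X + fps_const (- 2 * t))"
    by (simp add: u_def algebra_simps power2_eq_square fps_const_neg[symmetric] del: fps_const_neg)
  have "inverse (fps_compose (fps_binomial c) u) = fps_compose (fps_binomial (- c)) u"
    by (subst fps_inverse_compose[symmetric]) (auto simp: u inverse_fps_binomial)
  then have "inverse (fps_compose (fps_binomial c) u) $ m = (\<Sum>i=0..m. (- c gchoose i) * u ^ i $ m)"
    by (simp add: fps_compose_nth)
  also have "\<dots> = (\<Sum>i=0..m. (- c gchoose i) * (real (i choose (m - i)) * (- 2 * t) ^ (i - (m - i))))"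
    by (intro sum.cong refl) (auto simp: u power_mult_distrib fps_X_power_mult_nth fps_X_plus_const_power_nth)
  also have "\<dots> = (\<Sum>k=0..m. (- c gchoose (m - k)) * (real ((m - k) choose k) * (- 2 * t) ^ (m - k - k)))"
    by (rule sum.reindex_bij_witness[of _ "\<lambda>k. m - k" "\<lambda>k. m - k"]) auto
  also have "\<dots> = (\<Sum>k\<le>m div 2. (- c gchoose (m - k)) * (real ((m - k) choose k) * (- 2 * t) ^ (m - k - k)))"
    by (rule sum.mono_neutral_right) (auto simp: binomial_eq_0)
  also have "\<dots> = (\<Sum>k\<le>m div 2. (-1) ^ k * pochhammer c (m - k) / (fact k * fact (m - 2 * k)) * (2 * t) ^ (m - 2 * k))"
  proof (intro sum.cong refl)
    fix k assume "k \<in> {..m div 2}"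
    then have k: "2 * k \<le> m" by auto
    \<comment> \<open>One sign comes from \<open>- c gchoose (m - k)\<close>, the other from the
      powers of \<open>- 2 * t\<close>; together they leave \<open>(-1) ^ k\<close>.\<close>
    then have s: "(-1) ^ (m - k) * (-1) ^ (m - k - k) = ((-1) ^ k :: real)"
      by (simp add: power_add[symmetric] minus_one_power_iff)
    have e: "m - k - k = m - 2 * k" by simp
    have p: "(- 2 * t) ^ (m - k - k) = (-1) ^ (m - k - k) * (2 * t) ^ (m - 2 * k)"
      unfolding e using power_mult_distrib[of "-1" "2 * t" "m - 2 * k"] by simp
    have b: "real ((m - k) choose k) = fact (m - k) / (fact k * fact (m - 2 * k))"
      using k by (subst binomial_fact) (auto simp: e[symmetric])
    have "(- c gchoose (m - k)) * (real ((m - k) choose k) * (- 2 * t) ^ (m - k - k)) =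
      ((-1) ^ (m - k) * (-1) ^ (m - k - k)) * pochhammer c (m - k) / fact (m - k) *
        (fact (m - k) / (fact k * fact (m - 2 * k))) * (2 * t) ^ (m - 2 * k)"
      unfolding b p gbinomial_pochhammer by (simp only: minus_minus mult_ac times_divide_eq_left times_divide_eq_right divide_divide_eq_left)
    then show "(- c gchoose (m - k)) * (real ((m - k) choose k) * (- 2 * t) ^ (m - k - k)) =
       (-1) ^ k * pochhammer c (m - k) / (fact k * fact (m - 2 * k)) * (2 * t) ^ (m - 2 * k)"
      unfolding s by simp
  qed
  finally show ?thesis by (simp add: u_def)
qed

text \<open>The numerator \<open>1 - X^2\<close> produces the difference of the coefficients of
  index \<open>m\<close> and \<open>m - 2\<close>, in which the terms with the same power of
  \<open>t\<close> combine to a factor \<open>\<nu> + m\<close>. For \<open>m = 0\<close> the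
  right-hand side would be \<open>\<nu>\<close> instead of \<open>1\<close>.\<close>

lemma gegenbauer_check_eq_sum:
  assumes "m > 0"
  shows "gegenbauer_check \<nu> m t = (\<Sum>k\<le>m div 2. (-1) ^ k * (\<nu> + m) * pochhammer (\<nu> + 1) (m - k - 1) *
     2 ^ (m - 2 * k) / (fact k * fact (m - 2 * k)) * t ^ (m - 2 * k))"
    (is "_ = (\<Sum>k\<le>_. ?z k)")
proof -
  define D where "D = fps_compose (fps_binomial (\<nu> + 1)) (fps_X ^ 2 - fps_const (2 * t) * fps_X)"
  define A where "A m k = (-1) ^ k * pochhammer (\<nu> + 1) (m - k) / (fact k * fact (m - 2 * k)) * (2 * t) ^ (m - 2 * k)" for m k :: nat
  have D: "inverse D $ m = (\<Sum>k\<le>m div 2. A m k)" for m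
    unfolding D_def A_def by (rule binomial_power_nth)
  have "gegenbauer_check \<nu> m t = ((1 - fps_X ^ 2) * inverse D) $ m"
    by (simp add: gegenbauer_check_def D_def fps_divide_unit)
  also have "\<dots> = inverse D $ m - (if m < 2 then 0 else inverse D $ (m - 2))"
    by (simp add: left_diff_distrib fps_X_power_mult_nth)
  also have "\<dots> = (\<Sum>k\<le>m div 2. ?z k)"
  proof (cases "m = 1")
    case True
    then show ?thesis by (simp add: D A_def)
  next
    case False
    with assms have m: "m \<ge> 2" by simp
    then obtain h where h: "m div 2 = Suc h" by (metis div_greater_zero_iff gr0_implies_Suc zero_less_numeral)
    then have h': "(m - 2) div 2 = h" by simp
    have 0: "A m 0 = ?z 0"
      using pochhammer_rec'[of "\<nu> + 1" "m - 1"] m by (simp add: A_def power_mult_distrib of_nat_diff)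
    \<comment> \<open>Both terms carry the power \<open>n = m - 2 * Suc k\<close> of
      \<open>2 * t\<close>. With \<open>P\<close> as common factor, the brackets
      \<open>\<nu> + 1 + n + k\<close> and \<open>Suc k\<close> add up to
      \<open>\<nu> + m\<close>.\<close>
    have S: "A m (Suc k) - A (m - 2) k = ?z (Suc k)" if "k \<le> h" for k
    proof -
      have k: "2 * Suc k \<le> m" using that h by presburger
      define n where "n = m - 2 * Suc k"
      have m: "m = n + 2 * Suc k" using k by (simp add: n_def)
      have e: "m - Suc k = Suc (n + k)" "m - Suc k - 1 = n + k" "m - 2 - k = n + k" "m - 2 - 2 * k = n"
        using m by auto
      define P where "P = pochhammer (\<nu> + 1) (n + k)"
      have P: "pochhammer (\<nu> + 1) (Suc (n + k)) = P * (\<nu> + 1 + real (n + k))"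
        by (simp add: P_def pochhammer_Suc)
      have gen: "-1 * s * (P * Y) / (K * F * G) * q - s * P / (F * G) * q = -1 * s * P * q / (K * F * G) * (Y + K)"
        if "K \<noteq> 0" "F \<noteq> 0" "G \<noteq> 0" for s Y K F G q :: real
        using that by (simp add: field_simps)
      have f: "fact (Suc k) = real (Suc k) * fact k" by simp
      have "A m (Suc k) - A (m - 2) k = (-1) ^ Suc k * P * (2 * t) ^ n / (fact (Suc k) * fact n) * ((\<nu> + 1 + real (n + k)) + real (Suc k))"
        unfolding A_def e P n_def[symmetric] P_def[symmetric] f power_Suc by (rule gen) auto
      also have "(\<nu> + 1 + real (n + k)) + real (Suc k) = \<nu> + real m" using m by simp
      finally show ?thesis
        unfolding e(2) n_def[symmetric] P_def[symmetric] by (simp add: power_mult_distrib mult_ac)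
    qed
    have "inverse D $ m - (if m < 2 then 0 else inverse D $ (m - 2)) = (\<Sum>k\<le>Suc h. A m k) - (\<Sum>k\<le>h. A (m - 2) k)"
      using m by (simp add: D h h')
    also have "\<dots> = A m 0 + (\<Sum>k\<le>h. A m (Suc k) - A (m - 2) k)"
      by (subst sum.atMost_Suc_shift) (simp add: sum_subtractf)
    also have "\<dots> = ?z 0 + (\<Sum>k\<le>h. ?z (Suc k))"
      unfolding 0 by (intro arg_cong2[of _ _ _ _ "(+)"] sum.cong refl S) auto
    also have "\<dots> = (\<Sum>k\<le>m div 2. ?z k)"
      unfolding h by (rule sum.atMost_Suc_shift[symmetric])
    finally show ?thesis .
  qed
  finally show ?thesis .
qed

text \<open>
  At \<open>t = 1\<close> the denominator is \<open>((1 - X)\<^sup>2)\<^bsup>N/2\<^esup>\<close>; its square and constant term identify it as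
  \<open>(1 - X)\<^sup>N\<close>.
\<close>

lemma gegenbauer_check_one:
  assumes "real N = 2 * \<nu> + 2" "N > 0"
  shows "gegenbauer_check \<nu> m 1 = ((1 + fps_X) * inverse (1 - fps_X) ^ (N - 1)) $ m"
proof -
  define u :: "real fps" where "u = fps_X ^ 2 - fps_const (2 * 1) * fps_X"
  define D where "D = fps_compose (fps_binomial (\<nu> + 1)) u"
  define E :: "real fps" where "E = (1 - fps_X) ^ N"
  have u: "u = (1 - fps_X) ^ 2 - 1"
    by (simp add: u_def power2_eq_square algebra_simps numeral_fps_const[symmetric] flip: mult_2)
  have u0: "u $ 0 = 0" by (simp add: u_def)
  have "D * D = fps_compose (fps_binomial (\<nu> + 1) * fps_binomial (\<nu> + 1)) u"
    unfolding D_def by (rule fps_compose_mult_distrib[symmetric, OF u0])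
  also have "fps_binomial (\<nu> + 1) * fps_binomial (\<nu> + 1) = fps_binomial (real N)"
    using assms by (simp add: fps_binomial_add_mult[symmetric])
  also have "\<dots> = (1 + fps_X) ^ N" by (rule fps_binomial_of_nat)
  also have "fps_compose \<dots> u = (1 + u) ^ N"
    by (simp add: fps_compose_power[OF u0, symmetric] fps_compose_add_distrib u0)
  also have "\<dots> = E * E" by (simp add: u E_def power_mult_distrib[symmetric] power2_eq_square)
  finally have "(D - E) * (D + E) = 0" by (simp add: algebra_simps)
  moreover have "(D + E) $ 0 = 2" by (simp add: D_def E_def u0 fps_power_zeroth)
  then have "D + E \<noteq> 0" by (metis fps_zero_nth zero_neq_numeral)
  ultimately have DE: "D = E" by simp
  have nz: "(1 - fps_X :: real fps) $ 0 \<noteq> 0" by simp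
  have "gegenbauer_check \<nu> m 1 = ((1 - fps_X ^ 2) / E) $ m"
    using DE by (simp add: gegenbauer_check_def D_def u_def)
  also have "(1 - fps_X ^ 2) / E = (1 - fps_X ^ 2) * inverse (1 - fps_X) ^ N"
    unfolding E_def by (subst fps_divide_unit) (auto simp: fps_inverse_power fps_power_zeroth)
  also have "inverse (1 - fps_X) ^ N = inverse (1 - fps_X) * inverse (1 - fps_X :: real fps) ^ (N - 1)"
    using assms by (metis Suc_diff_1 power_Suc)
  also have "(1 - fps_X ^ 2) = (1 + fps_X) * (1 - fps_X :: real fps)"
    by (simp add: algebra_simps power2_eq_square)
  also have "(1 + fps_X) * (1 - fps_X) * (inverse (1 - fps_X) * inverse (1 - fps_X :: real fps) ^ (N - 1))
    = (1 + fps_X) * ((inverse (1 - fps_X) * (1 - fps_X)) * inverse (1 - fps_X :: real fps) ^ (N - 1))"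
    by (simp only: mult_ac)
  also have "inverse (1 - fps_X) * (1 - fps_X) = (1 :: real fps)"
    by (rule inverse_mult_eq_1[OF nz])
  finally show ?thesis by simp
qed

lemma inverse_one_minus_fps_X_nth: "inverse (1 - fps_X :: real fps) $ m = 1"
proof -
  have "inverse (1 - fps_X :: real fps) = Abs_fps (\<lambda>_. 1)"
    using fps_inverse_idempotent[of "Abs_fps (\<lambda>_. 1 :: real)"] by (simp add: fps_inverse_gp')
  then show ?thesis by simp
qed

text \<open>Multiplication by \<open>1/(1 - X)\<close> forms partial sums, so each further factor
  costs at most \<open>1 + m\<close>.\<close>

lemma inverse_one_minus_power_nth_le:
  "0 \<le> (inverse (1 - fps_X) ^ Suc k :: real fps) $ m \<and> (inverse (1 - fps_X) ^ Suc k :: real fps) $ m \<le> (1 + real m) ^ k"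
proof (induction k arbitrary: m)
  case 0
  then show ?case by (simp add: inverse_one_minus_fps_X_nth)
next
  case (Suc k)
  have eq: "(inverse (1 - fps_X) ^ Suc (Suc k) :: real fps) $ m = (\<Sum>i=0..m. (inverse (1 - fps_X) ^ Suc k :: real fps) $ (m - i))"
    by (subst power_Suc) (simp add: fps_mult_nth inverse_one_minus_fps_X_nth)
  have "(\<Sum>i=0..m. (inverse (1 - fps_X) ^ Suc k :: real fps) $ (m - i)) \<le> (\<Sum>i=0..m. (1 + real m) ^ k)"
    by (intro sum_mono order_trans[OF conjunct2[OF Suc.IH]] power_mono) auto
  also have "\<dots> = (1 + real m) ^ Suc k" by simp
  finally show ?case
    using Suc.IH by (auto simp only: eq intro!: sum_nonneg)
qed

text \<open>\<open>C_m(1)\<close> is of order at most \<open>m^(N-2)\<close>; the factor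
  \<open>(1 + m)^2\<close> stays on the left because \<open>N - 2\<close> is negative for
  \<open>N = 1\<close>. In that case the generating function is \<open>1 + X\<close>, so that only
  \<open>m \<le> 1\<close> matters.\<close>

lemma gegenbauer_check_one_bound:
  assumes N: "real N = 2 * \<nu> + 2" "N > 0"
  shows "gegenbauer_check \<nu> m 1 * (1 + real m) ^ 2 \<le> 2 * (1 + real m) ^ N"
proof (cases "N = 1")
  case True
  then show ?thesis
    by (cases "m \<le> 1") (auto simp: gegenbauer_check_one[OF N] le_Suc_eq)
next
  case False
  then obtain k where k: "N = Suc (Suc k)"
    using N by (metis One_nat_def less_numeral_extra(3) not0_implies_Suc)
  let ?P = "\<lambda>m. (inverse (1 - fps_X) ^ Suc k :: real fps) $ m"
  have P: "?P j \<le> (1 + real m) ^ k" if "j \<le> m" for j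
    using inverse_one_minus_power_nth_le[of k j] that by (meson add_left_mono of_nat_mono order_trans power_mono of_nat_0_le_iff add_nonneg_nonneg zero_le_one)
  have "gegenbauer_check \<nu> m 1 = ?P m + (if m = 0 then 0 else ?P (m - 1))"
    unfolding gegenbauer_check_one[OF N] k by (simp add: distrib_right del: power_Suc)
  also have "\<dots> \<le> (1 + real m) ^ k + (1 + real m) ^ k"
    by (intro add_mono) (auto intro!: P simp del: power_Suc)
  finally have "gegenbauer_check \<nu> m 1 * (1 + real m) ^ 2 \<le> (2 * (1 + real m) ^ k) * (1 + real m) ^ 2"
    by (intro mult_right_mono) auto
  then show ?thesis by (simp add: k power2_eq_square mult_ac)
qed

unbundle no fps_syntax
unbundle vec_syntax

section \<open>Radial integrals\<close>

lemma borel_measure_eqI_atMost: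
  fixes M N :: "real measure"
  assumes "sets M = sets borel" "sets N = sets borel"
    and "\<And>r. emeasure M {..r} = emeasure N {..r}" "\<And>r. emeasure M {..r} \<noteq> \<infinity>"
  shows "M = N"
proof (rule measure_eqI_generator_eq[where \<Omega> = UNIV and E = "range (\<lambda>a::real. {..a})" and A = "\<lambda>n. {..real n}"])
  show "Int_stable (range (\<lambda>a::real. {..a}))"
    by (force simp: Int_stable_def)
  have *: "sets borel = sigma_sets UNIV (range (\<lambda>a::real. {..a}))"
    by (subst borel_eq_atMost) simp
  then show "sets M = sigma_sets UNIV (range (\<lambda>a::real. {..a}))"
    "sets N = sigma_sets UNIV (range (\<lambda>a::real. {..a}))"
    using assms by auto
  show "(\<Union>n. {..real n}) = UNIV"
    using real_arch_simple by auto
qed (use assms in auto)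

lemma cball_borel [measurable]: "cball (x :: 'a::euclidean_space) r \<in> sets borel"
  by simp

lemma integrable_indicator_cball: "integrable lborel (indicat_real (cball 0 1 :: 'a::euclidean_space set))"
  by (rule integrable_real_indicator) (auto simp: emeasure_cball)

lemma integrable_mult_indicator_cball:
  fixes Q :: "'a::euclidean_space \<Rightarrow> real"
  assumes [measurable]: "Q \<in> borel_measurable borel" and bd: "\<And>x. \<bar>Q x\<bar> \<le> K"
  shows "integrable lborel (\<lambda>x. Q x * indicator (cball 0 1) x)"
  by (rule Bochner_Integration.integrable_bound[where f = "\<lambda>x::'a. K * indicator (cball 0 1) x"])
    (use integrable_mult_right[OF integrable_indicator_cball, of K] in \<open>auto simp: indicator_def abs_mult order_trans[OF bd abs_ge_self] simp del: integrable_mult_right_iff\<close>)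

lemma nn_integral_cball_scale:
  fixes Q :: "'a::euclidean_space \<Rightarrow> ennreal"
  assumes [measurable]: "Q \<in> borel_measurable borel" and hom: "\<And>c x. c > 0 \<Longrightarrow> Q (c *\<^sub>R x) = Q x" and r: "r > 0"
  shows "(\<integral>\<^sup>+x. Q x * indicator (cball 0 r) x \<partial>lborel) =
    ennreal (r ^ DIM('a)) * (\<integral>\<^sup>+x. Q x * indicator (cball 0 1) x \<partial>lborel)"
proof -
  have "(\<integral>\<^sup>+x. Q x * indicator (cball 0 r) x \<partial>lborel) =
    (\<integral>\<^sup>+x. Q x * indicator (cball 0 r) x \<partial>(density (distr lborel borel (\<lambda>x. 0 + r *\<^sub>R x)) (\<lambda>_. ennreal (\<bar>r\<bar>^DIM('a)))))"
    by (subst lborel_affine[of r 0]) (use r in simp_all)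
  also have "\<dots> = ennreal (r ^ DIM('a)) * (\<integral>\<^sup>+x. Q (r *\<^sub>R x) * indicator (cball 0 r) (r *\<^sub>R x) \<partial>lborel)"
    using r by (subst nn_integral_density, measurable, subst nn_integral_distr, measurable, simp)
      (simp add: nn_integral_cmult)
  also have "(\<integral>\<^sup>+x. Q (r *\<^sub>R x) * indicator (cball 0 r) (r *\<^sub>R x) \<partial>lborel) =
     (\<integral>\<^sup>+x. Q x * indicator (cball 0 1) x \<partial>lborel)"
    using r by (intro nn_integral_cong) (auto simp: hom indicator_def)
  finally show ?thesis .
qed

text \<open>
  A measure on the half line is determined by its values on initial segments, so that the
  radial push-forward of a \<open>0\<close>-homogeneous density depends only on the mass of the unit ball.
\<close>

lemma distr_norm_homogeneous:
  fixes Q :: "'a::euclidean_space \<Rightarrow> real"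
  assumes [measurable]: "Q \<in> borel_measurable borel" and hom: "\<And>c x. c > 0 \<Longrightarrow> Q (c *\<^sub>R x) = Q x"
    and nn: "\<And>x. Q x \<ge> 0" and bd: "\<And>x. Q x \<le> K"
  shows "distr (density lborel (\<lambda>x. ennreal (Q x))) borel norm =
    distr (density lborel (\<lambda>x. ennreal ((LINT x|lborel. Q x * indicator (cball 0 1) x) / unit_ball_vol (DIM('a))))) borel (norm :: 'a \<Rightarrow> real)"
    (is "?M = ?N")
proof -
  define q where "q = (LINT x|lborel. Q x * indicator (cball 0 1) x)"
  let ?V = "unit_ball_vol (DIM('a))"
  have V: "?V > 0" by (rule unit_ball_vol_pos) simp
  have int: "integrable lborel (\<lambda>x::'a. Q x * indicator (cball 0 1) x)"
    by (rule integrable_mult_indicator_cball[where K = K]) (use nn bd in auto)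
  have q0: "q \<ge> 0" unfolding q_def using nn by (intro integral_nonneg_AE) auto
  have qnn: "(\<integral>\<^sup>+x. ennreal (Q x) * indicator (cball 0 1) x \<partial>lborel) = ennreal q"
    unfolding q_def using nn by (subst nn_integral_eq_integral[OF int, symmetric])
      (auto intro!: nn_integral_cong simp: indicator_def)
  have vim: "norm -` {..r} = cball (0::'a) r" for r by auto
  have M: "emeasure ?M {..r} = (\<integral>\<^sup>+x. ennreal (Q x) * indicator (cball 0 r) x \<partial>lborel)" for r
    by (simp add: emeasure_distr emeasure_density vim)
  have N: "emeasure ?N {..r} = (\<integral>\<^sup>+x. ennreal (q / ?V) * indicator (cball (0::'a) r) x \<partial>lborel)" for r
    unfolding q_def[symmetric]
    by (simp add: emeasure_distr emeasure_density vim)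
  \<comment> \<open>\<open>max 0 r\<close> lets one formula cover \<open>r \<le> 0\<close>, where
    the ball is empty or a single point and hence a null set.\<close>
  have val: "emeasure ?M {..r} = ennreal (max 0 r ^ DIM('a) * q)" for r
  proof (cases "r > 0")
    case True
    then show ?thesis unfolding M
      by (subst nn_integral_cball_scale) (simp_all add: hom qnn ennreal_mult q0)
  next
    case False
    then have "cball 0 r \<subseteq> {0::'a}"
      by (auto simp: not_less) (metis norm_le_zero_iff order_trans)
    then have "cball (0::'a) r \<in> null_sets lborel"
      by (intro finite_imp_null_set_lborel) (rule finite_subset, auto)
    then have "AE x in lborel. x \<notin> cball (0::'a) r"
      by (rule AE_not_in)
    then have "(\<integral>\<^sup>+x. ennreal (Q x) * indicator (cball 0 r) x \<partial>lborel) = (\<integral>\<^sup>+x. 0 \<partial>(lborel::'a measure))"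
      by (intro nn_integral_cong_AE) (auto simp: indicator_def)
    with False show ?thesis unfolding M by (simp add: max_def power_0_left)
  qed
  have "emeasure ?N {..r} = ennreal (max 0 r ^ DIM('a) * q)" for r
  proof (cases "r \<ge> 0")
    case True
    have *: "ennreal (q / v) * ennreal (v * x) = ennreal (x * q)" if "v > 0" "x \<ge> 0" for v x
      using that q0 by (simp add: ennreal_mult[symmetric])
    show ?thesis unfolding N using True
      by (simp add: nn_integral_cmult emeasure_cball *)
  next
    case False
    then show ?thesis unfolding N by (simp add: max_def power_0_left)
  qed
  with val show ?thesis
    by (intro borel_measure_eqI_atMost) auto
qed

text \<open>Polar coordinates without a surface measure: for a 0-homogeneous \<open>Q\<close> the
  mean over the unit ball serves as the spherical mean, and only the push-forward under the norm
  enters.\<close>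

lemma radial_integral_average:
  fixes Q :: "'a::euclidean_space \<Rightarrow> real" and g :: "real \<Rightarrow> real"
  assumes Q[measurable]: "Q \<in> borel_measurable borel" and hom: "\<And>c x. c > 0 \<Longrightarrow> Q (c *\<^sub>R x) = Q x"
    and bd: "\<And>x. \<bar>Q x\<bar> \<le> K" and g[measurable]: "g \<in> borel_measurable borel"
    and int: "integrable lborel (\<lambda>x::'a. g (norm x))"
  shows "(LINT x|lborel. Q x * g (norm x)) =
    (LINT x|lborel. Q x * indicator (cball 0 1) x) / unit_ball_vol (DIM('a)) * (LINT x::'a|lborel. g (norm x))"
proof -
  let ?V = "unit_ball_vol (DIM('a))"
  let ?A = "\<lambda>Q::'a \<Rightarrow> real. (LINT x|lborel. Q x * indicator (cball 0 1) x) / ?V"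
  have pos: "(LINT x|lborel. P x * g (norm x)) = ?A P * (LINT x::'a|lborel. g (norm x))"
    if [measurable]: "P \<in> borel_measurable borel" and "\<And>c x. c > 0 \<Longrightarrow> P (c *\<^sub>R x) = P x"
      and nn: "\<And>x. P x \<ge> 0" "\<And>x. P x \<le> L" for P :: "'a \<Rightarrow> real" and L
  proof -
    have A: "?A P \<ge> 0" using nn by (intro divide_nonneg_nonneg integral_nonneg_AE) auto
    have "(LINT x|lborel. P x * g (norm x)) = integral\<^sup>L (density lborel (\<lambda>x. ennreal (P x))) (\<lambda>x. g (norm x))"
      using nn by (subst integral_density) auto
    also have "\<dots> = integral\<^sup>L (distr (density lborel (\<lambda>x. ennreal (P x))) borel norm) g"
      by (subst integral_distr) auto
    also have "\<dots> = integral\<^sup>L (distr (density lborel (\<lambda>x::'a. ennreal (?A P))) borel norm) g"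
      using distr_norm_homogeneous[of P L] that by simp
    also have "\<dots> = integral\<^sup>L (density lborel (\<lambda>x::'a. ennreal (?A P))) (\<lambda>x. g (norm x))"
      by (subst integral_distr) auto
    also have "\<dots> = (LINT x::'a|lborel. ?A P * g (norm x))"
      using A by (subst integral_density) auto
    finally show ?thesis by simp
  qed
  have i1: "integrable lborel (\<lambda>x::'a. Q x * indicator (cball 0 1) x)"
    using Q bd by (rule integrable_mult_indicator_cball)
  have i2: "integrable lborel (\<lambda>x. Q x * g (norm x))"
    by (rule Bochner_Integration.integrable_bound[where f = "\<lambda>x. K * g (norm x)"])
      (auto simp: abs_mult intro!: integrable_mult_right int mult_right_mono order_trans[OF bd])
  \<comment> \<open>Densities have to be nonnegative, so the identity is applied to
    \<open>Q + K\<close>; the constant \<open>K\<close>, whose mean over the ball is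
    \<open>K\<close>, is subtracted afterwards.\<close>
  have "0 \<le> Q x + K \<and> Q x + K \<le> 2 * K" for x
    using bd[of x] by linarith
  then have "(LINT x|lborel. (Q x + K) * g (norm x)) = ?A (\<lambda>x. Q x + K) * (LINT x::'a|lborel. g (norm x))"
    by (intro pos[where L = "2 * K"]) (auto simp: hom)
  also have "?A (\<lambda>x. Q x + K) = ?A Q + K"
  proof -
    have "(LINT x::'a|lborel. (Q x + K) * indicator (cball 0 1) x) =
      (LINT x::'a|lborel. Q x * indicator (cball 0 1) x + K * indicator (cball 0 1) x)"
      by (simp add: algebra_simps)
    also have "\<dots> = (LINT x::'a|lborel. Q x * indicator (cball 0 1) x) + K * ?V"
      using i1 by (subst Bochner_Integration.integral_add)
        (auto intro!: integrable_mult_right integrable_indicator_cball simp: measure_def emeasure_cball)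
    finally have "(LINT x::'a|lborel. (Q x + K) * indicator (cball 0 1) x) =
      (LINT x::'a|lborel. Q x * indicator (cball 0 1) x) + K * ?V" .
    moreover have "?V \<noteq> 0" by (metis less_irrefl of_nat_0_le_iff unit_ball_vol_pos)
    ultimately show ?thesis by (simp add: add_divide_distrib)
  qed
  also have "(LINT x|lborel. (Q x + K) * g (norm x)) = (LINT x|lborel. Q x * g (norm x)) + K * (LINT x::'a|lborel. g (norm x))"
    using i2 int by (simp add: distrib_right)
  finally show ?thesis by (simp add: algebra_simps)
qed

section \<open>Radial integrals of powers against \<open>exp (- \<tau> |x|^a)\<close>\<close>

lemma distr_norm_powr:
  assumes a: "a > 0" and tau: "\<tau> > 0"
  shows "distr lborel borel (\<lambda>x::'a::euclidean_space. \<tau> * norm x powr a) =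
    density lborel (\<lambda>u. ennreal (unit_ball_vol (DIM('a)) * DIM('a) / a * \<tau> powr (- (DIM('a) / a)) * (indicator {0..} u * u powr (DIM('a) / a - 1))))"
    (is "?M = density lborel (\<lambda>u. ennreal (?C * _))")
proof -
  let ?s = "DIM('a) / a"
  have s: "?s > 0" using a by simp
  have C: "?C \<ge> 0" using a by simp
  have null: "emeasure lborel {0::'a} = 0" by simp
  \<comment> \<open>The preimage of \<open>{..u}\<close> is a ball of radius
    \<open>(u/\<tau>)^(1/a)\<close>, of volume proportional to \<open>(u/\<tau>)^(N/a)\<close>; the
    claimed density is the derivative of this volume in \<open>u\<close>.\<close>
  have M: "emeasure ?M {..u} = ennreal (unit_ball_vol (DIM('a)) * (max 0 u / \<tau>) powr ?s)" for u
  proof (cases "u \<ge> 0")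
    case True
    have "(\<lambda>x::'a. \<tau> * norm x powr a) -` {..u} = cball 0 ((u / \<tau>) powr (1 / a))"
    proof (rule set_eqI)
      fix x :: 'a
      have "\<tau> * norm x powr a \<le> u \<longleftrightarrow> norm x powr a \<le> u / \<tau>"
        using tau by (simp add: field_simps)
      also have "\<dots> \<longleftrightarrow> (norm x powr a) powr (1 / a) \<le> (u / \<tau>) powr (1 / a)"
      proof
        show "(norm x powr a) powr (1 / a) \<le> (u / \<tau>) powr (1 / a)" if "norm x powr a \<le> u / \<tau>"
          using that a by (intro powr_mono2) auto
        show "norm x powr a \<le> u / \<tau>" if "(norm x powr a) powr (1 / a) \<le> (u / \<tau>) powr (1 / a)"
        proof (rule ccontr)
          assume "\<not> norm x powr a \<le> u / \<tau>"
          then have "(u / \<tau>) powr (1 / a) < (norm x powr a) powr (1 / a)"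
            using a True tau by (intro powr_less_mono2) auto
          with that show False by simp
        qed
      qed
      also have "(norm x powr a) powr (1 / a) = norm x" using a by (simp add: powr_powr)
      finally show "x \<in> (\<lambda>x::'a. \<tau> * norm x powr a) -` {..u} \<longleftrightarrow> x \<in> cball 0 ((u / \<tau>) powr (1 / a))" by simp
    qed
    then have "emeasure ?M {..u} = emeasure lborel (cball (0::'a) ((u / \<tau>) powr (1 / a)))"
      by (subst emeasure_distr) auto
    also have "\<dots> = ennreal (unit_ball_vol (DIM('a)) * ((u / \<tau>) powr (1 / a)) ^ DIM('a))"
      by (rule emeasure_cball) simp
    also have "((u / \<tau>) powr (1 / a)) ^ DIM('a) = (u / \<tau>) powr ?s"
      using True tau by (cases "u = 0") (simp_all add: powr_realpow[symmetric] powr_powr s)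
    finally show ?thesis using True by simp
  next
    case False
    then have "(\<lambda>x::'a. \<tau> * norm x powr a) -` {..u} = {}"
      using tau by (auto simp: not_le dest: order.strict_trans1) (metis less_eq_real_def linorder_not_less mult_nonneg_nonneg order_le_less_trans powr_ge_zero)
    then show ?thesis using False by (subst emeasure_distr) auto
  qed
  have N: "emeasure (density lborel (\<lambda>u. ennreal (?C * (indicator {0..} u * u powr (?s - 1))))) {..u} =
     ennreal (unit_ball_vol (DIM('a)) * (max 0 u / \<tau>) powr ?s)" for u
  proof (cases "u \<ge> 0")
    case True
    have "emeasure (density lborel (\<lambda>u. ennreal (?C * (indicator {0..} u * u powr (?s - 1))))) {..u} =
      (\<integral>\<^sup>+v. ennreal ?C * (ennreal (v powr (?s - 1)) * indicator {0..u} v) \<partial>lborel)"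
      using C by (subst emeasure_density)
        (auto intro!: nn_integral_cong split: split_indicator simp flip: ennreal_mult'')
    also have "\<dots> = ennreal ?C * (\<integral>\<^sup>+v. ennreal (v powr (?s - 1)) * indicator {0..u} v \<partial>lborel)"
      by (rule nn_integral_cmult) auto
    also have "(\<integral>\<^sup>+v. ennreal (v powr (?s - 1)) * indicator {0..u} v \<partial>lborel) = ennreal (u powr ?s / ?s)"
      using has_integral_powr_from_0[of "?s - 1" u] s True
      by (intro nn_integral_has_integral_lebesgue') auto
    also have "ennreal ?C * \<dots> = ennreal (?C * (u powr ?s / ?s))"
      using C by (rule ennreal_mult'[symmetric])
    also have "?C * (u powr ?s / ?s) = unit_ball_vol (DIM('a)) * (max 0 u / \<tau>) powr ?s"
      using True tau a by (simp add: powr_divide powr_minus field_simps)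
    finally show ?thesis .
  next
    case False
    then show ?thesis 
      by (subst emeasure_density) (auto simp: nn_integral_0_iff_AE indicator_def)
  qed
  show ?thesis
  proof (rule borel_measure_eqI_atMost)
    show "emeasure ?M {..r} = emeasure (density lborel (\<lambda>u. ennreal (?C * (indicator {0..} u * u powr (?s - 1))))) {..r}" for r
      by (simp only: M N)
    show "emeasure ?M {..r} \<noteq> \<infinity>" for r
      by (simp only: M) simp
  qed simp_all
qed

text \<open>In the variable \<open>u = \<tau> |x|^a\<close>, whose density is proportional to
  \<open>u^(N/a - 1)\<close>, the integral is Euler's integral for
  \<open>Gamma ((\<kappa> + N)/a)\<close>. The condition \<open>\<kappa> + N > 0\<close> is
  integrability at the origin.\<close>

lemma has_bochner_integral_norm_powr_exp:
  assumes a: "a > 0" and tau: "\<tau> > 0" and k: "(\<kappa>::real) + DIM('a) > 0"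
  shows "has_bochner_integral lborel (\<lambda>x::'a::euclidean_space. norm x powr \<kappa> * exp (- \<tau> * norm x powr a))
    (unit_ball_vol (DIM('a)) * DIM('a) / a * \<tau> powr (- ((\<kappa> + DIM('a)) / a)) * Gamma ((\<kappa> + DIM('a)) / a))"
proof (rule has_bochner_integral_nn_integral)
  let ?s = "DIM('a) / a" and ?z = "(\<kappa> + DIM('a)) / a"
  define C where "C = unit_ball_vol (DIM('a)) * DIM('a) / a * \<tau> powr (- ?s)"
  have z: "?z > 0" using a k by simp
  have C: "C \<ge> 0" using a by (simp add: C_def)
  have "(\<integral>\<^sup>+x. ennreal (norm x powr \<kappa> * exp (- \<tau> * norm x powr a)) \<partial>(lborel::'a measure)) =
    (\<integral>\<^sup>+x. ennreal (((\<tau> * norm x powr a) / \<tau>) powr (\<kappa> / a) * exp (- (\<tau> * norm x powr a))) \<partial>(lborel::'a measure))"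
    using a tau by (simp add: powr_powr)
  also have "\<dots> = (\<integral>\<^sup>+u. ennreal ((u / \<tau>) powr (\<kappa> / a) * exp (- u)) \<partial>(distr lborel borel (\<lambda>x::'a. \<tau> * norm x powr a)))"
    by (subst nn_integral_distr) auto
  also have "\<dots> = (\<integral>\<^sup>+u. ennreal (C * (indicator {0..} u * u powr (?s - 1))) * ennreal ((u / \<tau>) powr (\<kappa> / a) * exp (- u)) \<partial>lborel)"
    unfolding distr_norm_powr[OF a tau] C_def by (subst nn_integral_density) auto
  also have "\<dots> = (\<integral>\<^sup>+u. ennreal (C * \<tau> powr (- (\<kappa> / a))) * ennreal (indicator {0..} u * u powr (?z - 1) / exp u) \<partial>lborel)"
  proof (intro nn_integral_cong)
    fix u :: real
    have "u powr (?z - 1) = u powr (?s - 1) * u powr (\<kappa> / a)" 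
      by (simp add: powr_add[symmetric] add_divide_distrib algebra_simps)
    then show "ennreal (C * (indicator {0..} u * u powr (?s - 1))) * ennreal ((u / \<tau>) powr (\<kappa> / a) * exp (- u)) =
       ennreal (C * \<tau> powr (- (\<kappa> / a))) * ennreal (indicator {0..} u * u powr (?z - 1) / exp u)"
      using C tau by (cases "u \<ge> 0")
       (simp_all add: ennreal_mult[symmetric] powr_divide powr_minus exp_minus field_simps)
  qed
  also have "\<dots> = ennreal (C * \<tau> powr (- (\<kappa> / a))) * ennreal (Gamma ?z)"
    by (subst nn_integral_cmult) (auto simp: Gamma_conv_nn_integral_real[OF z])
  also have "\<dots> = ennreal (C * \<tau> powr (- (\<kappa> / a)) * Gamma ?z)"
    using C z by (subst ennreal_mult) auto
  also have "C * \<tau> powr (- (\<kappa> / a)) = unit_ball_vol (DIM('a)) * DIM('a) / a * \<tau> powr (- ?z)"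
    proof -
    have "- ?z = - ?s + - (\<kappa> / a)" by (simp add: add_divide_distrib)
    then have "\<tau> powr (- ?z) = \<tau> powr (- ?s) * \<tau> powr (- (\<kappa> / a))" by (simp only: powr_add)
    then show ?thesis by (simp add: C_def)
  qed
  finally show "(\<integral>\<^sup>+x. ennreal (norm x powr \<kappa> * exp (- \<tau> * norm x powr a)) \<partial>(lborel::'a measure)) =
    ennreal (unit_ball_vol (DIM('a)) * DIM('a) / a * \<tau> powr (- ?z) * Gamma ?z)" .
  show "0 \<le> unit_ball_vol (DIM('a)) * DIM('a) / a * \<tau> powr (- ?z) * Gamma ?z"
    using a z by (intro mult_nonneg_nonneg divide_nonneg_nonneg) (auto simp: less_imp_le)
qed auto

section \<open>Gaussian moments\<close>

text \<open>Strong induction: when the lower coefficients vanish, division by \<open>x ^ n\<close>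
  and the limit \<open>x \<rightarrow> 0\<close> single out \<open>c n\<close>.\<close>

lemma powser_sums_zero_imp_coeff_zero:
  fixes c :: "nat \<Rightarrow> real"
  assumes "\<And>x. (\<lambda>n. c n * x ^ n) sums 0"
  shows "c n = 0"
proof (induction n rule: less_induct)
  case (less n)
  have "(\<lambda>j. c (j + n) * x ^ j) sums 0" if "x \<noteq> 0" for x
  proof -
    have "(\<lambda>j. c (j + n) * x ^ (j + n)) sums 0"
      using assms[of x] less by (subst sums_zero_iff_shift) auto
    from sums_mult[OF this, of "1 / x ^ n"] show ?thesis
      using that by (simp add: power_add)
  qed
  then have "((\<lambda>x. 0) \<longlongrightarrow> c (0 + n)) (at (0::real))"
    by (intro powser_limit_0_strong[of 1 "\<lambda>j. c (j + n)"]) auto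
  then show "c n = 0" by (simp add: tendsto_const_iff)
qed

lemma powser_sums_unique:
  fixes c d :: "nat \<Rightarrow> real"
  assumes "\<And>x. (\<lambda>n. c n * x ^ n) sums f x" "\<And>x. (\<lambda>n. d n * x ^ n) sums f x"
  shows "c n = d n"
proof -
  have "(\<lambda>n. (c n - d n) * x ^ n) sums 0" for x
    using sums_diff[OF assms(1)[of x] assms(2)[of x]] by (simp add: left_diff_distrib)
  from powser_sums_zero_imp_coeff_zero[OF this] show ?thesis by simp
qed

text \<open>These are the Taylor coefficients of \<open>exp (x^2/2)\<close>;
  \<open>fact j * gauss_coeff j\<close> is the \<open>j\<close>-th moment of a standard normal
  variable.\<close>

definition gauss_coeff :: "nat \<Rightarrow> real" where
  "gauss_coeff j = (if even j then 1 / (2 ^ (j div 2) * fact (j div 2)) else 0)"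

lemma gauss_coeff_sums: "(\<lambda>j. gauss_coeff j * x ^ j) sums exp (x\<^sup>2 / 2)"
proof -
  have "(\<lambda>n. (x\<^sup>2 / 2) ^ n /\<^sub>R fact n) sums exp (x\<^sup>2 / 2)"
    by (rule exp_converges)
  moreover have "(x\<^sup>2 / 2) ^ n /\<^sub>R fact n = gauss_coeff (2 * n) * x ^ (2 * n)" for n
    by (simp add: gauss_coeff_def power_mult[symmetric] power_divide field_simps)
  ultimately have "(\<lambda>n. gauss_coeff (2 * n) * x ^ (2 * n)) sums exp (x\<^sup>2 / 2)"
    by simp
  then show ?thesis
    by (subst (asm) sums_mono_reindex) (auto simp: strict_mono_def gauss_coeff_def elim!: evenE)
qed

definition gauss_weight :: "'a::euclidean_space \<Rightarrow> real" where
  "gauss_weight x = exp (- (norm x)\<^sup>2 / 2)"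

lemma gauss_weight_measurable [measurable]: "gauss_weight \<in> borel_measurable borel"
  unfolding gauss_weight_def by measurable

lemma integrable_norm_power_exp:
  assumes "c > 0"
  shows "integrable lborel (\<lambda>x::'a::euclidean_space. norm x ^ d * exp (- c * (norm x)\<^sup>2))"
proof -
  have "integrable lborel (\<lambda>x::'a. norm x powr d * exp (- c * norm x powr 2))"
    using has_bochner_integral_norm_powr_exp[of 2 c d, where 'a='a] assms
    by (auto simp: has_bochner_integral_iff add_nonneg_pos simp del: powr_numeral)
  then show ?thesis
  proof (rule integrable_cong_AE_imp)
    \<comment> \<open>For \<open>d = 0\<close> the two powers differ at the origin,
      \<open>0 ^ 0 = 1\<close> against \<open>0 powr 0 = 0\<close>, so the origin is discarded as a
      null set.\<close>
    show "AE x in lborel. norm (x::'a) powr d * exp (- c * norm x powr 2) = norm x ^ d * exp (- c * (norm x)\<^sup>2)"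
      using AE_lborel_singleton[of "0::'a"] by eventually_elim (simp add: powr_realpow)
  qed measurable
qed

text \<open>The weight is left unnormalized; its total mass \<open>radial_moment _ 0\<close> cancels
  once Gaussian moments are divided by radial ones.\<close>

definition radial_moment :: "'a::euclidean_space itself \<Rightarrow> nat \<Rightarrow> real" where
  "radial_moment _ d = (LINT x|lborel. norm (x::'a) ^ d * gauss_weight x)"

lemma radial_moment_eq:
  assumes "real DIM('a::euclidean_space) = 2 * \<nu> + 2"
  shows "radial_moment TYPE('a) d = unit_ball_vol DIM('a) * DIM('a) / 2 * 2 powr (d / 2 + \<nu> + 1) * Gamma (d / 2 + \<nu> + 1)"
proof -
  have "radial_moment TYPE('a) d = (LINT x::'a|lborel. norm x powr d * exp (- (1 / 2) * norm x powr 2))"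
    unfolding radial_moment_def
  proof (rule integral_cong_AE)
    show "AE x in lborel. norm (x::'a) ^ d * gauss_weight x = norm x powr d * exp (- (1 / 2) * norm x powr 2)"
      using AE_lborel_singleton[of "0::'a"] by eventually_elim (simp add: powr_realpow gauss_weight_def)
  qed measurable
  also have "\<dots> = unit_ball_vol DIM('a) * DIM('a) / 2 * (1 / 2) powr (- ((real d + DIM('a)) / 2)) * Gamma ((real d + DIM('a)) / 2)"
    by (rule has_bochner_integral_integral_eq[OF has_bochner_integral_norm_powr_exp]) (auto intro: add_nonneg_pos)
  also have "(real d + DIM('a)) / 2 = d / 2 + \<nu> + 1" using assms by simp
  also have "(1 / 2) powr (- z) = 2 powr z" for z :: real
    by (simp add: powr_divide powr_minus)
  finally show ?thesis .
qed

lemma radial_moment_pos: "radial_moment TYPE('a::euclidean_space) d > 0"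
proof -
  define \<nu> :: real where "\<nu> = DIM('a) / 2 - 1"
  have "real DIM('a) > 0" by simp
  then have \<nu>: "\<nu> > -1" unfolding \<nu>_def by linarith
  have "Gamma (d / 2 + \<nu> + 1) > 0"
    using \<nu> by (intro Gamma_real_pos) (auto intro: add_nonneg_pos)
  then show ?thesis
    by (subst radial_moment_eq[of \<nu>]) (auto simp: \<nu>_def intro!: mult_pos_pos divide_pos_pos)
qed

definition gauss_moment :: "nat \<Rightarrow> nat \<Rightarrow> 'a::euclidean_space \<Rightarrow> 'a \<Rightarrow> real" where
  "gauss_moment p q \<omega> \<eta> = (LINT x|lborel. (\<omega> \<bullet> x) ^ p * (\<eta> \<bullet> x) ^ q * gauss_weight x)"

lemma inner_unit_le: "norm \<omega> = 1 \<Longrightarrow> \<bar>\<omega> \<bullet> x\<bar> \<le> norm x"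
  using Cauchy_Schwarz_ineq2[of \<omega> x] by simp

lemma integrable_gauss_moment:
  fixes \<omega> \<eta> :: "'a::euclidean_space"
  assumes "norm \<omega> = 1" "norm \<eta> = 1"
  shows "integrable lborel (\<lambda>x. (\<omega> \<bullet> x) ^ p * (\<eta> \<bullet> x) ^ q * gauss_weight x)"
proof (rule Bochner_Integration.integrable_bound)
  show "integrable lborel (\<lambda>x::'a. norm x ^ (p + q) * exp (- (1 / 2) * (norm x)\<^sup>2))"
    by (rule integrable_norm_power_exp) simp
  have "\<bar>(\<omega> \<bullet> x) ^ p * (\<eta> \<bullet> x) ^ q\<bar> \<le> norm x ^ (p + q)" for x
    unfolding power_add abs_mult power_abs
    by (intro mult_mono power_mono inner_unit_le assms) auto
  then show "AE x in lborel. norm ((\<omega> \<bullet> x) ^ p * (\<eta> \<bullet> x) ^ q * gauss_weight x) \<le>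
     norm (norm x ^ (p + q) * exp (- (1 / 2) * (norm x)\<^sup>2))"
    by (intro AE_I2) (auto simp: gauss_weight_def abs_mult intro!: mult_right_mono)
qed measurable

text \<open>Expanding \<open>exp (\<alpha> * (\<omega> \<bullet> x))\<close> under the integral
  yields the exponential generating function of the moments in the variable
  \<open>p\<close>.\<close>

lemma gauss_moment_series:
  fixes \<omega> \<eta> :: "'a::euclidean_space"
  assumes u: "norm \<omega> = 1" "norm \<eta> = 1"
  shows "(\<lambda>p. gauss_moment p q \<omega> \<eta> / fact p * \<alpha> ^ p) sums
     (LINT x|lborel. exp (\<alpha> * (\<omega> \<bullet> x)) * (\<eta> \<bullet> x) ^ q * gauss_weight x)"
proof -
  let ?s = "\<lambda>n x. (\<Sum>p<n. (\<alpha> * (\<omega> \<bullet> x)) ^ p /\<^sub>R fact p) * ((\<eta> \<bullet> x) ^ q * gauss_weight x)"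
  let ?w = "\<lambda>x::'a. exp (\<alpha>\<^sup>2) * (norm x ^ q * exp (- (1 / 4) * (norm x)\<^sup>2))"
  have "(\<lambda>n. LINT x|lborel. ?s n x) \<longlonglongrightarrow> (LINT x|lborel. exp (\<alpha> * (\<omega> \<bullet> x)) * ((\<eta> \<bullet> x) ^ q * gauss_weight x))"
  proof (rule integral_dominated_convergence)
    show "integrable lborel ?w"
      by (rule integrable_mult_right, rule integrable_norm_power_exp) simp
    show "AE x in lborel. (\<lambda>n. ?s n x) \<longlonglongrightarrow> exp (\<alpha> * (\<omega> \<bullet> x)) * ((\<eta> \<bullet> x) ^ q * gauss_weight x)"
    proof (rule AE_I2)
      fix x :: 'a
      show "(\<lambda>n. ?s n x) \<longlonglongrightarrow> exp (\<alpha> * (\<omega> \<bullet> x)) * ((\<eta> \<bullet> x) ^ q * gauss_weight x)"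
        using exp_converges[of "\<alpha> * (\<omega> \<bullet> x)"] by (intro tendsto_mult_right) (simp add: sums_def)
    qed
    show "AE x in lborel. norm (?s n x) \<le> ?w x" for n
    proof (rule AE_I2)
      fix x :: 'a
      have "\<bar>\<Sum>p<n. (\<alpha> * (\<omega> \<bullet> x)) ^ p /\<^sub>R fact p\<bar> \<le> (\<Sum>p<n. (\<bar>\<alpha>\<bar> * norm x) ^ p /\<^sub>R fact p)"
        by (rule order_trans[OF sum_abs])
          (auto intro!: sum_mono mult_left_mono power_mono mult_left_mono inner_unit_le u simp: abs_mult power_abs)
      also have "\<dots> \<le> exp (\<bar>\<alpha>\<bar> * norm x)"
        unfolding exp_def using summable_exp_generic[of "\<bar>\<alpha>\<bar> * norm x"] by (intro sum_le_suminf) auto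
      \<comment> \<open>By \<open>|\<alpha>| |x| \<le> \<alpha>^2 + |x|^2/4\<close> only half of the
        Gaussian exponent is spent, and \<open>exp (- |x|^2/4)\<close> remains for the
        majorant.\<close>
      also have "\<dots> \<le> exp (\<alpha>\<^sup>2 + (norm x)\<^sup>2 / 4)"
      proof -
        have "0 \<le> (\<bar>\<alpha>\<bar> - norm x / 2)\<^sup>2" by simp
        also have "\<dots> = \<alpha>\<^sup>2 + (norm x)\<^sup>2 / 4 - \<bar>\<alpha>\<bar> * norm x" by (simp add: power2_eq_square field_simps)
        finally show ?thesis by simp
      qed
      finally have "\<bar>\<Sum>p<n. (\<alpha> * (\<omega> \<bullet> x)) ^ p /\<^sub>R fact p\<bar> * (\<bar>\<eta> \<bullet> x\<bar> ^ q * gauss_weight x) \<le>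
         exp (\<alpha>\<^sup>2 + (norm x)\<^sup>2 / 4) * (norm x ^ q * gauss_weight x)"
        by (intro mult_mono power_mono inner_unit_le u) (auto simp: gauss_weight_def)
      also have "\<dots> = ?w x"
        by (simp add: gauss_weight_def exp_add[symmetric] mult_ac)
      finally show "norm (?s n x) \<le> ?w x"
        by (simp add: abs_mult power_abs gauss_weight_def)
    qed
  qed measurable
  moreover have "(LINT x|lborel. ?s n x) = (\<Sum>p<n. gauss_moment p q \<omega> \<eta> / fact p * \<alpha> ^ p)" for n
  proof -
    have "(LINT x|lborel. ?s n x) = (LINT x|lborel. (\<Sum>p<n. (\<alpha> ^ p / fact p) * ((\<omega> \<bullet> x) ^ p * (\<eta> \<bullet> x) ^ q * gauss_weight x)))"
      by (simp add: sum_distrib_right sum_distrib_left power_mult_distrib divide_inverse mult_ac)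
    also have "\<dots> = (\<Sum>p<n. (LINT x|lborel. (\<alpha> ^ p / fact p) * ((\<omega> \<bullet> x) ^ p * (\<eta> \<bullet> x) ^ q * gauss_weight x)))"
      by (intro Bochner_Integration.integral_sum integrable_mult_right integrable_gauss_moment u)
    also have "\<dots> = (\<Sum>p<n. gauss_moment p q \<omega> \<eta> / fact p * \<alpha> ^ p)"
      unfolding gauss_moment_def by (intro sum.cong refl) simp
    finally show ?thesis .
  qed
  ultimately show ?thesis by (simp add: sums_def mult.assoc)
qed

text \<open>Completing the square: \<open>e\<^bsup>\<alpha>\<omega>x\<^esup> e\<^bsup>-x\<^sup>2/2\<^esup> = e\<^bsup>\<alpha>\<^sup>2/2\<^esup> e\<^bsup>-(x - \<alpha>\<omega>)\<^sup>2/2\<^esup>\<close>.\<close>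

lemma gauss_moment_translate:
  fixes \<omega> \<eta> :: "'a::euclidean_space"
  assumes u: "norm \<omega> = 1" "norm \<eta> = 1"
  shows "(LINT x|lborel. exp (\<alpha> * (\<omega> \<bullet> x)) * (\<eta> \<bullet> x) ^ q * gauss_weight x) =
    exp (\<alpha>\<^sup>2 / 2) * (\<Sum>i\<le>q. real (q choose i) * (\<alpha> * (\<omega> \<bullet> \<eta>)) ^ i * gauss_moment 0 (q - i) \<omega> \<eta>)"
proof -
  let ?f = "\<lambda>x::'a. exp (\<alpha> * (\<omega> \<bullet> x)) * (\<eta> \<bullet> x) ^ q * gauss_weight x"
  have "(LINT x|lborel. ?f x) = (LINT x|distr lborel borel (\<lambda>x. \<alpha> *\<^sub>R \<omega> + x). ?f x)"
    using lborel_affine[of 1 "\<alpha> *\<^sub>R \<omega>"] by (simp add: density_1)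
  also have "\<dots> = (LINT x|lborel. ?f (\<alpha> *\<^sub>R \<omega> + x))"
    by (rule integral_distr) measurable
  also have "\<dots> = (LINT x|lborel. exp (\<alpha>\<^sup>2 / 2) * (\<Sum>i\<le>q. real (q choose i) * (\<alpha> * (\<omega> \<bullet> \<eta>)) ^ i * ((\<omega> \<bullet> x) ^ 0 * (\<eta> \<bullet> x) ^ (q - i) * gauss_weight x)))"
  proof (rule Bochner_Integration.integral_cong[OF refl])
    fix x :: 'a
    have "\<omega> \<bullet> \<omega> = 1" using u by (simp add: dot_square_norm)
    then have n: "(norm (\<alpha> *\<^sub>R \<omega> + x))\<^sup>2 = \<alpha>\<^sup>2 + 2 * \<alpha> * (\<omega> \<bullet> x) + (norm x)\<^sup>2" and
      i: "\<alpha> * (\<omega> \<bullet> (\<alpha> *\<^sub>R \<omega> + x)) = \<alpha>\<^sup>2 + \<alpha> * (\<omega> \<bullet> x)"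
      unfolding power2_norm_eq_inner by (simp_all add: inner_add_left inner_add_right inner_commute power2_eq_square algebra_simps)
    have e: "exp (\<alpha> * (\<omega> \<bullet> (\<alpha> *\<^sub>R \<omega> + x))) * gauss_weight (\<alpha> *\<^sub>R \<omega> + x) = exp (\<alpha>\<^sup>2 / 2) * gauss_weight x"
      unfolding gauss_weight_def n i exp_add[symmetric] by (simp add: field_simps)
    have b: "(\<eta> \<bullet> (\<alpha> *\<^sub>R \<omega> + x)) ^ q = (\<Sum>i\<le>q. real (q choose i) * (\<alpha> * (\<omega> \<bullet> \<eta>)) ^ i * (\<eta> \<bullet> x) ^ (q - i))"
      by (simp add: inner_add_right binomial_ring inner_commute)
    have "?f (\<alpha> *\<^sub>R \<omega> + x) = (exp (\<alpha> * (\<omega> \<bullet> (\<alpha> *\<^sub>R \<omega> + x))) * gauss_weight (\<alpha> *\<^sub>R \<omega> + x)) * (\<eta> \<bullet> (\<alpha> *\<^sub>R \<omega> + x)) ^ q"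
      by (simp only: mult_ac)
    also have "\<dots> = exp (\<alpha>\<^sup>2 / 2) * (\<Sum>i\<le>q. real (q choose i) * (\<alpha> * (\<omega> \<bullet> \<eta>)) ^ i * ((\<omega> \<bullet> x) ^ 0 * (\<eta> \<bullet> x) ^ (q - i) * gauss_weight x))"
      unfolding e b by (simp add: sum_distrib_left sum_distrib_right mult_ac)
    finally show "?f (\<alpha> *\<^sub>R \<omega> + x) = exp (\<alpha>\<^sup>2 / 2) * (\<Sum>i\<le>q. real (q choose i) * (\<alpha> * (\<omega> \<bullet> \<eta>)) ^ i * ((\<omega> \<bullet> x) ^ 0 * (\<eta> \<bullet> x) ^ (q - i) * gauss_weight x))" .
  qed
  also have "\<dots> = exp (\<alpha>\<^sup>2 / 2) * (\<Sum>i\<le>q. real (q choose i) * (\<alpha> * (\<omega> \<bullet> \<eta>)) ^ i * gauss_moment 0 (q - i) \<omega> \<eta>)"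
    unfolding gauss_moment_def
    by (subst integral_mult_right_zero, subst Bochner_Integration.integral_sum)
      (auto intro!: integrable_mult_right integrable_gauss_moment[OF u, of 0, simplified])
  finally show ?thesis .
qed

text \<open>The same function of \<open>\<alpha>\<close> has two power series:
  \<open>gauss_moment_series\<close>, and \<open>exp (\<alpha>^2/2)\<close> times the polynomial of
  \<open>gauss_moment_translate\<close>. Their coefficients of \<open>\<alpha>^p\<close> are
  compared.\<close>

lemma gauss_moment_expansion:
  fixes \<omega> \<eta> :: "'a::euclidean_space"
  assumes u: "norm \<omega> = 1" "norm \<eta> = 1"
  shows "gauss_moment p q \<omega> \<eta> / fact p =
    (\<Sum>i\<le>q. real (q choose i) * (\<omega> \<bullet> \<eta>) ^ i * gauss_moment 0 (q - i) \<omega> \<eta> * (if i \<le> p then gauss_coeff (p - i) else 0))"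
proof (rule powser_sums_unique[where c = "\<lambda>p. gauss_moment p q \<omega> \<eta> / fact p" and n = p and
    d = "\<lambda>p. \<Sum>i\<le>q. real (q choose i) * (\<omega> \<bullet> \<eta>) ^ i * gauss_moment 0 (q - i) \<omega> \<eta> * (if i \<le> p then gauss_coeff (p - i) else 0)"])
  fix \<alpha> :: real
  show "(\<lambda>p. gauss_moment p q \<omega> \<eta> / fact p * \<alpha> ^ p) sums
    (exp (\<alpha>\<^sup>2 / 2) * (\<Sum>i\<le>q. real (q choose i) * (\<alpha> * (\<omega> \<bullet> \<eta>)) ^ i * gauss_moment 0 (q - i) \<omega> \<eta>))"
    using gauss_moment_series[OF u] gauss_moment_translate[OF u] by simp
  have shift: "(\<lambda>p. (if i \<le> p then gauss_coeff (p - i) else 0) * \<alpha> ^ p) sums (\<alpha> ^ i * exp (\<alpha>\<^sup>2 / 2))" for i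
  proof (subst sums_zero_iff_shift[of i, symmetric])
    show "(\<lambda>p. (if i \<le> p + i then gauss_coeff (p + i - i) else 0) * \<alpha> ^ (p + i)) sums (\<alpha> ^ i * exp (\<alpha>\<^sup>2 / 2))"
      using sums_mult[OF gauss_coeff_sums[of \<alpha>], of "\<alpha> ^ i"] by (simp add: power_add mult_ac)
  qed auto
  have "(\<lambda>p. (\<Sum>i\<le>q. (real (q choose i) * (\<omega> \<bullet> \<eta>) ^ i * gauss_moment 0 (q - i) \<omega> \<eta>) * ((if i \<le> p then gauss_coeff (p - i) else 0) * \<alpha> ^ p)))
    sums (\<Sum>i\<le>q. (real (q choose i) * (\<omega> \<bullet> \<eta>) ^ i * gauss_moment 0 (q - i) \<omega> \<eta>) * (\<alpha> ^ i * exp (\<alpha>\<^sup>2 / 2)))"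
    by (intro sums_sum sums_mult shift)
  then show "(\<lambda>p. (\<Sum>i\<le>q. real (q choose i) * (\<omega> \<bullet> \<eta>) ^ i * gauss_moment 0 (q - i) \<omega> \<eta> * (if i \<le> p then gauss_coeff (p - i) else 0)) * \<alpha> ^ p)
    sums (exp (\<alpha>\<^sup>2 / 2) * (\<Sum>i\<le>q. real (q choose i) * (\<alpha> * (\<omega> \<bullet> \<eta>)) ^ i * gauss_moment 0 (q - i) \<omega> \<eta>))"
    by (simp add: sum_distrib_left sum_distrib_right power_mult_distrib mult_ac)
qed

text \<open>This is Wick's formula: \<open>i\<close> counts the pairings of a factor
  \<open>\<omega> \<bullet> x\<close> with a factor \<open>\<eta> \<bullet> x\<close>, the remaining
  factors being paired among their own kind.\<close>

lemma gauss_moment_eq: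
  fixes \<omega> \<eta> :: "'a::euclidean_space"
  assumes u: "norm \<omega> = 1" "norm \<eta> = 1"
  shows "gauss_moment p q \<omega> \<eta> = radial_moment TYPE('a) 0 * fact p * fact q *
    (\<Sum>i\<le>q. (if i \<le> p then gauss_coeff (p - i) * gauss_coeff (q - i) * (\<omega> \<bullet> \<eta>) ^ i / fact i else 0))"
proof -
  have m0: "gauss_moment 0 k \<omega> \<eta> = fact k * gauss_coeff k * radial_moment TYPE('a) 0" for k
  proof -
    \<comment> \<open>With the two vectors exchanged, the expansion has \<open>q = 0\<close> and
      thus a single term, which evaluates the moments of one linear form.\<close>
    have "gauss_moment 0 k \<omega> \<eta> = gauss_moment k 0 \<eta> \<omega>" by (simp add: gauss_moment_def)
    also have "\<dots> = fact k * (gauss_moment k 0 \<eta> \<omega> / fact k)" by simp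
    also have "gauss_moment k 0 \<eta> \<omega> / fact k = gauss_moment 0 0 \<eta> \<omega> * gauss_coeff k"
      by (subst gauss_moment_expansion) (simp_all add: u)
    also have "gauss_moment 0 0 \<eta> \<omega> = radial_moment TYPE('a) 0"
      by (simp add: gauss_moment_def radial_moment_def)
    finally show ?thesis by simp
  qed
  have "gauss_moment p q \<omega> \<eta> = fact p * (gauss_moment p q \<omega> \<eta> / fact p)" by simp
  also have "\<dots> = fact p * (\<Sum>i\<le>q. real (q choose i) * (\<omega> \<bullet> \<eta>) ^ i * gauss_moment 0 (q - i) \<omega> \<eta> * (if i \<le> p then gauss_coeff (p - i) else 0))"
    by (subst gauss_moment_expansion[OF u]) (rule refl)
  also have "\<dots> = fact p * (\<Sum>i\<le>q. radial_moment TYPE('a) 0 * fact q * (if i \<le> p then gauss_coeff (p - i) * gauss_coeff (q - i) * (\<omega> \<bullet> \<eta>) ^ i / fact i else 0))"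
  proof (rule arg_cong2[where f = "(*)"], rule refl, rule sum.cong, rule refl)
    fix i assume "i \<in> {..q}"
    then have b: "real (q choose i) * fact (q - i) = fact q / fact i" by (simp add: binomial_fact)
    have "real (q choose i) * (\<omega> \<bullet> \<eta>) ^ i * gauss_moment 0 (q - i) \<omega> \<eta> * g =
      (real (q choose i) * fact (q - i)) * (radial_moment TYPE('a) 0 * (g * gauss_coeff (q - i) * (\<omega> \<bullet> \<eta>) ^ i))" for g
      unfolding m0 by (simp only: mult_ac)
    then show "real (q choose i) * (\<omega> \<bullet> \<eta>) ^ i * gauss_moment 0 (q - i) \<omega> \<eta> * (if i \<le> p then gauss_coeff (p - i) else 0) =
      radial_moment TYPE('a) 0 * fact q * (if i \<le> p then gauss_coeff (p - i) * gauss_coeff (q - i) * (\<omega> \<bullet> \<eta>) ^ i / fact i else 0)"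
      unfolding b by simp
  qed
  finally show ?thesis by (simp add: sum_distrib_left mult_ac)
qed

section \<open>Orthogonality of zonal functions\<close>

lemma alternating_binomial_sum_Suc:
  fixes f :: "nat \<Rightarrow> real"
  shows "(\<Sum>k\<le>Suc L. (-1) ^ k * real (Suc L choose k) * f k) =
    (\<Sum>k\<le>L. (-1) ^ k * real (L choose k) * f k) - (\<Sum>k\<le>L. (-1) ^ k * real (L choose k) * f (Suc k))"
proof -
  have "(\<Sum>k\<le>Suc L. (-1) ^ k * real (Suc L choose k) * f k) =
    f 0 + (\<Sum>k\<le>L. (-1) ^ Suc k * real (L choose Suc k) * f (Suc k)) - (\<Sum>k\<le>L. (-1) ^ k * real (L choose k) * f (Suc k))"
    by (subst sum.atMost_Suc_shift) (simp add: sum_subtractf[symmetric] algebra_simps sum.distrib[symmetric] del: sum.atMost_Suc)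
  also have "f 0 + (\<Sum>k\<le>L. (-1) ^ Suc k * real (L choose Suc k) * f (Suc k)) = (\<Sum>k\<le>Suc L. (-1) ^ k * real (L choose k) * f k)"
    by (subst sum.atMost_Suc_shift) simp
  also have "\<dots> = (\<Sum>k\<le>L. (-1) ^ k * real (L choose k) * f k)"
    by simp
  finally show ?thesis .
qed

text \<open>Up to sign the sum is an \<open>L\<close>-th finite difference, computed by induction
  through Pascal's rule. If \<open>\<alpha> - \<beta>\<close> is a natural number below
  \<open>L\<close>, the ratio is a polynomial in \<open>k\<close> of degree less than
  \<open>L\<close> and the product vanishes; orthogonality rests on this.\<close>

lemma alternating_Gamma_ratio_sum:
  fixes \<alpha> \<beta> :: real
  assumes "\<alpha> > real L" "\<beta> > real L"
  shows "(\<Sum>k\<le>L. (-1) ^ k * real (L choose k) * (Gamma (\<alpha> - k) / Gamma (\<beta> - k))) =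
    (\<Prod>j<L. \<alpha> - \<beta> - real j) * Gamma (\<alpha> - L) / Gamma \<beta>"
  using assms
proof (induction L arbitrary: \<alpha> \<beta>)
  case (Suc L)
  have IH1: "(\<Sum>k\<le>L. (-1) ^ k * real (L choose k) * (Gamma (\<alpha> - k) / Gamma (\<beta> - k))) =
    (\<Prod>j<L. \<alpha> - \<beta> - real j) * Gamma (\<alpha> - L) / Gamma \<beta>"
    using Suc.prems by (intro Suc.IH) auto
  have IH2: "(\<Sum>k\<le>L. (-1) ^ k * real (L choose k) * (Gamma (\<alpha> - 1 - k) / Gamma (\<beta> - 1 - k))) =
    (\<Prod>j<L. (\<alpha> - 1) - (\<beta> - 1) - real j) * Gamma (\<alpha> - 1 - L) / Gamma (\<beta> - 1)"
    using Suc.prems by (intro Suc.IH) auto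
  have g1: "Gamma (\<alpha> - L) = (\<alpha> - 1 - L) * Gamma (\<alpha> - 1 - L)"
    using Gamma_plus1[of "\<alpha> - 1 - L"] Suc.prems by (auto simp: nonpos_Ints_def algebra_simps)
  have g2: "Gamma \<beta> = (\<beta> - 1) * Gamma (\<beta> - 1)"
    using Gamma_plus1[of "\<beta> - 1"] Suc.prems by (auto simp: nonpos_Ints_def algebra_simps)
  have nz: "Gamma (\<beta> - 1) > 0" "\<beta> - 1 > 0" using Suc.prems by auto
  have "(\<Sum>k\<le>Suc L. (-1) ^ k * real (Suc L choose k) * (Gamma (\<alpha> - k) / Gamma (\<beta> - k))) =
    (\<Prod>j<L. \<alpha> - \<beta> - real j) * Gamma (\<alpha> - L) / Gamma \<beta> -
    (\<Prod>j<L. \<alpha> - \<beta> - real j) * Gamma (\<alpha> - 1 - L) / Gamma (\<beta> - 1)"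
    unfolding alternating_binomial_sum_Suc IH1 using IH2 by (simp add: algebra_simps)
  also have "\<dots> = (\<Prod>j<L. \<alpha> - \<beta> - real j) * ((\<alpha> - 1 - L) - (\<beta> - 1)) * Gamma (\<alpha> - 1 - L) / Gamma \<beta>"
  proof -
    have "P * (A * G) / (B * H) - P * G / H = P * (A - B) * G / (B * H)" if "B > 0" "H > 0" for P A B G H :: real
      using that by (simp add: field_simps)
    then show ?thesis unfolding g1 g2 using nz by blast
  qed
  finally show ?case by (simp add: algebra_simps)
qed simp

definition gegenbauer_coeff :: "real \<Rightarrow> nat \<Rightarrow> nat \<Rightarrow> real" where
  "gegenbauer_coeff \<nu> m k = (if m = 0 then 1 else (-1) ^ k * (\<nu> + m) * pochhammer (\<nu> + 1) (m - k - 1) *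
     2 ^ (m - 2 * k) / (fact k * fact (m - 2 * k)))"

lemma gegenbauer_check_eq: "gegenbauer_check \<nu> m t = (\<Sum>k\<le>m div 2. gegenbauer_coeff \<nu> m k * t ^ (m - 2 * k))"
  by (cases "m = 0") (simp_all add: gegenbauer_check_0 gegenbauer_check_eq_sum gegenbauer_coeff_def)

lemma gegenbauer_coeff_Gamma:
  assumes "\<nu> > -1" "2 * k \<le> m" "m > 0"
  shows "gegenbauer_coeff \<nu> m k = (-1) ^ k * (\<nu> + m) * Gamma (\<nu> + m - k) / Gamma (\<nu> + 1) *
     2 ^ (m - 2 * k) / (fact k * fact (m - 2 * k))"
proof -
  have "\<nu> + 1 \<notin> \<int>\<^sub>\<le>\<^sub>0" using assms by (auto simp: nonpos_Ints_def)
  then have "pochhammer (\<nu> + 1) (m - k - 1) = Gamma (\<nu> + 1 + real (m - k - 1)) / Gamma (\<nu> + 1)"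
    by (rule pochhammer_Gamma)
  also have "\<nu> + 1 + real (m - k - 1) = \<nu> + m - k"
    using assms by (simp add: of_nat_diff)
  finally show ?thesis using assms by (simp add: gegenbauer_coeff_def)
qed

text \<open>Up to factors free of \<open>k\<close>, this is the coefficient of
  \<open>(\<omega> \<bullet> \<eta>)^i\<close> in the spherical mean of
  \<open>C_m(\<omega> \<bullet> x) (\<eta> \<bullet> x)^q\<close>. Here \<open>\<rho> d\<close> is
  the ratio of the radial moments of degrees \<open>d\<close> and \<open>0\<close>, \<open>h\<close>
  is half the total degree, and \<open>i \<le> m - 2 * k\<close> amounts to
  \<open>k \<le> L\<close>.\<close>

lemma gegenbauer_moment_sum:
  fixes \<nu> :: real and m q i L h :: nat
  defines "\<rho> \<equiv> \<lambda>d::nat. 2 powr (d / 2) * Gamma (d / 2 + \<nu> + 1) / Gamma (\<nu> + 1)"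
  assumes nu: "\<nu> \<ge> -1/2" and m: "m > 0" "i + 2 * L = m" "m + q = 2 * h" "i \<le> q" "q \<le> m"
  shows "(\<Sum>k\<le>m div 2. if i \<le> m - 2 * k then gegenbauer_coeff \<nu> m k * fact (m - 2 * k) * gauss_coeff (m - 2 * k - i) / \<rho> (m - 2 * k + q) else 0) =
    (\<nu> + m) * 2 powr (real m - L - h) / fact L * ((\<Prod>j<L. real m - h - 1 - real j) * Gamma (\<nu> + m - L) / Gamma (\<nu> + h + 1))"
    (is "(\<Sum>k\<le>_. if _ then ?f k else 0) = _")
proof -
  have G: "Gamma (\<nu> + 1) > 0" using nu by (intro Gamma_real_pos) auto
  have "(\<Sum>k\<le>m div 2. if i \<le> m - 2 * k then ?f k else 0) = (\<Sum>k\<le>L. ?f k)"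
    by (rule sum.mono_neutral_cong_right) (use m in \<open>auto\<close>)
  also have "\<dots> = (\<Sum>k\<le>L. (\<nu> + m) * 2 powr (real m - L - h) / fact L *
     ((-1) ^ k * real (L choose k) * (Gamma (\<nu> + m - k) / Gamma (\<nu> + h + 1 - k))))"
  proof (rule sum.cong[OF refl])
    fix k assume "k \<in> {..L}"
    then have k: "k \<le> L" by simp
    have kh: "k \<le> h" "2 * k \<le> m" using m k by linarith+
    have e: "m - 2 * k - i = 2 * (L - k)" "m - 2 * k + q = 2 * (h - k)"
      using m k kh by auto
    have rho: "\<rho> (m - 2 * k + q) = 2 powr (real h - k) * Gamma (\<nu> + h + 1 - k) / Gamma (\<nu> + 1)"
    proof -
      have "real (2 * (h - k)) / 2 = real h - k" "real (2 * (h - k)) / 2 + \<nu> + 1 = \<nu> + h + 1 - k"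
        using kh by (simp_all add: of_nat_diff)
      then show ?thesis unfolding \<rho>_def e by (simp only:)
    qed
    have g: "gauss_coeff (m - 2 * k - i) = 1 / (2 powr (real L - k) * fact (L - k))"
      unfolding e gauss_coeff_def using k by (simp add: powr_realpow[symmetric] of_nat_diff)
    have p: "(2::real) ^ (m - 2 * k) = 2 powr (real m - 2 * k)"
      using kh by (simp add: powr_realpow[symmetric] of_nat_diff)
    have b: "real (L choose k) = fact L / (fact k * fact (L - k))"
      using k by (simp add: binomial_fact)
    \<comment> \<open>The exponents depending on \<open>k\<close> cancel, so the powers of
      \<open>2\<close> leave the alternating sum.\<close>
    have pp: "2 powr (real m - 2 * k) / (2 powr (real L - k) * 2 powr (real h - k)) = 2 powr (real m - L - h)"
    proof -
      have "2 powr (real m - 2 * k) / (2 powr (real L - k) * 2 powr (real h - k)) = 2 powr (real m - 2 * k - ((real L - k) + (real h - k)))"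
        by (simp only: powr_add powr_diff)
      also have "real m - 2 * k - ((real L - k) + (real h - k)) = real m - L - h" by simp
      finally show ?thesis .
    qed
    have "?f k = (2 powr (real m - 2 * k) / (2 powr (real L - k) * 2 powr (real h - k))) *
      ((-1) ^ k * (\<nu> + m) * Gamma (\<nu> + m - k)) / (fact k * fact (L - k) * Gamma (\<nu> + h + 1 - k))"
    proof -
      have alg: "(sg * c * Gm / G1 * P / (fk * F2)) * F2 * (1 / (P1 * F)) / (P2 * G2 / G1) = (P / (P1 * P2)) * (sg * c * Gm) / (fk * F * G2)"
        if "G1 > 0" "F2 > 0" "fk > 0" "P1 > 0" "P2 > 0" "F > 0" "G2 > 0" for sg c Gm G1 P fk F2 P1 F P2 G2 :: real
        using that by (simp add: field_simps)
      have gp: "Gamma (\<nu> + h + 1 - k) > 0" using nu kh by (intro Gamma_real_pos) linarith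
      have "\<nu> > -1" using nu by linarith
      note coef = gegenbauer_coeff_Gamma[OF this kh(2) m(1), unfolded p]
      show ?thesis unfolding rho g coef by (rule alg) (use G gp in simp_all)
    qed
    then show "?f k = (\<nu> + m) * 2 powr (real m - L - h) / fact L *
     ((-1) ^ k * real (L choose k) * (Gamma (\<nu> + m - k) / Gamma (\<nu> + h + 1 - k)))"
      unfolding pp b by simp
  qed
  also have "\<dots> = (\<nu> + m) * 2 powr (real m - L - h) / fact L *
     (\<Sum>k\<le>L. (-1) ^ k * real (L choose k) * (Gamma (\<nu> + m - k) / Gamma (\<nu> + h + 1 - k)))"
    by (simp add: sum_distrib_left)
  also have "(\<Sum>k\<le>L. (-1) ^ k * real (L choose k) * (Gamma (\<nu> + m - k) / Gamma (\<nu> + h + 1 - k))) =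
    (\<Prod>j<L. (\<nu> + m) - (\<nu> + h + 1) - real j) * Gamma (\<nu> + m - L) / Gamma (\<nu> + h + 1)"
  proof (rule alternating_Gamma_ratio_sum)
    \<comment> \<open>All Gamma arguments have to stay positive. Indeed
      \<open>2h = m + q \<ge> 2L + 2i\<close> gives \<open>h \<ge> L\<close>, and
      \<open>2L \<le> m\<close> with \<open>m > 0\<close> gives \<open>L + 1 \<le> m\<close>; then
      \<open>\<nu> \<ge> -1/2\<close> suffices.\<close>
    have "real m = real i + 2 * real L" "real m + real q = 2 * real h"
      using arg_cong[OF m(2), of real] arg_cong[OF m(3), of real] by simp_all
    moreover have "real q \<ge> real i" "real i \<ge> 0" using m by simp_all
    moreover have "L + 1 \<le> m" using m by linarith
    then have "real L + 1 \<le> real m" by linarith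
    ultimately have "\<nu> + m > real L \<and> \<nu> + h + 1 > real L"
      using nu by linarith
    then show "\<nu> + m > real L" "\<nu> + h + 1 > real L" by blast+
  qed
  also have "(\<Prod>j<L. (\<nu> + m) - (\<nu> + h + 1) - real j) = (\<Prod>j<L. real m - h - 1 - real j)"
    by (rule prod.cong) simp_all
  finally show ?thesis .
qed

section \<open>Spherical means, taken as means of 0-homogeneous functions over the unit ball\<close>

definition sphere_mean :: "('a::euclidean_space \<Rightarrow> real) \<Rightarrow> real" where
  "sphere_mean Q = (LINT x|lborel. Q x * indicator (cball 0 1) x) / unit_ball_vol DIM('a)"

lemma sphere_mean_sum:
  fixes Q :: "'i \<Rightarrow> 'a::euclidean_space \<Rightarrow> real"
  assumes "\<And>k. k \<in> A \<Longrightarrow> Q k \<in> borel_measurable borel" "\<And>k x. k \<in> A \<Longrightarrow> \<bar>Q k x\<bar> \<le> K k"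
  shows "sphere_mean (\<lambda>x. \<Sum>k\<in>A. c k * Q k x) = (\<Sum>k\<in>A. c k * sphere_mean (Q k))"
proof -
  have "(LINT x|lborel. (\<Sum>k\<in>A. c k * Q k x) * indicator (cball (0::'a) 1) x) =
     (LINT x|lborel. (\<Sum>k\<in>A. c k * (Q k x * indicator (cball (0::'a) 1) x)))"
    by (simp add: sum_distrib_right mult.assoc)
  also have "\<dots> = (\<Sum>k\<in>A. LINT x|lborel. c k * (Q k x * indicator (cball (0::'a) 1) x))"
    using assms by (intro Bochner_Integration.integral_sum integrable_mult_right integrable_mult_indicator_cball)
  finally show ?thesis
    by (simp add: sphere_mean_def sum_divide_distrib)
qed

lemma abs_inner_sgn_le: "norm \<omega> = 1 \<Longrightarrow> \<bar>\<omega> \<bullet> sgn x\<bar> \<le> 1"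
  using inner_unit_le[of \<omega> "sgn x"] by (auto simp: norm_sgn split: if_splits)

lemma inner_sgn_measurable [measurable]: "(\<lambda>x::'a::euclidean_space. \<omega> \<bullet> sgn x) \<in> borel_measurable borel"
  unfolding sgn_div_norm by measurable

text \<open>Writing \<open>x = |x| sgn x\<close> splits the Gaussian moment into the spherical mean
  and the radial moment of degree \<open>p + q\<close>.\<close>

lemma sphere_mean_monomial:
  fixes \<omega> \<eta> :: "'a::euclidean_space"
  assumes u: "norm \<omega> = 1" "norm \<eta> = 1"
  shows "sphere_mean (\<lambda>x. (\<omega> \<bullet> sgn x) ^ p * (\<eta> \<bullet> sgn x) ^ q) = gauss_moment p q \<omega> \<eta> / radial_moment TYPE('a) (p + q)"
proof -
  have "gauss_moment p q \<omega> \<eta> = (LINT x|lborel. ((\<omega> \<bullet> sgn x) ^ p * (\<eta> \<bullet> sgn x) ^ q) * (norm x ^ (p + q) * exp (- (norm x)\<^sup>2 / 2)))"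
    unfolding gauss_moment_def
  proof (rule Bochner_Integration.integral_cong[OF refl])
    fix x :: 'a
    have "\<zeta> \<bullet> x = norm x * (\<zeta> \<bullet> sgn x)" for \<zeta> :: 'a by (cases "x = 0") (simp_all add: sgn_div_norm)
    from this[of \<omega>] this[of \<eta>] show "(\<omega> \<bullet> x) ^ p * (\<eta> \<bullet> x) ^ q * gauss_weight x =
      ((\<omega> \<bullet> sgn x) ^ p * (\<eta> \<bullet> sgn x) ^ q) * (norm x ^ (p + q) * exp (- (norm x)\<^sup>2 / 2))"
      by (simp add: power_mult_distrib power_add gauss_weight_def mult_ac del: inner_sgn_measurable)
  qed
  also have "\<dots> = sphere_mean (\<lambda>x. (\<omega> \<bullet> sgn x) ^ p * (\<eta> \<bullet> sgn x) ^ q) * radial_moment TYPE('a) (p + q)"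
    unfolding sphere_mean_def radial_moment_def gauss_weight_def
  proof (rule radial_integral_average[where K = 1 and g = "\<lambda>r. r ^ (p + q) * exp (- r\<^sup>2 / 2)"])
    show "integrable lborel (\<lambda>x::'a. norm x ^ (p + q) * exp (- (norm x)\<^sup>2 / 2))"
      using integrable_norm_power_exp[of "1 / 2" "p + q", where 'a='a] by simp
    show "\<bar>(\<omega> \<bullet> sgn x) ^ p * (\<eta> \<bullet> sgn x) ^ q\<bar> \<le> 1" for x
      using u by (auto simp: abs_mult power_abs intro!: mult_le_one power_le_one abs_inner_sgn_le)
  qed (auto simp: sgn_scaleR)
  finally show ?thesis using radial_moment_pos[of "p + q", where 'a='a] by (simp add: field_simps)
qed

lemma sum_atMost_even_difference:
  fixes f :: "nat \<Rightarrow> real"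
  assumes "\<And>i. i \<le> m \<Longrightarrow> odd (m - i) \<Longrightarrow> f i = 0"
  shows "(\<Sum>i\<le>m. f i) = (\<Sum>L\<le>m div 2. f (m - 2 * L))"
proof -
  have "(\<Sum>L\<le>m div 2. f (m - 2 * L)) = (\<Sum>i\<in>(\<lambda>L. m - 2 * L) ` {..m div 2}. f i)"
    by (rule sum.reindex_cong[symmetric]) (auto simp: inj_on_def)
  also have "\<dots> = (\<Sum>i\<le>m. f i)"
  proof (rule sum.mono_neutral_left)
    show "\<forall>i\<in>{..m} - (\<lambda>L. m - 2 * L) ` {..m div 2}. f i = 0"
    proof
      fix i assume i: "i \<in> {..m} - (\<lambda>L. m - 2 * L) ` {..m div 2}"
      have "odd (m - i)"
      proof
        assume "even (m - i)"
        then have "i = m - 2 * ((m - i) div 2)" using i by auto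
        moreover have "(m - i) div 2 \<in> {..m div 2}" by (auto intro: div_le_mono)
        ultimately show False using i by blast
      qed
      with i assms show "f i = 0" by auto
    qed
  qed auto
  finally show ?thesis by simp
qed


text \<open>The sum of the absolute coefficients is a crude bound that serves only to make
  integrands bounded or integrable; the sharp bound \<open>C_m(1)\<close> needs the orthogonality
  relations.\<close>

lemma gegenbauer_check_bounded:
  obtains K where "\<And>t. \<bar>t\<bar> \<le> 1 \<Longrightarrow> \<bar>gegenbauer_check \<nu> m t\<bar> \<le> K"
proof
  fix t :: real assume t: "\<bar>t\<bar> \<le> 1"
  have "\<bar>gegenbauer_check \<nu> m t\<bar> \<le> (\<Sum>k\<le>m div 2. \<bar>gegenbauer_coeff \<nu> m k * t ^ (m - 2 * k)\<bar>)"
    unfolding gegenbauer_check_eq by (rule sum_abs)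
  also have "\<dots> \<le> (\<Sum>k\<le>m div 2. \<bar>gegenbauer_coeff \<nu> m k\<bar>)"
    using t by (intro sum_mono) (auto simp: abs_mult power_abs intro!: mult_left_le power_le_one)
  finally show "\<bar>gegenbauer_check \<nu> m t\<bar> \<le> (\<Sum>k\<le>m div 2. \<bar>gegenbauer_coeff \<nu> m k\<bar>)" .
qed

lemma gegenbauer_check_measurable [measurable]: "gegenbauer_check \<nu> m \<in> borel_measurable borel"
  unfolding gegenbauer_check_eq by measurable

text \<open>Each monomial of \<open>C_m\<close> is averaged by the moment formula, and the
  coefficient of every power of \<open>\<omega> \<bullet> \<eta>\<close> becomes an alternating
  Gamma sum. For \<open>q < m\<close> its product contains a zero factor; for \<open>q = m\<close>
  the sums reproduce the coefficients of \<open>C_m\<close>, divided by the leading one.\<close>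

lemma sphere_mean_gegenbauer_power:
  fixes \<omega> \<eta> :: "'a::euclidean_space" and m q :: nat
  assumes nu: "real DIM('a) = 2 * \<nu> + 2" and u: "norm \<omega> = 1" "norm \<eta> = 1" and m: "m > 0" "q \<le> m"
  shows "sphere_mean (\<lambda>x. gegenbauer_check \<nu> m (\<omega> \<bullet> sgn x) * (\<eta> \<bullet> sgn x) ^ q) =
    (if q = m then gegenbauer_check \<nu> m (\<omega> \<bullet> \<eta>) / gegenbauer_coeff \<nu> m 0 else 0)"
proof -
  define \<rho> where "\<rho> d = 2 powr (d / 2) * Gamma (d / 2 + \<nu> + 1) / Gamma (\<nu> + 1)" for d :: nat
  define s where "s = \<omega> \<bullet> \<eta>"
  define S where "S i = (\<Sum>k\<le>m div 2. if i \<le> m - 2 * k then gegenbauer_coeff \<nu> m k * fact (m - 2 * k) *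
     gauss_coeff (m - 2 * k - i) / \<rho> (m - 2 * k + q) else 0)" for i
  have "DIM('a) \<ge> 1" by (simp add: Suc_leI)
  then have "real DIM('a) \<ge> 1" by simp
  then have nu': "\<nu> \<ge> -1/2" using nu by linarith
  have G: "Gamma (\<nu> + 1) > 0" using nu' by (intro Gamma_real_pos) auto
  have R: "radial_moment TYPE('a) d = radial_moment TYPE('a) 0 * \<rho> d" for d
  proof -
    define V where "V = unit_ball_vol DIM('a) * DIM('a) / 2"
    have p: "2 powr (d / 2 + \<nu> + 1) = 2 powr (d / 2) * 2 powr (\<nu> + 1)"
      by (simp only: powr_add mult.assoc)
    have "radial_moment TYPE('a) 0 = V * 2 powr (\<nu> + 1) * Gamma (\<nu> + 1)"
      by (subst radial_moment_eq[OF nu]) (simp add: V_def)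
    moreover have "radial_moment TYPE('a) d = V * (2 powr (d / 2) * 2 powr (\<nu> + 1)) * Gamma (d / 2 + \<nu> + 1)"
      unfolding radial_moment_eq[OF nu] V_def p ..
    ultimately show ?thesis using G by (simp add: \<rho>_def)
  qed
  have Rp: "radial_moment TYPE('a) 0 > 0" by (rule radial_moment_pos)
  have "sphere_mean (\<lambda>x. gegenbauer_check \<nu> m (\<omega> \<bullet> sgn x) * (\<eta> \<bullet> sgn x) ^ q) =
    sphere_mean (\<lambda>x. \<Sum>k\<le>m div 2. gegenbauer_coeff \<nu> m k * ((\<omega> \<bullet> sgn x) ^ (m - 2 * k) * (\<eta> \<bullet> sgn x) ^ q))"
    by (simp add: gegenbauer_check_eq sum_distrib_right mult.assoc)
  also have "\<dots> = (\<Sum>k\<le>m div 2. gegenbauer_coeff \<nu> m k * sphere_mean (\<lambda>x. (\<omega> \<bullet> sgn x) ^ (m - 2 * k) * (\<eta> \<bullet> sgn x) ^ q))"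
    by (rule sphere_mean_sum[where K = "\<lambda>_. 1"])
      (auto simp: abs_mult power_abs intro!: mult_le_one power_le_one abs_inner_sgn_le u)
  also have "\<dots> = (\<Sum>k\<le>m div 2. \<Sum>i\<le>q. (fact q * gauss_coeff (q - i) * s ^ i / fact i) *
      (if i \<le> m - 2 * k then gegenbauer_coeff \<nu> m k * fact (m - 2 * k) * gauss_coeff (m - 2 * k - i) / \<rho> (m - 2 * k + q) else 0))"
  proof (rule sum.cong[OF refl])
    fix k
    have "sphere_mean (\<lambda>x. (\<omega> \<bullet> sgn x) ^ (m - 2 * k) * (\<eta> \<bullet> sgn x) ^ q) =
      fact (m - 2 * k) * fact q *
       (\<Sum>i\<le>q. (if i \<le> m - 2 * k then gauss_coeff (m - 2 * k - i) * gauss_coeff (q - i) * s ^ i / fact i else 0)) / \<rho> (m - 2 * k + q)"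
      unfolding sphere_mean_monomial[OF u] gauss_moment_eq[OF u] R[of "m - 2 * k + q"] s_def using Rp by simp
    then show "gegenbauer_coeff \<nu> m k * sphere_mean (\<lambda>x. (\<omega> \<bullet> sgn x) ^ (m - 2 * k) * (\<eta> \<bullet> sgn x) ^ q) =
      (\<Sum>i\<le>q. (fact q * gauss_coeff (q - i) * s ^ i / fact i) *
      (if i \<le> m - 2 * k then gegenbauer_coeff \<nu> m k * fact (m - 2 * k) * gauss_coeff (m - 2 * k - i) / \<rho> (m - 2 * k + q) else 0))"
      by (auto simp: sum_distrib_left sum_divide_distrib mult_ac intro!: sum.cong)
  qed
  also have "\<dots> = (\<Sum>i\<le>q. (fact q * gauss_coeff (q - i) * s ^ i / fact i) * S i)"
    by (subst sum.swap) (simp add: S_def sum_distrib_left)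
  also have "\<dots> = (if q = m then gegenbauer_check \<nu> m s / gegenbauer_coeff \<nu> m 0 else 0)"
  proof (cases "q = m")
    case False
    have "gauss_coeff (q - i) * S i = 0" if i: "i \<le> q" for i
    proof (cases "even (q - i)")
      case True
      show ?thesis
      proof (cases "even (m - i)")
        case ev: True
        then obtain L where L: "m - i = 2 * L" by (rule evenE)
        from ev True have "even (m + q)" using i m by (metis add_diff_inverse_nat even_add even_diff_nat not_less order_trans)
        then obtain h where h: "m + q = 2 * h" by (rule evenE)
        have iL: "i + 2 * L = m" using L i m by linarith
        have "S i = (\<nu> + m) * 2 powr (real m - L - h) / fact L * ((\<Prod>j<L. real m - h - 1 - real j) * Gamma (\<nu> + m - L) / Gamma (\<nu> + h + 1))"
          unfolding S_def \<rho>_def by (rule gegenbauer_moment_sum[OF nu' m(1) iL h i m(2)])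
        \<comment> \<open>The factor with \<open>j = m - h - 1\<close> is zero. It occurs because
          \<open>m - h = (m - q)/2\<close> is positive and at most
          \<open>(m - i)/2 = L\<close>.\<close>
        moreover have "(\<Prod>j<L. real m - h - 1 - real j) = 0"
        proof (rule prod_zero)
          have "h < m" "m - h - 1 < L" using h iL i m False by linarith+
          then show "\<exists>j\<in>{..<L}. real m - h - 1 - real j = 0"
            by (intro bexI[of _ "m - h - 1"]) (auto simp: of_nat_diff)
        qed simp
        ultimately show ?thesis by simp
      next
        case False
        have "gauss_coeff (m - 2 * k - i) = 0" if "i \<le> m - 2 * k" "k \<le> m div 2" for k
          using False that i m by (auto simp: gauss_coeff_def)
        then have "S i = 0" unfolding S_def by (intro sum.neutral) auto
        then show ?thesis by simp
      qed
    qed (simp add: gauss_coeff_def)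
    then have "(\<Sum>i\<le>q. (fact q * gauss_coeff (q - i) * s ^ i / fact i) * S i) = 0"
      by (intro sum.neutral) auto
    with False show ?thesis by simp
  next
    case True
    have "(\<Sum>i\<le>m. (fact m * gauss_coeff (m - i) * s ^ i / fact i) * S i) =
      (\<Sum>L\<le>m div 2. (fact m * gauss_coeff (m - (m - 2 * L)) * s ^ (m - 2 * L) / fact (m - 2 * L)) * S (m - 2 * L))"
      by (rule sum_atMost_even_difference) (simp add: gauss_coeff_def)
    also have "\<dots> = (\<Sum>L\<le>m div 2. gegenbauer_coeff \<nu> m L * s ^ (m - 2 * L) / gegenbauer_coeff \<nu> m 0)"
    proof (rule sum.cong[OF refl])
      fix L assume "L \<in> {..m div 2}"
      then have L: "2 * L \<le> m" by auto
      have g: "gauss_coeff (m - (m - 2 * L)) = 1 / (2 ^ L * fact L)"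
        using L by (simp add: gauss_coeff_def)
      \<comment> \<open>For \<open>q = m\<close> also \<open>h = m\<close>, so the factors are
        \<open>-1, ..., -L\<close> and none of them vanishes.\<close>
      have pr: "(\<Prod>j<L. real m - m - 1 - real j) = (-1) ^ L * fact L"
        by (induction L) (auto simp: algebra_simps)
      have "S (m - 2 * L) = (\<nu> + m) * 2 powr (real m - L - m) / fact L * ((\<Prod>j<L. real m - m - 1 - real j) * Gamma (\<nu> + m - L) / Gamma (\<nu> + m + 1))"
        unfolding S_def \<rho>_def True by (rule gegenbauer_moment_sum[OF nu' m(1)]) (use L in auto)
      also have "2 powr (real m - L - m) = 1 / 2 ^ L" by (simp add: powr_minus powr_realpow divide_inverse)
      finally have S: "S (m - 2 * L) = (\<nu> + m) / 2 ^ L * (-1) ^ L * Gamma (\<nu> + m - L) / Gamma (\<nu> + m + 1)"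
        unfolding pr by simp
      have gm: "Gamma (\<nu> + m + 1) = (\<nu> + m) * Gamma (\<nu> + m)"
        using Gamma_plus1[of "\<nu> + m"] nu' m by (auto simp: nonpos_Ints_def)
      have pos: "\<nu> + m > 0" "Gamma (\<nu> + m) > 0"
        using nu' m by (auto intro!: Gamma_real_pos)
      have two: "(2::real) ^ m = 2 ^ (m - 2 * L) * (2 ^ L * 2 ^ L)"
        using L by (simp flip: power_add)
      have "(fact m * (1 / (2 ^ L * fact L)) * s ^ (m - 2 * L) / fact (m - 2 * L)) * S (m - 2 * L) =
        ((-1) ^ L * (\<nu> + m) * Gamma (\<nu> + m - L) / Gamma (\<nu> + 1) * 2 ^ (m - 2 * L) / (fact L * fact (m - 2 * L))) * s ^ (m - 2 * L) /
        ((\<nu> + m) * Gamma (\<nu> + m) / Gamma (\<nu> + 1) * 2 ^ m / fact m)"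
      proof -
        have "(FM * (1 / (B * FL)) * SS / F2) * (c / B * sg * GL / (c * Gm)) =
          (sg * c * GL / G1 * P / (FL * F2)) * SS / (c * Gm / G1 * (P * (B * B)) / FM)"
          if "FM > 0" "B > 0" "FL > 0" "F2 > 0" "c > 0" "Gm > 0" "G1 > 0" "P > 0"
          for FM B FL SS F2 c sg GL Gm G1 P :: real
          using that by (simp add: divide_simps)
        then show ?thesis unfolding S gm two using pos G by simp
      qed
      also have "\<dots> = gegenbauer_coeff \<nu> m L * s ^ (m - 2 * L) / gegenbauer_coeff \<nu> m 0"
        using L nu' m by (simp add: gegenbauer_coeff_Gamma)
      finally show "(fact m * gauss_coeff (m - (m - 2 * L)) * s ^ (m - 2 * L) / fact (m - 2 * L)) * S (m - 2 * L) =
         gegenbauer_coeff \<nu> m L * s ^ (m - 2 * L) / gegenbauer_coeff \<nu> m 0"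
        unfolding g .
    qed
    also have "\<dots> = gegenbauer_check \<nu> m s / gegenbauer_coeff \<nu> m 0"
      by (simp add: gegenbauer_check_eq sum_divide_distrib)
    finally show ?thesis using True by simp
  qed
  finally show ?thesis by (simp add: s_def)
qed

lemma gegenbauer_coeff_0_nz:
  assumes "\<nu> \<ge> -1/2"
  shows "gegenbauer_coeff \<nu> m 0 \<noteq> 0"
proof (cases "m = 0")
  case False
  then have "\<nu> + m > 0" using assms by linarith
  moreover have "pochhammer (\<nu> + 1) (m - 1) > 0" using assms by (intro pochhammer_pos) auto
  ultimately show ?thesis using False by (simp add: gegenbauer_coeff_def)
qed (simp add: gegenbauer_coeff_def)

text \<open>Expand the factor of lower degree in powers: only its leading power can have degree
  \<open>m\<close>, and the leading coefficient cancels the denominator in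
  \<open>sphere_mean_gegenbauer_power\<close>. The case \<open>m = 0\<close> is separate because
  that lemma requires a positive degree.\<close>

lemma sphere_mean_gegenbauer_le:
  fixes \<omega> \<eta> :: "'a::euclidean_space" and m n :: nat
  assumes nu: "real DIM('a) = 2 * \<nu> + 2" and u: "norm \<omega> = 1" "norm \<eta> = 1" and mn: "n \<le> m"
  shows "sphere_mean (\<lambda>x. gegenbauer_check \<nu> m (\<omega> \<bullet> sgn x) * gegenbauer_check \<nu> n (\<eta> \<bullet> sgn x)) =
    (if m = n then gegenbauer_check \<nu> m (\<omega> \<bullet> \<eta>) else 0)"
proof (cases "m = 0")
  case True
  have "sphere_mean (\<lambda>x::'a. 1) = 1"
    using sphere_mean_monomial[OF u, of 0 0] radial_moment_pos[of 0, where 'a='a]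
    by (simp add: gauss_moment_def radial_moment_def)
  with True mn show ?thesis by (simp add: gegenbauer_check_0)
next
  case False
  have "DIM('a) \<ge> 1" by (simp add: Suc_leI)
  then have "real DIM('a) \<ge> 1" by simp
  then have nu': "\<nu> \<ge> -1/2" using nu by linarith
  obtain K where K: "\<And>t. \<bar>t\<bar> \<le> 1 \<Longrightarrow> \<bar>gegenbauer_check \<nu> m t\<bar> \<le> K"
    using gegenbauer_check_bounded by blast
  have K0: "K \<ge> 0" using K[of 0] by linarith
  have "sphere_mean (\<lambda>x. gegenbauer_check \<nu> m (\<omega> \<bullet> sgn x) * gegenbauer_check \<nu> n (\<eta> \<bullet> sgn x)) =
    sphere_mean (\<lambda>x. \<Sum>l\<le>n div 2. gegenbauer_coeff \<nu> n l * (gegenbauer_check \<nu> m (\<omega> \<bullet> sgn x) * (\<eta> \<bullet> sgn x) ^ (n - 2 * l)))"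
    unfolding gegenbauer_check_eq[of \<nu> n] by (simp add: sum_distrib_left mult_ac)
  also have "\<dots> = (\<Sum>l\<le>n div 2. gegenbauer_coeff \<nu> n l * sphere_mean (\<lambda>x. gegenbauer_check \<nu> m (\<omega> \<bullet> sgn x) * (\<eta> \<bullet> sgn x) ^ (n - 2 * l)))"
  proof (rule sphere_mean_sum[where K = "\<lambda>_. K * 1"])
    show "\<bar>gegenbauer_check \<nu> m (\<omega> \<bullet> sgn x) * (\<eta> \<bullet> sgn x) ^ (n - 2 * l)\<bar> \<le> K * 1" for x l
      unfolding abs_mult power_abs using K0 by (intro mult_mono K abs_inner_sgn_le u power_le_one) auto
  qed measurable
  also have "\<dots> = (\<Sum>l\<le>n div 2. if l = 0 then (if m = n then gegenbauer_check \<nu> m (\<omega> \<bullet> \<eta>) else 0) else 0)"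
  proof (rule sum.cong[OF refl])
    fix l assume "l \<in> {..n div 2}"
    then have l: "2 * l \<le> n" by auto
    have "(n - 2 * l = m) = (l = 0 \<and> m = n)" using l mn False by auto
    then show "gegenbauer_coeff \<nu> n l * sphere_mean (\<lambda>x. gegenbauer_check \<nu> m (\<omega> \<bullet> sgn x) * (\<eta> \<bullet> sgn x) ^ (n - 2 * l)) =
      (if l = 0 then (if m = n then gegenbauer_check \<nu> m (\<omega> \<bullet> \<eta>) else 0) else 0)"
      using False mn gegenbauer_coeff_0_nz[OF nu'] by (subst sphere_mean_gegenbauer_power[OF nu u]) auto
  qed
  finally show ?thesis by simp
qed

lemma sphere_mean_gegenbauer:
  fixes \<omega> \<eta> :: "'a::euclidean_space" and m n :: nat
  assumes nu: "real DIM('a) = 2 * \<nu> + 2" and u: "norm \<omega> = 1" "norm \<eta> = 1"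
  shows "sphere_mean (\<lambda>x. gegenbauer_check \<nu> m (\<omega> \<bullet> sgn x) * gegenbauer_check \<nu> n (\<eta> \<bullet> sgn x)) =
    (if m = n then gegenbauer_check \<nu> m (\<omega> \<bullet> \<eta>) else 0)"
proof (cases "n \<le> m")
  case False
  then have "sphere_mean (\<lambda>x. gegenbauer_check \<nu> n (\<eta> \<bullet> sgn x) * gegenbauer_check \<nu> m (\<omega> \<bullet> sgn x)) = 0"
    by (subst sphere_mean_gegenbauer_le[OF nu u(2,1)]) auto
  with False show ?thesis by (simp add: mult.commute)
qed (simp add: sphere_mean_gegenbauer_le[OF nu u])

text \<open>Positivity of the mean of the square of the sum or difference of two zonal functions.\<close>

lemma abs_gegenbauer_check_le:
  fixes \<omega> \<eta> :: "'a::euclidean_space"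
  assumes nu: "real DIM('a) = 2 * \<nu> + 2" and u: "norm \<omega> = 1" "norm \<eta> = 1"
  shows "\<bar>gegenbauer_check \<nu> m (\<omega> \<bullet> \<eta>)\<bar> \<le> gegenbauer_check \<nu> m 1"
proof -
  obtain K where K: "\<And>t. \<bar>t\<bar> \<le> 1 \<Longrightarrow> \<bar>gegenbauer_check \<nu> m t\<bar> \<le> K"
    using gegenbauer_check_bounded by blast
  have K0: "K \<ge> 0" using K[of 0] by linarith
  let ?Z = "\<lambda>\<omega> x. gegenbauer_check \<nu> m (\<omega> \<bullet> sgn x)"
  have KZ: "\<bar>?Z \<omega> x * ?Z \<eta> x\<bar> \<le> K * K" if "norm \<omega> = 1" "norm \<eta> = 1" for \<omega> \<eta> x :: 'a
    unfolding abs_mult using K0 that by (intro mult_mono K abs_inner_sgn_le) auto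
  have unit: "\<omega> \<bullet> \<omega> = 1" "\<eta> \<bullet> \<eta> = 1" using u by (simp_all add: dot_square_norm)
  have "0 \<le> 2 * gegenbauer_check \<nu> m 1 + 2 * c * gegenbauer_check \<nu> m (\<omega> \<bullet> \<eta>)" if "c\<^sup>2 = 1" for c
  proof -
    have "0 \<le> sphere_mean (\<lambda>x. (?Z \<omega> x + c * ?Z \<eta> x)\<^sup>2)"
      unfolding sphere_mean_def by (intro divide_nonneg_nonneg integral_nonneg_AE) auto
    \<comment> \<open>The expanded square is written as an indexed three-term sum so that
      \<open>sphere_mean_sum\<close> applies; the condition on \<open>c\<close> admits the two signs
      \<open>1\<close> and \<open>-1\<close>.\<close>
    also have "(\<lambda>x. (?Z \<omega> x + c * ?Z \<eta> x)\<^sup>2) = (\<lambda>x. \<Sum>k<3::nat. (if k = 0 then 1 else if k = 1 then 2 * c else 1) *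
      (if k = 0 then ?Z \<omega> x * ?Z \<omega> x else if k = 1 then ?Z \<omega> x * ?Z \<eta> x else ?Z \<eta> x * ?Z \<eta> x))"
    proof
      fix x
      have "(?Z \<omega> x + c * ?Z \<eta> x)\<^sup>2 = ?Z \<omega> x * ?Z \<omega> x + 2 * c * (?Z \<omega> x * ?Z \<eta> x) + c\<^sup>2 * (?Z \<eta> x * ?Z \<eta> x)"
        by (simp add: power2_eq_square algebra_simps)
      with that show "(?Z \<omega> x + c * ?Z \<eta> x)\<^sup>2 = (\<Sum>k<3::nat. (if k = 0 then 1 else if k = 1 then 2 * c else 1) *
        (if k = 0 then ?Z \<omega> x * ?Z \<omega> x else if k = 1 then ?Z \<omega> x * ?Z \<eta> x else ?Z \<eta> x * ?Z \<eta> x))"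
        by (simp add: numeral_3_eq_3)
    qed
    also have "sphere_mean \<dots> = (\<Sum>k<3::nat. (if k = 0 then 1 else if k = 1 then 2 * c else 1) *
      sphere_mean (\<lambda>x. if k = 0 then ?Z \<omega> x * ?Z \<omega> x else if k = 1 then ?Z \<omega> x * ?Z \<eta> x else ?Z \<eta> x * ?Z \<eta> x))"
      by (rule sphere_mean_sum[where K = "\<lambda>_. K * K"]) (use KZ[OF u(1) u(1)] KZ[OF u(1) u(2)] KZ[OF u(2) u(2)] in auto)
    also have "\<dots> = 2 * gegenbauer_check \<nu> m 1 + 2 * c * gegenbauer_check \<nu> m (\<omega> \<bullet> \<eta>)"
      by (simp add: numeral_3_eq_3 sphere_mean_gegenbauer[OF nu] u unit)
    finally show ?thesis .
  qed
  from this[of 1] this[of "-1"] show ?thesis by simp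
qed

lemma integral_gegenbauer_radial:
  fixes \<omega> \<eta> :: "'a::euclidean_space" and g :: "real \<Rightarrow> real"
  assumes nu: "real DIM('a) = 2 * \<nu> + 2" and u: "norm \<omega> = 1" "norm \<eta> = 1"
    and g: "g \<in> borel_measurable borel" "integrable lborel (\<lambda>x::'a. g (norm x))"
  shows "(LINT x|lborel. gegenbauer_check \<nu> m (\<omega> \<bullet> sgn x) * gegenbauer_check \<nu> n (\<eta> \<bullet> sgn x) * g (norm x)) =
    (if m = n then gegenbauer_check \<nu> m (\<omega> \<bullet> \<eta>) * (LINT x::'a|lborel. g (norm x)) else 0)"
proof -
  obtain K where K: "\<And>t. \<bar>t\<bar> \<le> 1 \<Longrightarrow> \<bar>gegenbauer_check \<nu> m t\<bar> \<le> K"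
    using gegenbauer_check_bounded by blast
  obtain K' where K': "\<And>t. \<bar>t\<bar> \<le> 1 \<Longrightarrow> \<bar>gegenbauer_check \<nu> n t\<bar> \<le> K'"
    using gegenbauer_check_bounded by blast
  have K0: "K \<ge> 0" using K[of 0] by linarith
  have "(LINT x|lborel. gegenbauer_check \<nu> m (\<omega> \<bullet> sgn x) * gegenbauer_check \<nu> n (\<eta> \<bullet> sgn x) * g (norm x)) =
    sphere_mean (\<lambda>x. gegenbauer_check \<nu> m (\<omega> \<bullet> sgn x) * gegenbauer_check \<nu> n (\<eta> \<bullet> sgn x)) * (LINT x::'a|lborel. g (norm x))"
    unfolding sphere_mean_def
  proof (rule radial_integral_average[where K = "K * K'"])
    show "\<bar>gegenbauer_check \<nu> m (\<omega> \<bullet> sgn x) * gegenbauer_check \<nu> n (\<eta> \<bullet> sgn x)\<bar> \<le> K * K'" for x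
      unfolding abs_mult using K0 by (intro mult_mono K K' abs_inner_sgn_le u) auto
  qed (use g in \<open>auto simp: sgn_scaleR\<close>)
  then show ?thesis by (simp add: sphere_mean_gegenbauer[OF nu u])
qed

section \<open>Bounds for normalized Bessel functions\<close>

text \<open>The integrand \<open>t\<^sup>x e\<^sup>-\<^sup>t\<close> of \<open>\<Gamma>(x + 1)\<close> is at least \<open>y\<^sup>x e\<^sup>-\<^sup>t\<close> on \<open>[y, \<infinity>)\<close>.\<close>

lemma powr_rGamma_le_exp:
  fixes x y :: real
  assumes "y > 0" "x \<ge> 0"
  shows "y powr x * rGamma (x + 1) \<le> exp y"
proof -
  have "ennreal (y powr x * exp (- y)) = ennreal (y powr x) * (\<integral>\<^sup>+t. ennreal (exp (- 1 * t)) * indicator {y..} t \<partial>lborel)"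
    using has_integral_exp_minus_to_infinity[of 1 y]
    by (subst nn_integral_has_integral_lebesgue'[where I = "exp (- y)"]) (auto simp: ennreal_mult)
  also have "\<dots> = (\<integral>\<^sup>+t. ennreal (y powr x) * (ennreal (exp (- 1 * t)) * indicator {y..} t) \<partial>lborel)"
    by (rule nn_integral_cmult[symmetric]) auto
  also have "\<dots> \<le> (\<integral>\<^sup>+t. ennreal (indicator {0..} t * t powr ((x + 1) - 1) / exp t) \<partial>lborel)"
  proof (rule nn_integral_mono)
    fix t :: real
    show "ennreal (y powr x) * (ennreal (exp (- 1 * t)) * indicator {y..} t) \<le> ennreal (indicator {0..} t * t powr ((x + 1) - 1) / exp t)"
    proof (cases "t \<ge> y")
      case True
      then have "y powr x \<le> t powr x" using assms by (intro powr_mono2) auto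
      then show ?thesis using True assms
        by (auto simp: exp_minus divide_inverse simp flip: ennreal_mult intro!: ennreal_leI mult_right_mono)
    qed simp
  qed
  also have "\<dots> = ennreal (Gamma (x + 1))"
    using assms by (subst Gamma_conv_nn_integral_real) auto
  finally have "y powr x * exp (- y) \<le> Gamma (x + 1)"
    using assms by (subst (asm) ennreal_le_iff) (auto intro: less_imp_le)
  moreover have "Gamma (x + 1) > 0" using assms by (intro Gamma_real_pos) auto
  ultimately show ?thesis
    by (simp add: rGamma_inverse_Gamma exp_minus field_simps)
qed

lemma rGamma_real_pos: "x > 0 \<Longrightarrow> rGamma (x::real) > 0"
  by (simp add: rGamma_inverse_Gamma Gamma_real_pos)

text \<open>The identity \<open>x / Gamma (x+1) = 1 / Gamma x\<close> trades a factor
  \<open>x\<close> for a factor \<open>y\<close> and lowers the index \<open>x\<close> by one. For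
  \<open>x < 1\<close> the index cannot be lowered, but there \<open>1 + x \<le> 2\<close>.\<close>

lemma power_powr_rGamma_le:
  "\<exists>C\<ge>1. \<forall>x y. x \<ge> 0 \<longrightarrow> y > 0 \<longrightarrow> (1 + x) ^ n * (y powr x * rGamma (x + 1)) \<le> C * ((1 + y) ^ n * exp (y::real))"
proof (induction n)
  case 0
  show ?case using powr_rGamma_le_exp by (intro exI[of _ 1]) auto
next
  case (Suc n)
  then obtain C where C: "C \<ge> 1" "\<And>x y. x \<ge> 0 \<Longrightarrow> y > 0 \<Longrightarrow> (1 + x) ^ n * (y powr x * rGamma (x + 1)) \<le> C * ((1 + y) ^ n * exp (y::real))"
    by auto
  have "(1 + x) ^ Suc n * (y powr x * rGamma (x + 1)) \<le> (2 ^ Suc n * C) * ((1 + y) ^ Suc n * exp y)"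
    if x: "x \<ge> 0" and y: "y > 0" for x y :: real
  proof (cases "x \<ge> 1")
    case True
    have rG: "rGamma x = x * rGamma (x + 1)" by (simp add: rGamma_plus1)
    have F: "x * (y powr x * rGamma (x + 1)) = y * (y powr (x - 1) * rGamma (x - 1 + 1))"
      using y by (simp add: rG powr_diff)
    have p: "0 \<le> y powr x * rGamma (x + 1)"
      using rGamma_real_pos[of "x + 1"] x by simp
    have "(1 + x) ^ Suc n * (y powr x * rGamma (x + 1)) \<le> (2 * x) ^ Suc n * (y powr x * rGamma (x + 1))"
      using True p by (intro mult_right_mono power_mono) auto
    also have "\<dots> = 2 ^ Suc n * x ^ n * (x * (y powr x * rGamma (x + 1)))"
      by (simp add: power_mult_distrib)
    also have "\<dots> = 2 ^ Suc n * (y * ((1 + (x - 1)) ^ n * (y powr (x - 1) * rGamma (x - 1 + 1))))"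
      unfolding F by simp
    also have "\<dots> \<le> 2 ^ Suc n * ((1 + y) * (C * ((1 + y) ^ n * exp y)))"
      using y C True by (intro mult_left_mono mult_mono C(2)) (auto intro!: mult_nonneg_nonneg rGamma_real_pos[THEN less_imp_le])
    finally show ?thesis by (simp add: mult_ac)
  next
    case False
    have "(1 + x) ^ Suc n * (y powr x * rGamma (x + 1)) \<le> 2 ^ Suc n * exp y"
      using False x y by (intro mult_mono power_mono powr_rGamma_le_exp) (auto intro!: mult_nonneg_nonneg rGamma_real_pos[THEN less_imp_le])
    also have "\<dots> \<le> (2 ^ Suc n * C) * ((1 + y) ^ Suc n * exp y)"
    proof -
      have "1 * 1 \<le> C * (1 + y) ^ Suc n"
        using C(1) y by (intro mult_mono one_le_power) auto
      then have "2 ^ Suc n * exp y * 1 \<le> 2 ^ Suc n * exp y * (C * (1 + y) ^ Suc n)"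
        by (intro mult_left_mono) auto
      then show ?thesis by (simp only: mult_ac mult_1_right)
    qed
    finally show ?thesis .
  qed
  moreover have "2 ^ Suc n * C \<ge> 1"
  proof -
    have "1 * 1 \<le> 2 ^ Suc n * C"
      using C(1) by (intro mult_mono one_le_power) auto
    then show ?thesis by simp
  qed
  ultimately show ?case by blast
qed

text \<open>In the notation of the informal statement, \<open>real_I \<mu> y\<close> is \<open>I\<^sub>\<mu>(2y)\<close> and \<open>real_J \<mu> y\<close> is \<open>I\<^sub>\<mu>(\<plusminus>2iy)\<close> (both normalized).\<close>

definition real_I :: "real \<Rightarrow> real \<Rightarrow> real" where
  "real_I \<mu> y = (\<Sum>j. y ^ (2 * j) * rGamma (\<mu> + real j + 1) / fact j)"

definition real_J :: "real \<Rightarrow> real \<Rightarrow> real" where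
  "real_J \<mu> y = (\<Sum>j. (-1) ^ j * (y ^ (2 * j) * rGamma (\<mu> + real j + 1) / fact j))"

lemma real_I_term_nonneg: "\<mu> > -1 \<Longrightarrow> 0 \<le> y ^ (2 * j) * rGamma (\<mu> + real j + 1) / fact j"
  using rGamma_real_pos[of "\<mu> + real j + 1"] by (auto simp: power_mult)

lemma abs_real_J_term:
  "\<mu> > -1 \<Longrightarrow> \<bar>(-1) ^ j * (y ^ (2 * j) * rGamma (\<mu> + real j + 1) / fact j)\<bar> = y ^ (2 * j) * rGamma (\<mu> + real j + 1) / fact j"
  unfolding abs_mult[of "(-1) ^ j"] by (subst abs_of_nonneg[OF real_I_term_nonneg]) (auto simp: power_abs)

lemma summable_real_I:
  assumes "\<mu> > -1"
  shows "summable (\<lambda>j. y ^ (2 * j) * rGamma (\<mu> + real j + 1) / fact j)"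
proof (rule summable_comparison_test'[where N = 1])
  have "summable (\<lambda>j. (y\<^sup>2) ^ j /\<^sub>R fact j)" by (rule summable_exp_generic)
  then show "summable (\<lambda>j. exp 1 * ((y\<^sup>2) ^ j /\<^sub>R fact j))" by (rule summable_mult)
  fix j :: nat assume "j \<ge> 1"
  \<comment> \<open>With \<open>y = 1\<close> the bound reads
    \<open>1 / Gamma (\<mu> + j + 1) \<le> e\<close>. It requires \<open>\<mu> + j \<ge> 0\<close>,
    hence \<open>j \<ge> 1\<close>, since \<open>\<mu>\<close> may be negative.\<close>
  then have "rGamma (\<mu> + real j + 1) \<le> exp 1"
    using powr_rGamma_le_exp[of 1 "\<mu> + real j"] assms by simp
  then have "y ^ (2 * j) * rGamma (\<mu> + real j + 1) / fact j \<le> y ^ (2 * j) * exp 1 / fact j"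
    by (intro divide_right_mono mult_left_mono) (auto simp: power_mult)
  then show "norm (y ^ (2 * j) * rGamma (\<mu> + real j + 1) / fact j) \<le> exp 1 * ((y\<^sup>2) ^ j /\<^sub>R fact j)"
    using real_I_term_nonneg[OF assms, of y j] by (simp add: power_mult[symmetric] divide_inverse mult_ac)
qed

lemma real_I_nonneg: "\<mu> > -1 \<Longrightarrow> real_I \<mu> y \<ge> 0"
  unfolding real_I_def by (intro suminf_nonneg summable_real_I real_I_term_nonneg)

lemma real_I_mono: "\<mu> > -1 \<Longrightarrow> 0 \<le> y \<Longrightarrow> y \<le> z \<Longrightarrow> real_I \<mu> y \<le> real_I \<mu> z"
  unfolding real_I_def
  by (intro suminf_le summable_real_I divide_right_mono mult_right_mono power_mono)
    (auto intro!: rGamma_real_pos[THEN less_imp_le])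

lemma summable_real_J:
  "\<mu> > -1 \<Longrightarrow> summable (\<lambda>j. (-1) ^ j * (y ^ (2 * j) * rGamma (\<mu> + real j + 1) / fact j))"
  by (rule summable_comparison_test'[OF summable_real_I[of \<mu> y], where N = 0])
    (simp_all only: real_norm_def abs_real_J_term order_refl)

lemma partial_real_J_le:
  assumes "\<mu> > -1"
  shows "\<bar>\<Sum>j<K. (-1) ^ j * (y ^ (2 * j) * rGamma (\<mu> + real j + 1) / fact j)\<bar> \<le> real_I \<mu> y"
proof -
  have "\<bar>\<Sum>j<K. (-1) ^ j * (y ^ (2 * j) * rGamma (\<mu> + real j + 1) / fact j)\<bar> \<le> (\<Sum>j<K. y ^ (2 * j) * rGamma (\<mu> + real j + 1) / fact j)"
    by (rule order_trans[OF sum_abs]) (simp only: abs_real_J_term[OF assms] order_refl)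
  also have "\<dots> \<le> real_I \<mu> y"
    unfolding real_I_def by (intro sum_le_suminf summable_real_I assms ballI real_I_term_nonneg) auto
  finally show ?thesis .
qed

lemma real_J_partial_tendsto:
  "\<mu> > -1 \<Longrightarrow> (\<lambda>K. \<Sum>j<K. (-1) ^ j * (y ^ (2 * j) * rGamma (\<mu> + real j + 1) / fact j)) \<longlonglongrightarrow> real_J \<mu> y"
  unfolding real_J_def by (rule summable_LIMSEQ[OF summable_real_J])

lemma abs_real_J_le:
  assumes "\<mu> > -1"
  shows "\<bar>real_J \<mu> y\<bar> \<le> real_I \<mu> y"
  by (rule tendsto_upperbound[OF tendsto_rabs[OF real_J_partial_tendsto[OF assms]]])
    (use partial_real_J_le[OF assms] in \<open>simp_all only: eventually_True sequentially_bot not_False_eq_True\<close>)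

text \<open>The counterpart of \<open>principal_power\<close> for nonnegative real bases: the value
  \<open>1\<close> at exponent \<open>0\<close> keeps the term \<open>m = 0\<close> alive at
  \<open>y = 0\<close>.\<close>

definition pow0 :: "real \<Rightarrow> real \<Rightarrow> real" where
  "pow0 y s = (if s = 0 then 1 else y powr s)"

lemma pow0_nonneg: "pow0 y s \<ge> 0" by (simp add: pow0_def)

lemma pow0_mono: "s \<ge> 0 \<Longrightarrow> 0 \<le> y \<Longrightarrow> y \<le> z \<Longrightarrow> pow0 y s \<le> pow0 z s"
  by (simp add: pow0_def powr_mono2)

lemma pow0_pos: "y > 0 \<Longrightarrow> pow0 y s = y powr s" by (simp add: pow0_def)

text \<open>Since \<open>b * m \<ge> 0\<close>, no order lies below the first one. Above
  \<open>-1\<close> every coefficient \<open>rGamma (\<mu> + j + 1)\<close> is positive, so that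
  \<open>real_I\<close> has nonnegative terms and dominates \<open>real_J\<close>.\<close>

lemma bessel_index_gt:
  assumes "b > 0" "b * \<nu> > (-1::real)"
  shows "b * (real m + \<nu>) > -1"
proof -
  have "b * real m \<ge> 0" using assms by simp
  with assms have "b * real m + b * \<nu> > -1" by linarith
  then show ?thesis by (simp add: distrib_left)
qed

text \<open>With \<open>x = b(m + \<nu>) + j\<close>, the power \<open>y^(bm + 2j)\<close> in the
  \<open>j\<close>-th term equals \<open>y^(-b\<nu>) y^j y^x\<close>. Then
  \<open>power_powr_rGamma_le\<close> estimates the part depending on \<open>x\<close> and gives one
  factor \<open>e^y\<close>; summing \<open>y^j / j!\<close> gives the other.\<close>

lemma bessel_term_bound_pos:
  fixes b \<nu> :: real and N :: nat
  assumes b: "b > 0" and lam: "b * \<nu> > -1" and N: "real N = 2 * \<nu> + 2" "N > 0"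
  shows "\<exists>C. \<forall>m y. y > 0 \<longrightarrow> (1 + real m) ^ N * (pow0 y (b * m) * real_I (b * (m + \<nu>)) y) \<le>
     C * (1 + y powr (- (b * \<nu>)) * (1 + y) ^ N * exp (2 * y))"
proof -
  obtain C where C: "C \<ge> 1" "\<And>x y. x \<ge> 0 \<Longrightarrow> y > 0 \<Longrightarrow> (1 + x) ^ N * (y powr x * rGamma (x + 1)) \<le> C * ((1 + y) ^ N * exp (y::real))"
    using power_powr_rGamma_le[of N] by auto
  \<comment> \<open>\<open>D\<close> converts \<open>1 + m\<close> into \<open>1 + x\<close>: for
    \<open>m \<ge> 1\<close> one has \<open>x \<ge> b m / 2\<close>, because
    \<open>\<nu> \<ge> -1/2\<close>.\<close>
  define D where "D = max 1 (2 / b)"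
  have D: "D \<ge> 1" "2 / b \<le> D" by (auto simp: D_def)
  define r where "r = rGamma (b * \<nu> + 1)"
  have r: "r > 0" unfolding r_def using lam by (intro rGamma_real_pos) simp
  have nu: "\<nu> \<ge> -1/2" using N by linarith
  have mu: "b * (m + \<nu>) \<ge> b * m / 2" if "m \<ge> 1" for m :: nat
  proof -
    have "real m / 2 \<le> m + \<nu>" using that nu by linarith
    from mult_left_mono[OF this, of b] b show ?thesis by simp
  qed
  have mu1: "b * (m + \<nu>) > -1" for m :: nat
    by (rule bessel_index_gt[OF b lam])
  have "(1 + real m) ^ N * (pow0 y (b * m) * real_I (b * (m + \<nu>)) y) \<le>
     (r + D ^ N * C) * (1 + y powr (- (b * \<nu>)) * (1 + y) ^ N * exp (2 * y))" if y: "y > 0" for m :: nat and y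
  proof -
    define Y where "Y = y powr (- (b * \<nu>)) * (D ^ N * (C * ((1 + y) ^ N * exp y)))"
    \<comment> \<open>The term \<open>m = j = 0\<close> has \<open>x = b * \<nu>\<close>, which may
      be negative; its value is exactly \<open>r\<close>, and it is split off.\<close>
    have trm: "(1 + real m) ^ N * (pow0 y (b * m) * (y ^ (2 * j) * rGamma (b * (m + \<nu>) + real j + 1) / fact j)) \<le>
      (if j = 0 then r else 0) + Y * (y ^ j /\<^sub>R fact j)" for j
    proof (cases "m = 0 \<and> j = 0")
      case True
      have "Y \<ge> 0" using y C D by (auto simp: Y_def intro!: mult_nonneg_nonneg)
      with True show ?thesis by (simp add: r_def pow0_def)
    next
      case False
      define x where "x = b * (m + \<nu>) + j"
      have x: "x \<ge> 0 \<and> 1 + real m \<le> D * (1 + x)"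
      proof (cases "m = 0")
        case True
        then have "j \<ge> 1" using False by simp
        then have "x \<ge> 0" using True lam by (simp add: x_def)
        moreover have "1 * 1 \<le> D * (1 + x)" using D \<open>x \<ge> 0\<close> by (intro mult_mono) auto
        ultimately show ?thesis using True by simp
      next
        case False
        then have "b * m / 2 \<le> x" unfolding x_def using mu[of m] by simp
        moreover have "0 \<le> b * m / 2" using b by simp
        ultimately have "x \<ge> 0" by linarith
        moreover have "real m \<le> 2 / b * x" using \<open>b * m / 2 \<le> x\<close> b by (simp add: field_simps)
        moreover have "2 / b * x \<le> D * x" using \<open>x \<ge> 0\<close> D by (intro mult_right_mono)
        ultimately show ?thesis using D by (auto simp: distrib_left)
      qed
      have F: "0 \<le> y powr x * rGamma (x + 1)" using x rGamma_real_pos[of "x + 1"] by simp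
      have "pow0 y (b * m) * y ^ (2 * j) = y powr (b * m + 2 * real j)"
        using y by (simp add: pow0_pos powr_add powr_realpow[symmetric])
      also have "b * m + 2 * real j = - (b * \<nu>) + (real j + x)" by (simp add: x_def algebra_simps)
      also have "y powr \<dots> = y powr (- (b * \<nu>)) * (y ^ j * y powr x)"
        using y by (simp only: powr_add powr_realpow)
      finally have e: "pow0 y (b * m) * y ^ (2 * j) = y powr (- (b * \<nu>)) * (y ^ j * y powr x)" .
      have "(1 + real m) ^ N * (y powr x * rGamma (x + 1)) \<le> (D * (1 + x)) ^ N * (y powr x * rGamma (x + 1))"
        using x F by (intro mult_right_mono power_mono) auto
      also have "\<dots> = D ^ N * ((1 + x) ^ N * (y powr x * rGamma (x + 1)))"
        by (simp add: power_mult_distrib)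
      also have "\<dots> \<le> D ^ N * (C * ((1 + y) ^ N * exp y))"
        using D x y by (intro mult_left_mono C) auto
      finally have "y powr (- (b * \<nu>)) * ((1 + real m) ^ N * (y powr x * rGamma (x + 1))) * (y ^ j /\<^sub>R fact j) \<le>
         y powr (- (b * \<nu>)) * (D ^ N * (C * ((1 + y) ^ N * exp y))) * (y ^ j /\<^sub>R fact j)"
        using y by (intro mult_right_mono mult_left_mono) auto
      moreover have "(1 + real m) ^ N * (pow0 y (b * m) * (y ^ (2 * j) * rGamma (b * (m + \<nu>) + real j + 1) / fact j)) =
        (1 + real m) ^ N * ((pow0 y (b * m) * y ^ (2 * j)) * rGamma (x + 1) / fact j)"
        by (simp add: x_def)
      then have "(1 + real m) ^ N * (pow0 y (b * m) * (y ^ (2 * j) * rGamma (b * (m + \<nu>) + real j + 1) / fact j)) =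
        y powr (- (b * \<nu>)) * ((1 + real m) ^ N * (y powr x * rGamma (x + 1))) * (y ^ j /\<^sub>R fact j)"
        unfolding e by (simp add: divide_inverse mult_ac)
      ultimately show ?thesis using r by (auto simp: Y_def)
    qed
    have s1: "(\<lambda>j. (if j = 0 then r else 0) + Y * (y ^ j /\<^sub>R fact j)) sums (r + Y * exp y)"
      using sums_single[of 0 "\<lambda>_. r"] exp_converges[of y] by (intro sums_add sums_mult) (auto simp: eq_commute)
    have s2: "(\<lambda>j. (1 + real m) ^ N * (pow0 y (b * m) * (y ^ (2 * j) * rGamma (b * (m + \<nu>) + real j + 1) / fact j))) sums
      ((1 + real m) ^ N * (pow0 y (b * m) * real_I (b * (m + \<nu>)) y))"
      unfolding real_I_def by (intro sums_mult summable_sums summable_real_I mu1)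
    have "(1 + real m) ^ N * (pow0 y (b * m) * real_I (b * (m + \<nu>)) y) \<le> r + Y * exp y"
      by (rule sums_le[OF trm s2 s1])
    also have "\<dots> = r + (D ^ N * C) * (y powr (- (b * \<nu>)) * (1 + y) ^ N * exp (2 * y))"
      by (simp add: Y_def mult_ac flip: exp_add mult_2)
    also have "\<dots> \<le> (r + D ^ N * C) * (1 + y powr (- (b * \<nu>)) * (1 + y) ^ N * exp (2 * y))"
    proof -
      have "u + v * w \<le> (u + v) * (1 + w)" if "u \<ge> 0" "v \<ge> 0" "w \<ge> 0" for u v w :: real
        using that by (simp add: algebra_simps)
      then show ?thesis using r D C y by auto
    qed
    finally show ?thesis .
  qed
  then show ?thesis by blast
qed

text \<open>\<open>y^(-b\<nu>)\<close> may be unbounded near \<open>0\<close>, but the left-hand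
  side is nondecreasing in \<open>y\<close>, so for \<open>y < 1/2\<close> the bound at
  \<open>1/2\<close> suffices. For \<open>y \<ge> 1/2\<close> the estimate
  \<open>1 + y \<le> 3y\<close> merges all powers into \<open>y^(N - b\<nu>)\<close>.\<close>

lemma bessel_term_bound:
  fixes b \<nu> :: real and N :: nat
  assumes b: "b > 0" and lam: "b * \<nu> > -1" and N: "real N = 2 * \<nu> + 2" "N > 0"
  shows "\<exists>C>0. \<forall>m y. y \<ge> 0 \<longrightarrow> (1 + real m) ^ N * (pow0 y (b * m) * real_I (b * (m + \<nu>)) y) \<le>
     C * exp (2 * y) * (1 + y powr (N - b * \<nu>))"
proof -
  obtain C where C: "\<And>m y. y > 0 \<Longrightarrow> (1 + real m) ^ N * (pow0 y (b * m) * real_I (b * (m + \<nu>)) y) \<le>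
     C * (1 + y powr (- (b * \<nu>)) * (1 + y) ^ N * exp (2 * y))"
    using bessel_term_bound_pos[OF assms] by blast
  have nu: "\<nu> \<ge> -1/2" using N by linarith
  have mu1: "b * (m + \<nu>) > -1" for m :: nat
    by (rule bessel_index_gt[OF b lam])
  define C' where "C' = max 1 C"
  define E where "E = C' * (1 + (1/2) powr (- (b * \<nu>)) * (1 + 1/2) ^ N * exp (2 * (1/2)))"
  have C': "C' \<ge> 1" "C \<le> C'" by (auto simp: C'_def)
  have "1 * 1 \<le> E" unfolding E_def using C' by (intro mult_mono) auto
  then have E: "E \<ge> 1" by simp
  have "(1 + real m) ^ N * (pow0 y (b * m) * real_I (b * (m + \<nu>)) y) \<le> (3 ^ N * C' + E) * exp (2 * y) * (1 + y powr (N - b * \<nu>))"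
    if y: "y \<ge> 0" for m :: nat and y
  proof (cases "y \<ge> 1/2")
    case True
    have "(1 + real m) ^ N * (pow0 y (b * m) * real_I (b * (m + \<nu>)) y) \<le> C * (1 + y powr (- (b * \<nu>)) * (1 + y) ^ N * exp (2 * y))"
      using True by (intro C) auto
    also have "\<dots> \<le> C' * (1 + y powr (- (b * \<nu>)) * (1 + y) ^ N * exp (2 * y))"
      using C' y by (intro mult_right_mono) auto
    also have "\<dots> \<le> C' * (3 ^ N * (exp (2 * y) * (1 + y powr (N - b * \<nu>))))"
    proof (rule mult_left_mono)
      have "(1 + y) ^ N \<le> (3 * y) ^ N" using True by (intro power_mono) auto
      then have "y powr (- (b * \<nu>)) * (1 + y) ^ N * exp (2 * y) \<le> y powr (- (b * \<nu>)) * (3 * y) ^ N * exp (2 * y)"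
        by (intro mult_right_mono mult_left_mono) auto
      also have "\<dots> = 3 ^ N * (exp (2 * y) * y powr (N - b * \<nu>))"
        using True by (simp add: power_mult_distrib powr_diff powr_minus powr_realpow field_simps)
      finally have "y powr (- (b * \<nu>)) * (1 + y) ^ N * exp (2 * y) \<le> 3 ^ N * (exp (2 * y) * y powr (N - b * \<nu>))" .
      moreover have "1 * 1 \<le> 3 ^ N * exp (2 * y)" using y by (intro mult_mono one_le_power) auto
      ultimately show "1 + y powr (- (b * \<nu>)) * (1 + y) ^ N * exp (2 * y) \<le> 3 ^ N * (exp (2 * y) * (1 + y powr (N - b * \<nu>)))"
        unfolding distrib_left by linarith
    qed (use C' in simp)
    also have "\<dots> = (3 ^ N * C') * exp (2 * y) * (1 + y powr (N - b * \<nu>))" by (simp add: mult_ac)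
    also have "\<dots> \<le> (3 ^ N * C' + E) * exp (2 * y) * (1 + y powr (N - b * \<nu>))"
      using E by (intro mult_right_mono) auto
    finally show ?thesis .
  next
    case False
    have "(1 + real m) ^ N * (pow0 y (b * m) * real_I (b * (m + \<nu>)) y) \<le>
      (1 + real m) ^ N * (pow0 (1/2) (b * m) * real_I (b * (m + \<nu>)) (1/2))"
      using False y b by (intro mult_left_mono mult_mono pow0_mono real_I_mono mu1 pow0_nonneg real_I_nonneg) auto
    also have "\<dots> \<le> C * (1 + (1/2) powr (- (b * \<nu>)) * (1 + 1/2) ^ N * exp (2 * (1/2)))"
      by (rule C) simp
    also have "\<dots> \<le> E" unfolding E_def using C' by (intro mult_right_mono) auto
    also have "E = E * 1 * 1" by simp
    also have "\<dots> \<le> (3 ^ N * C' + E) * exp (2 * y) * (1 + y powr (N - b * \<nu>))"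
      using E C' y by (intro mult_mono) auto
    finally show ?thesis .
  qed
  moreover have "3 ^ N * C' + E > 0" using E C' by (intro add_nonneg_pos) auto
  ultimately show ?thesis by blast
qed

text \<open>The power of \<open>y\<close> costs at most one further \<open>e^y\<close>; this coarser
  form is what domination and summability use. The exponent \<open>N - b\<nu>\<close> can be
  negative, whence the separate treatment of \<open>y < 1/2\<close>.\<close>

lemma bessel_term_bound_exp:
  fixes b \<nu> :: real and N :: nat
  assumes b: "b > 0" and lam: "b * \<nu> > -1" and N: "real N = 2 * \<nu> + 2" "N > 0"
  shows "\<exists>C>0. \<forall>m y. y \<ge> 0 \<longrightarrow> (1 + real m) ^ N * (pow0 y (b * m) * real_I (b * (m + \<nu>)) y) \<le> C * exp (3 * y)"
proof -
  obtain C where C: "C > 0" "\<And>m y. y \<ge> 0 \<Longrightarrow> (1 + real m) ^ N * (pow0 y (b * m) * real_I (b * (m + \<nu>)) y) \<le>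
     C * exp (2 * y) * (1 + y powr (N - b * \<nu>))"
    using bessel_term_bound[OF assms] by blast
  define p where "p = N - b * \<nu>"
  have mu1: "b * (m + \<nu>) > -1" for m :: nat
    by (rule bessel_index_gt[OF b lam])
  \<comment> \<open>The first summand serves negative \<open>p\<close>, for which \<open>y^p\<close>
    is largest at \<open>1/2\<close>; the second is \<open>Gamma (|p| + 1)\<close>, from
    \<open>powr_rGamma_le_exp\<close>.\<close>
  define E where "E = (1/2) powr p + inverse (rGamma (\<bar>p\<bar> + 1))"
  have rg: "rGamma (\<bar>p\<bar> + 1) > 0" by (intro rGamma_real_pos) linarith
  have E: "E \<ge> 0" unfolding E_def using rg by simp
  have pw: "y powr p \<le> E * exp y" if y: "y \<ge> 1/2" for y
  proof (cases "p \<ge> 0")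
    case True
    have "y powr p \<le> inverse (rGamma (\<bar>p\<bar> + 1)) * exp y"
      using powr_rGamma_le_exp[of y p] True y rg by (simp add: field_simps)
    also have "\<dots> \<le> E * exp y" unfolding E_def by (intro mult_right_mono) auto
    finally show ?thesis .
  next
    case False
    then have "y powr p \<le> (1/2) powr p * 1" using y by (simp add: powr_mono2')
    also have "\<dots> \<le> E * exp y" unfolding E_def using y rg by (intro mult_mono) auto
    finally show ?thesis .
  qed
  have up: "(1 + real m) ^ N * (pow0 y (b * m) * real_I (b * (m + \<nu>)) y) \<le> C * (1 + E) * exp (3 * y)"
    if y: "y \<ge> 1/2" for m :: nat and y
  proof -
    have "1 + y powr p \<le> 1 * exp y + E * exp y" using pw[OF y] y by (intro add_mono) auto
    then have "C * exp (2 * y) * (1 + y powr p) \<le> C * exp (2 * y) * (1 * exp y + E * exp y)"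
      using C by (intro mult_left_mono) auto
    also have "\<dots> = C * (1 + E) * exp (2 * y + y)" by (simp add: algebra_simps flip: exp_add)
    finally show ?thesis using C(2)[of y m] y by (auto simp: p_def intro: order_trans)
  qed
  have "(1 + real m) ^ N * (pow0 y (b * m) * real_I (b * (m + \<nu>)) y) \<le> (C * (1 + E) * exp (3/2)) * exp (3 * y)"
    if y: "y \<ge> 0" for m :: nat and y
  proof (cases "y \<ge> 1/2")
    case True
    have "C * (1 + E) * exp (3 * y) * 1 \<le> C * (1 + E) * exp (3 * y) * exp (3/2)"
      using C E by (intro mult_left_mono) auto
    with up[OF True, of m] show ?thesis by (simp add: mult_ac)
  next
    case False
    have "(1 + real m) ^ N * (pow0 y (b * m) * real_I (b * (m + \<nu>)) y) \<le>
      (1 + real m) ^ N * (pow0 (1/2) (b * m) * real_I (b * (m + \<nu>)) (1/2))"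
      using False y b by (intro mult_left_mono mult_mono pow0_mono real_I_mono mu1 pow0_nonneg real_I_nonneg) auto
    also have "\<dots> \<le> C * (1 + E) * exp (3 * (1/2))" by (rule up) simp
    also have "\<dots> \<le> (C * (1 + E) * exp (3/2)) * exp (3 * y)"
      using C E y by simp
    finally show ?thesis .
  qed
  moreover have "C * (1 + E) * exp (3/2) > 0" using C E by (intro mult_pos_pos) auto
  ultimately show ?thesis by blast
qed

section \<open>Weber's integral\<close>

lemma has_sum_product:
  fixes f :: "'a \<Rightarrow> real" and g :: "'b \<Rightarrow> real"
  assumes "(f has_sum F) A" "(g has_sum G) B" "Infinite_Sum.abs_summable_on f A" "Infinite_Sum.abs_summable_on g B"
  shows "((\<lambda>(x, y). f x * g y) has_sum (F * G)) (A \<times> B)" "Infinite_Sum.abs_summable_on (\<lambda>(x, y). f x * g y) (A \<times> B)"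
proof -
  show abs: "Infinite_Sum.abs_summable_on (\<lambda>(x, y). f x * g y) (A \<times> B)"
    unfolding Infinite_Sum.abs_summable_on_Sigma_iff
  proof (intro conjI ballI)
    show "Infinite_Sum.abs_summable_on (\<lambda>y. case (x, y) of (x, y) \<Rightarrow> f x * g y) B" for x
      using assms(4) by (simp add: abs_mult summable_on_cmult_right)
    show "Infinite_Sum.abs_summable_on (\<lambda>x. infsum (\<lambda>y. norm (case (x, y) of (x, y) \<Rightarrow> f x * g y)) B) A"
      using assms(3) by (simp add: abs_mult infsum_cmult_right' summable_on_cmult_left)
  qed
  show "((\<lambda>(x, y). f x * g y) has_sum (F * G)) (A \<times> B)"
  proof (rule has_sum_SigmaI)
    show "((\<lambda>y. case (x, y) of (x, y) \<Rightarrow> f x * g y) has_sum f x * G) B" for x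
      using assms(2) by (simp add: has_sum_cmult_right)
    show "((\<lambda>x. f x * G) has_sum F * G) A"
      using assms(1) by (rule has_sum_cmult_left)
    show "(\<lambda>(x, y). f x * g y) summable_on A \<times> B"
      using abs by (rule abs_summable_summable)
  qed
qed

lemma exp_has_sum:
  fixes x :: real
  shows "((\<lambda>n. x ^ n / fact n) has_sum exp x) UNIV" "Infinite_Sum.abs_summable_on (\<lambda>n. x ^ n / fact n) UNIV"
proof -
  have s: "(\<lambda>n. x ^ n / fact n) sums exp x" for x :: real
    using exp_converges[of x] by (simp add: divide_inverse mult.commute)
  have n: "summable (\<lambda>n. norm (x ^ n / fact n))"
    using s[of "\<bar>x\<bar>"] by (simp add: sums_iff power_abs abs_mult)
  show "((\<lambda>n. x ^ n / fact n) has_sum exp x) UNIV"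
    by (rule norm_summable_imp_has_sum[OF n s])
  show "Infinite_Sum.abs_summable_on (\<lambda>n. x ^ n / fact n) UNIV"
    by (rule norm_summable_imp_summable_on) (use n in simp)
qed

text \<open>This is the Chu-Vandermonde identity for \<open>(j + \<mu> + l) gchoose l\<close>, with
  the binomials rewritten as Gamma values.\<close>

lemma Gamma_Vandermonde:
  fixes \<mu> :: real
  assumes "\<mu> > -1"
  shows "Gamma (\<mu> + j + l + 1) * rGamma (\<mu> + j + 1) * rGamma (\<mu> + l + 1) / (fact j * fact l) =
    (\<Sum>k\<le>min j l. rGamma (\<mu> + k + 1) / (fact k * fact (j - k) * fact (l - k)))"
proof -
  have np: "z + 1 \<notin> \<int>\<^sub>\<le>\<^sub>0" if "z > -1" for z :: real
    using that by (auto simp: nonpos_Ints_def)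
  have gp: "Gamma (\<mu> + l + 1) > 0" using assms by (intro Gamma_real_pos) linarith
  have "(\<Sum>k=0..l. (real j gchoose k) * ((\<mu> + l) gchoose (l - k))) = (real j + (\<mu> + l)) gchoose l"
    by (rule gbinomial_Vandermonde)
  also have "\<dots> = Gamma (\<mu> + j + l + 1) / (fact l * Gamma (\<mu> + j + 1))"
    using assms by (subst gbinomial_Gamma) (auto intro!: np simp: algebra_simps)
  finally have "(\<Sum>k=0..l. (real j gchoose k) * ((\<mu> + l) gchoose (l - k))) * (rGamma (\<mu> + l + 1) / fact j) =
    Gamma (\<mu> + j + l + 1) * rGamma (\<mu> + j + 1) * rGamma (\<mu> + l + 1) / (fact j * fact l)"
    by (simp add: rGamma_inverse_Gamma divide_inverse mult_ac)
  moreover have "(\<Sum>k=0..l. (real j gchoose k) * ((\<mu> + l) gchoose (l - k))) * (rGamma (\<mu> + l + 1) / fact j) =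
    (\<Sum>k\<le>min j l. rGamma (\<mu> + k + 1) / (fact k * fact (j - k) * fact (l - k)))"
    unfolding sum_distrib_right
  proof (rule sum.mono_neutral_cong_right)
    fix k assume "k \<in> {..min j l}"
    then have k: "k \<le> j" "k \<le> l" by auto
    have g1: "(\<mu> + l) gchoose (l - k) = Gamma (\<mu> + l + 1) / (fact (l - k) * Gamma (\<mu> + k + 1))"
      using assms k by (subst gbinomial_Gamma) (auto intro!: np simp: of_nat_diff algebra_simps)
    have g2: "real j gchoose k = fact j / (fact k * fact (j - k))"
      using k by (simp add: binomial_gbinomial[symmetric] binomial_fact)
    show "(real j gchoose k) * ((\<mu> + l) gchoose (l - k)) * (rGamma (\<mu> + l + 1) / fact j) =
      rGamma (\<mu> + k + 1) / (fact k * fact (j - k) * fact (l - k))"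
      unfolding g1 g2 using gp by (simp add: rGamma_inverse_Gamma divide_simps)
  qed (auto simp: binomial_gbinomial[symmetric])
  ultimately show ?thesis by simp
qed

text \<open>
  Weber's second exponential integral, at the level of power series: multiply the series of
  \<open>e\<^sup>-\<^sup>X\<close>, \<open>e\<^sup>-\<^sup>Y\<close> and \<open>I\<^sub>\<mu>\<close> and collect the coefficient of \<open>X\<^sup>j Y\<^sup>l\<close> by Vandermonde's identity.
\<close>

lemma weber_has_sum:
  fixes \<mu> R S \<tau> :: real
  assumes mu: "\<mu> > -1" and tau: "\<tau> > 0"
  defines "X \<equiv> R\<^sup>2 / \<tau>" and "Y \<equiv> S\<^sup>2 / \<tau>"
  shows "((\<lambda>(j, l). (- X) ^ j * (- Y) ^ l * (Gamma (\<mu> + j + l + 1) * rGamma (\<mu> + j + 1) * rGamma (\<mu> + l + 1) / (fact j * fact l)))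
    has_sum (exp (- X) * exp (- Y) * real_I \<mu> (R * S / \<tau>))) UNIV"
proof -
  define y where "y = R * S / \<tau>"
  define f where "f k = y ^ (2 * k) * rGamma (\<mu> + real k + 1) / fact k" for k
  \<comment> \<open>Since \<open>y^2 = X Y\<close>, a factor \<open>y^(2k)\<close> raises the
    exponents of \<open>- X\<close> and \<open>- Y\<close> by \<open>k\<close> each, and the signs
    cancel.\<close>
  have XY: "y ^ (2 * k) = (- X) ^ k * (- Y) ^ k" for k
    by (simp add: y_def X_def Y_def power_mult power_mult_distrib[symmetric] power_divide power2_eq_square[symmetric])
  have f: "(f has_sum real_I \<mu> y) UNIV" "Infinite_Sum.abs_summable_on f UNIV"
  proof -
    have s: "f sums real_I \<mu> y" unfolding f_def real_I_def by (rule summable_sums[OF summable_real_I[OF mu]])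
    have nn: "f k \<ge> 0" for k unfolding f_def by (rule real_I_term_nonneg[OF mu])
    show "(f has_sum real_I \<mu> y) UNIV" by (rule sums_nonneg_imp_has_sum[OF s nn])
    then show "Infinite_Sum.abs_summable_on f UNIV" using nn by (auto simp: summable_on_def)
  qed
  let ?e = "\<lambda>X n. (- X) ^ n / fact n :: real"
  let ?G = "\<lambda>(k, (i, n)). f k * (?e X i * ?e Y n)"
  have e2: "((\<lambda>(i, n). ?e X i * ?e Y n) has_sum (exp (- X) * exp (- Y))) (UNIV \<times> UNIV)"
      "Infinite_Sum.abs_summable_on (\<lambda>(i, n). ?e X i * ?e Y n) (UNIV \<times> UNIV)"
    by (rule has_sum_product exp_has_sum)+
  have "(?G has_sum (real_I \<mu> y * (exp (- X) * exp (- Y)))) (UNIV \<times> (UNIV \<times> UNIV))"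
    using has_sum_product(1)[OF f(1) e2(1) f(2) e2(2)] by (simp add: case_prod_unfold)
  \<comment> \<open>The new indices \<open>j = k + i\<close> and \<open>l = k + n\<close> are the
    total exponents of \<open>X\<close> and \<open>Y\<close>; for fixed \<open>(j, l)\<close> only
    finitely many \<open>k\<close> remain.\<close>
  also have "?this \<longleftrightarrow> ((\<lambda>((j, l), k). f k * (?e X (j - k) * ?e Y (l - k))) has_sum (real_I \<mu> y * (exp (- X) * exp (- Y))))
     (Sigma UNIV (\<lambda>(j, l). {..min j l}))"
    by (rule has_sum_reindex_bij_witness[of _ "\<lambda>((j, l), k). (k, (j - k, l - k))" "\<lambda>(k, (i, n)). ((k + i, k + n), k)"]) auto
  finally have "((\<lambda>(j, l). (- X) ^ j * (- Y) ^ l * (Gamma (\<mu> + j + l + 1) * rGamma (\<mu> + j + 1) * rGamma (\<mu> + l + 1) / (fact j * fact l)))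
     has_sum (real_I \<mu> y * (exp (- X) * exp (- Y)))) UNIV"
  proof (rule has_sum_SigmaD, goal_cases)
    case (1 x)
    obtain j l where x: "x = (j, l)" by (cases x)
    have "(\<Sum>k\<le>min j l. f k * (?e X (j - k) * ?e Y (l - k))) = (\<Sum>k\<le>min j l. ((- X) ^ j * (- Y) ^ l) * (rGamma (\<mu> + k + 1) / (fact k * fact (j - k) * fact (l - k))))"
    proof (rule sum.cong[OF refl])
      fix k assume "k \<in> {..min j l}"
      then have k: "k \<le> j" "k \<le> l" by auto
      have pX: "(- X) ^ j = (- X) ^ k * (- X) ^ (j - k)" and pY: "(- Y) ^ l = (- Y) ^ k * (- Y) ^ (l - k)"
        using k by (simp_all flip: power_add)
      show "f k * (?e X (j - k) * ?e Y (l - k)) = ((- X) ^ j * (- Y) ^ l) * (rGamma (\<mu> + k + 1) / (fact k * fact (j - k) * fact (l - k)))"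
        unfolding f_def XY pX pY by (simp add: mult_ac)
    qed
    also have "\<dots> = (- X) ^ j * (- Y) ^ l * (Gamma (\<mu> + j + l + 1) * rGamma (\<mu> + j + 1) * rGamma (\<mu> + l + 1) / (fact j * fact l))"
      by (simp only: Gamma_Vandermonde[OF mu] sum_distrib_left)
    finally have "(\<Sum>k\<le>min j l. f k * (?e X (j - k) * ?e Y (l - k))) = (- X) ^ j * (- Y) ^ l * (Gamma (\<mu> + j + l + 1) * rGamma (\<mu> + j + 1) * rGamma (\<mu> + l + 1) / (fact j * fact l))" .
    then show ?case
      unfolding x prod.case by (intro has_sum_finiteI) auto
  qed
  then show ?thesis by (simp add: y_def mult.commute)
qed

text \<open>The squares \<open>{..<K} \<times> {..<K}\<close> are cofinal among the finite index
  sets. Square partial sums are what the product of two truncated Bessel series produces.\<close>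

lemma weber_tendsto:
  fixes \<mu> R S \<tau> :: real
  assumes mu: "\<mu> > -1" and tau: "\<tau> > 0"
  defines "X \<equiv> R\<^sup>2 / \<tau>" and "Y \<equiv> S\<^sup>2 / \<tau>"
  shows "(\<lambda>K. \<Sum>j<K. \<Sum>l<K. (- X) ^ j * (- Y) ^ l * (Gamma (\<mu> + j + l + 1) * rGamma (\<mu> + j + 1) * rGamma (\<mu> + l + 1) / (fact j * fact l)))
    \<longlonglongrightarrow> exp (- X) * exp (- Y) * real_I \<mu> (R * S / \<tau>)"
proof -
  have fl: "filterlim (\<lambda>K. {..<K} \<times> {..<K::nat}) (finite_subsets_at_top UNIV) sequentially"
    unfolding filterlim_finite_subsets_at_top
  proof (intro allI impI)
    fix F :: "(nat \<times> nat) set" assume F: "finite F \<and> F \<subseteq> UNIV"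
    then have "finite (fst ` F \<union> snd ` F)" by auto
    then obtain n where n: "fst ` F \<union> snd ` F \<subseteq> {..<n}" using finite_nat_iff_bounded by blast
    show "\<forall>\<^sub>F K in sequentially. finite ({..<K} \<times> {..<K}) \<and> F \<subseteq> {..<K} \<times> {..<K} \<and> {..<K} \<times> {..<K} \<subseteq> UNIV"
      using eventually_ge_at_top[of n]
    proof eventually_elim
      case (elim K)
      have "p \<in> {..<K} \<times> {..<K}" if "p \<in> F" for p
      proof -
        have "fst p < n" "snd p < n" using n that by auto
        with elim show ?thesis by (cases p) auto
      qed
      then show ?case by auto
    qed
  qed
  from filterlim_compose[OF weber_has_sum[OF mu tau, of R S, unfolded has_sum_def] fl]
  show ?thesis by (simp add: sum.cartesian_product X_def Y_def)
qed

section \<open>Termwise integration against the radial weight\<close>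

lemma integrable_norm_powr_exp:
  "a > 0 \<Longrightarrow> \<tau> > 0 \<Longrightarrow> (\<kappa>::real) + DIM('a) > 0 \<Longrightarrow>
    integrable lborel (\<lambda>x::'a::euclidean_space. norm x powr \<kappa> * exp (- \<tau> * norm x powr a))"
  using has_bochner_integral_norm_powr_exp[of a \<tau> \<kappa>, where 'a='a] by (simp add: has_bochner_integral_iff)

text \<open>Completing the square: one half of the Gaussian exponent absorbs the exponential growth,
  the other half is left for integrability.\<close>

lemma exp_linear_minus_square_le:
  fixes \<kappa> \<tau> u :: real
  assumes "\<tau> > 0"
  shows "exp (\<kappa> * u) * exp (- \<tau> * u\<^sup>2) \<le> exp (\<kappa>\<^sup>2 / (2 * \<tau>)) * exp (- (\<tau> / 2) * u\<^sup>2)"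
proof -
  have "0 \<le> (\<kappa> - \<tau> * u)\<^sup>2 / (2 * \<tau>)" using assms by simp
  also have "\<dots> = \<kappa>\<^sup>2 / (2 * \<tau>) - \<kappa> * u + \<tau> / 2 * u\<^sup>2"
    using assms by (simp add: power2_eq_square field_simps)
  finally show ?thesis by (simp flip: exp_add)
qed

lemma pow0_mult_powr:
  assumes "R \<ge> 0" "u > 0"
  shows "pow0 (R * u) s = pow0 R s * u powr s"
  using assms by (auto simp: pow0_def powr_mult)

text \<open>Multiplied by \<open>a\<close>, the condition \<open>b * \<nu> > -1\<close> on the
  Bessel orders reads \<open>N - 2 > -a\<close>, which is the local integrability of
  \<open>|x|^(a-2)\<close>.\<close>

lemma dimension_condition:
  assumes "a > 0" "b = 2 / a" "real N = 2 * \<nu> + 2" "b * \<nu> > -1"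
  shows "a - 2 + real N > 0"
proof -
  have "b * a = 2" using assms by simp
  then have "b * \<nu> * a = 2 * \<nu>" by (simp add: mult.assoc mult.left_commute[of b])
  moreover have "b * \<nu> * a > -1 * a" using assms by (intro mult_strict_right_mono) auto
  ultimately show ?thesis using assms by linarith
qed

text \<open>In the variable \<open>|x|^(a/2)\<close> the exponential weight is a Gaussian and the
  integral is Weber's. The truncated Bessel series are multiplied out and integrated term by term
  into Gamma values, whose limit is \<open>weber_tendsto\<close>; the truncations are bounded
  uniformly in \<open>K\<close>.\<close>

lemma weber_integral:
  fixes a b \<nu> \<tau> R S :: real and m :: nat
  assumes a: "a > 0" "b = 2 / a" and nu: "real DIM('a::euclidean_space) = 2 * \<nu> + 2" and lam: "b * \<nu> > -1"
    and RS: "R \<ge> 0" "S \<ge> 0" and tau: "\<tau> > 0"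
  defines "u \<equiv> \<lambda>x::'a. norm x powr (a / 2)" and "\<mu> \<equiv> b * (m + \<nu>)"
  shows "(LINT x|lborel. (pow0 (R * u x) (b * m) * real_J \<mu> (R * u x)) * (pow0 (S * u x) (b * m) * real_J \<mu> (S * u x)) *
     (norm x powr (a - 2) * exp (- \<tau> * norm x powr a))) =
     unit_ball_vol DIM('a) * DIM('a) / a * \<tau> powr (- (b * \<nu> + 1)) * exp (- (R\<^sup>2 / \<tau>)) * exp (- (S\<^sup>2 / \<tau>)) *
       (pow0 (R * S / \<tau>) (b * m) * real_I \<mu> (R * S / \<tau>))" (is "(LINT x|lborel. ?F x) = ?r")
proof -
  let ?N = "DIM('a)" and ?W = "\<lambda>x::'a. norm x powr (a - 2) * exp (- \<tau> * norm x powr a)"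
  define P where "P K y = (\<Sum>j<K. (-1) ^ j * (y ^ (2 * j) * rGamma (\<mu> + real j + 1) / fact j))" for K y
  have b: "b > 0" using a by simp
  have mu: "\<mu> > -1" unfolding \<mu>_def by (rule bessel_index_gt[OF b lam])
  have kap: "a - 2 + ?N > 0" by (rule dimension_condition[OF a nu lam])
  have DIM: "?N > 0" by simp
  obtain C where C: "C > 0" "\<And>m y. y \<ge> 0 \<Longrightarrow> (1 + real m) ^ ?N * (pow0 y (b * m) * real_I (b * (m + \<nu>)) y) \<le> C * exp (3 * y)"
    using bessel_term_bound_exp[OF b lam nu DIM] by blast
  have bd: "pow0 y (b * m) * real_I \<mu> y \<le> C * exp (3 * y)" if "y \<ge> 0" for y
  proof -
    have "1 * (pow0 y (b * m) * real_I \<mu> y) \<le> (1 + real m) ^ ?N * (pow0 y (b * m) * real_I \<mu> y)"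
      by (intro mult_right_mono one_le_power mult_nonneg_nonneg pow0_nonneg real_I_nonneg mu) auto
    with C(2)[OF that, of m] show ?thesis by (simp add: \<mu>_def)
  qed
  have bdP: "\<bar>pow0 y (b * m) * P K y\<bar> \<le> C * exp (3 * y)" if "y \<ge> 0" for y K
  proof -
    have "\<bar>pow0 y (b * m) * P K y\<bar> \<le> pow0 y (b * m) * real_I \<mu> y"
      unfolding abs_mult P_def using partial_real_J_le[OF mu] pow0_nonneg[of y "b * m"] by (simp add: mult_left_mono)
    with bd[OF that] show ?thesis by linarith
  qed
  let ?s = "\<lambda>K x. (pow0 (R * u x) (b * m) * P K (R * u x)) * (pow0 (S * u x) (b * m) * P K (S * u x)) * ?W x"
  \<comment> \<open>The exponential is the constant of \<open>exp_linear_minus_square_le\<close> for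
    \<open>\<kappa> = 3(R + S)\<close>, the joint growth rate of the two truncations in
    \<open>u x\<close>.\<close>
  let ?c = "C * C * exp ((3 * (R + S))\<^sup>2 / (2 * \<tau>))"
  let ?w = "\<lambda>x::'a. ?c * (norm x powr (a - 2) * exp (- (\<tau> / 2) * norm x powr a))"
  have u0: "u x \<ge> 0" for x by (simp add: u_def)
  have u2: "(u x)\<^sup>2 = norm x powr a" for x
    by (cases "x = 0") (simp_all add: u_def powr_realpow[symmetric] powr_powr)
  have dom: "norm (?s K x) \<le> ?w x" for K x
  proof -
    have "norm (?s K x) \<le> ((C * exp (3 * (R * u x))) * (C * exp (3 * (S * u x)))) * ?W x"
      unfolding real_norm_def abs_mult[of _ "?W x"] abs_mult[of _ "pow0 (S * u x) (b * m) * P K (S * u x)"]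
      using C RS u0 by (intro mult_mono bdP) auto
    also have "\<dots> = C * C * norm x powr (a - 2) * (exp (3 * (R + S) * u x) * exp (- \<tau> * (u x)\<^sup>2))"
      by (simp add: u2 algebra_simps flip: exp_add)
    also have "\<dots> \<le> C * C * norm x powr (a - 2) * (exp ((3 * (R + S))\<^sup>2 / (2 * \<tau>)) * exp (- (\<tau> / 2) * (u x)\<^sup>2))"
      using C by (intro mult_left_mono exp_linear_minus_square_le tau) auto
    finally show ?thesis by (simp add: u2 mult_ac)
  qed
  have Pm [measurable]: "P K \<in> borel_measurable borel" for K unfolding P_def by measurable
  have pm [measurable]: "(\<lambda>y. pow0 y s) \<in> borel_measurable borel" for s
    unfolding pow0_def by (cases "s = 0") auto
  have um [measurable]: "u \<in> borel_measurable borel" unfolding u_def by measurable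
  have sm [measurable]: "?s K \<in> borel_measurable lborel" for K by measurable
  have lim: "(\<lambda>K. ?s K x) \<longlonglongrightarrow> ?F x" for x
    unfolding P_def by (intro tendsto_mult tendsto_const real_J_partial_tendsto mu)
  have "(\<lambda>K. LINT x|lborel. ?s K x) \<longlonglongrightarrow> (LINT x|lborel. ?F x)"
  proof (rule integral_dominated_convergence)
    show "?F \<in> borel_measurable lborel"
      by (rule borel_measurable_LIMSEQ_metric[OF sm lim])
    show "integrable lborel ?w"
      by (rule integrable_mult_right, rule integrable_norm_powr_exp) (use a tau kap in auto)
    show "AE x in lborel. (\<lambda>K. ?s K x) \<longlonglongrightarrow> ?F x" using lim by simp
    show "AE x in lborel. norm (?s K x) \<le> ?w x" for K using dom by simp
  qed (rule sm)
  moreover define c where "c = unit_ball_vol ?N * ?N / a * (pow0 R (b * m) * pow0 S (b * m) * \<tau> powr (- (\<mu> + 1)))"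
  have "(LINT x|lborel. ?s K x) = c * (\<Sum>j<K. \<Sum>l<K. (- (R\<^sup>2 / \<tau>)) ^ j * (- (S\<^sup>2 / \<tau>)) ^ l *
     (Gamma (\<mu> + j + l + 1) * rGamma (\<mu> + j + 1) * rGamma (\<mu> + l + 1) / (fact j * fact l)))" for K
  proof -
    define d where "d j l = (-1) ^ (j + l) * (pow0 R (b * m) * pow0 S (b * m)) * R ^ (2 * j) * S ^ (2 * l) *
       (rGamma (\<mu> + real j + 1) * rGamma (\<mu> + real l + 1) / (fact j * fact l))" for j l :: nat
    \<comment> \<open>\<open>\<kappa> j l\<close> is the total exponent of \<open>|x|\<close> in the
      term \<open>(j, l)\<close>, written so that \<open>(\<kappa> + N)/a\<close> is the Gamma
      argument \<open>\<mu> + j + l + 1\<close> of the double series.\<close>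
    define \<kappa> where "\<kappa> j l = a * (\<mu> + real j + real l + 1) - ?N" for j l :: nat
    have kap': "\<kappa> j l = a * j + a * l + 2 * m + (a - 2)" for j l
      using a by (simp add: \<kappa>_def \<mu>_def nu field_simps)
    have intk: "has_bochner_integral lborel (\<lambda>x::'a. norm x powr \<kappa> j l * exp (- \<tau> * norm x powr a))
      (unit_ball_vol ?N * ?N / a * \<tau> powr (- (\<mu> + j + l + 1)) * Gamma (\<mu> + j + l + 1))" for j l
    proof -
      have "\<kappa> j l + ?N > 0" using a mu by (simp add: \<kappa>_def add_nonneg_pos)
      from has_bochner_integral_norm_powr_exp[OF a(1) tau this]
      show ?thesis using a by (simp add: \<kappa>_def)
    qed
    have "(LINT x|lborel. ?s K x) = (LINT x::'a|lborel. (\<Sum>j<K. \<Sum>l<K. d j l * (norm x powr \<kappa> j l * exp (- \<tau> * norm x powr a))))"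
    proof (rule integral_cong_AE)
      show "AE x in lborel. ?s K x = (\<Sum>j<K. \<Sum>l<K. d j l * (norm x powr \<kappa> j l * exp (- \<tau> * norm x powr a)))"
        using AE_lborel_singleton[of "0::'a"]
      proof eventually_elim
        case (elim x)
        then have x: "norm x > 0" by simp
        then have up: "u x > 0" by (simp add: u_def)
        have ub: "u x powr (b * m) = norm x powr m"
          using a by (simp add: u_def powr_powr)
        have uj: "(u x) ^ (2 * j) = norm x powr (a * j)" for j
          using x powr_realpow[of "norm x powr a" j] by (simp add: power_mult u2 powr_powr)
        have "?s K x = (\<Sum>j<K. \<Sum>l<K. (pow0 R (b * m) * norm x powr m * ((-1) ^ j * ((R * u x) ^ (2 * j) * rGamma (\<mu> + real j + 1) / fact j))) *
           (pow0 S (b * m) * norm x powr m * ((-1) ^ l * ((S * u x) ^ (2 * l) * rGamma (\<mu> + real l + 1) / fact l))) * ?W x)"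
        proof -
          have "(A * sum f I) * (B * sum g I) * w = (\<Sum>j\<in>I. \<Sum>l\<in>I. (A * f j) * (B * g l) * w)"
            for A B w :: real and f g and I :: "nat set"
            by (simp only: sum_distrib_left[of A] sum_distrib_left[of B] sum_product sum_distrib_right[of _ _ w])
          then show ?thesis
            unfolding P_def pow0_mult_powr[OF RS(1) up] pow0_mult_powr[OF RS(2) up] ub .
        qed
        also have "\<dots> = (\<Sum>j<K. \<Sum>l<K. d j l * (norm x powr \<kappa> j l * exp (- \<tau> * norm x powr a)))"
        proof (intro sum.cong refl)
          fix j l
          have k: "norm x powr \<kappa> j l = norm x powr (a * j) * norm x powr (a * l) * (norm x powr m * norm x powr m) * norm x powr (a - 2)"
            unfolding kap' by (simp add: powr_add[symmetric])
          show "(pow0 R (b * m) * norm x powr m * ((-1) ^ j * ((R * u x) ^ (2 * j) * rGamma (\<mu> + real j + 1) / fact j))) *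
           (pow0 S (b * m) * norm x powr m * ((-1) ^ l * ((S * u x) ^ (2 * l) * rGamma (\<mu> + real l + 1) / fact l))) * ?W x =
            d j l * (norm x powr \<kappa> j l * exp (- \<tau> * norm x powr a))"
            unfolding k d_def power_mult_distrib uj power_add[of "-1"] by simp
        qed
        finally show ?case .
      qed
    qed measurable
    also have "\<dots> = (\<Sum>j<K. \<Sum>l<K. d j l * (unit_ball_vol ?N * ?N / a * \<tau> powr (- (\<mu> + j + l + 1)) * Gamma (\<mu> + j + l + 1)))"
      by (intro has_bochner_integral_integral_eq has_bochner_integral_sum has_bochner_integral_mult_right intk)
    also have "\<dots> = (\<Sum>j<K. \<Sum>l<K. c * ((- (R\<^sup>2 / \<tau>)) ^ j * (- (S\<^sup>2 / \<tau>)) ^ l *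
     (Gamma (\<mu> + j + l + 1) * rGamma (\<mu> + j + 1) * rGamma (\<mu> + l + 1) / (fact j * fact l))))"
    proof (intro sum.cong refl)
      fix j l
      have "- (\<mu> + j + l + 1) = - (\<mu> + 1) - real j - real l" by simp
      then have t: "\<tau> powr (- (\<mu> + j + l + 1)) = \<tau> powr (- (\<mu> + 1)) / \<tau> ^ j / \<tau> ^ l"
        using tau by (simp only: powr_diff powr_realpow)
      have p: "(- (Q\<^sup>2 / \<tau>)) ^ j = (-1) ^ j * Q ^ (2 * j) / \<tau> ^ j" for Q j
        using power_mult_distrib[of "-1" "Q\<^sup>2 / \<tau>" j] by (simp add: power_divide power_mult)
      show "d j l * (unit_ball_vol ?N * ?N / a * \<tau> powr (- (\<mu> + j + l + 1)) * Gamma (\<mu> + j + l + 1)) =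
        c * ((- (R\<^sup>2 / \<tau>)) ^ j * (- (S\<^sup>2 / \<tau>)) ^ l *
         (Gamma (\<mu> + j + l + 1) * rGamma (\<mu> + j + 1) * rGamma (\<mu> + l + 1) / (fact j * fact l)))"
        unfolding t p d_def c_def power_add by (simp add: mult_ac)
    qed
    finally show ?thesis by (simp add: sum_distrib_left)
  qed
  ultimately have "(\<lambda>K. c * (\<Sum>j<K. \<Sum>l<K. (- (R\<^sup>2 / \<tau>)) ^ j * (- (S\<^sup>2 / \<tau>)) ^ l *
     (Gamma (\<mu> + j + l + 1) * rGamma (\<mu> + j + 1) * rGamma (\<mu> + l + 1) / (fact j * fact l)))) \<longlonglongrightarrow> (LINT x|lborel. ?F x)"
    by simp
  moreover have "(\<lambda>K. c * (\<Sum>j<K. \<Sum>l<K. (- (R\<^sup>2 / \<tau>)) ^ j * (- (S\<^sup>2 / \<tau>)) ^ l *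
     (Gamma (\<mu> + j + l + 1) * rGamma (\<mu> + j + 1) * rGamma (\<mu> + l + 1) / (fact j * fact l)))) \<longlonglongrightarrow>
     c * (exp (- (R\<^sup>2 / \<tau>)) * exp (- (S\<^sup>2 / \<tau>)) * real_I \<mu> (R * S / \<tau>))"
    by (intro tendsto_mult tendsto_const weber_tendsto mu tau)
  ultimately have "(LINT x|lborel. ?F x) = c * (exp (- (R\<^sup>2 / \<tau>)) * exp (- (S\<^sup>2 / \<tau>)) * real_I \<mu> (R * S / \<tau>))"
    by (rule LIMSEQ_unique)
  \<comment> \<open>Since \<open>\<mu> = bm + b\<nu>\<close>, the part \<open>\<tau>^(-bm)\<close>
    of the scaling goes into \<open>(RS/\<tau>)^(bm)\<close>, and the remaining prefactor does not
    depend on \<open>m\<close>.\<close>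
  moreover have "pow0 R (b * m) * pow0 S (b * m) * \<tau> powr (- (\<mu> + 1)) = \<tau> powr (- (b * \<nu> + 1)) * pow0 (R * S / \<tau>) (b * m)"
  proof -
    have "- (\<mu> + 1) = - (b * \<nu> + 1) - b * m" by (simp add: \<mu>_def algebra_simps)
    then have "\<tau> powr (- (\<mu> + 1)) = \<tau> powr (- (b * \<nu> + 1)) / \<tau> powr (b * m)" by (simp only: powr_diff)
    then show ?thesis using RS tau by (simp add: pow0_def powr_mult powr_divide)
  qed
  ultimately show ?thesis by (simp add: c_def)
qed

section \<open>The heat kernel\<close>

lemma principal_power_neg_ii:
  assumes "y \<ge> 0"
  shows "principal_power (- \<i> * of_real y) s = of_real (pow0 y s) * cis (- (pi / 2) * s)"
proof (cases "s = 0 \<or> y = 0")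
  case True
  then show ?thesis by (auto simp: principal_power_def pow0_def rcis_def)
next
  case False
  then have y: "y > 0" using assms by simp
  have "Arg (- \<i> * of_real y) = - (pi / 2)"
    using Arg_times_of_real[OF y, of "- \<i>"] by (simp add: mult.commute)
  then show ?thesis
    using False y by (simp add: principal_power_def pow0_def rcis_def norm_mult)
qed

lemma I_tilde_neg_ii:
  assumes mu: "\<mu> > -1" and w: "w / 2 = - \<i> * of_real y"
  shows "I_tilde \<mu> w = of_real (real_J \<mu> y)"
proof -
  have "(- \<i> * of_real y) ^ (2 * j) = (of_real ((-1) ^ j * y ^ (2 * j)) :: complex)" for j
    using power_minus[of "(of_real y :: complex)\<^sup>2" j] by (simp add: power_mult power_mult_distrib)
  then have "I_tilde \<mu> w = (\<Sum>j. of_real ((-1) ^ j * (y ^ (2 * j) * rGamma (\<mu> + real j + 1) / fact j)))"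
    unfolding I_tilde_def w by (simp add: mult.assoc)
  also have "\<dots> = of_real (real_J \<mu> y)"
    unfolding real_J_def by (rule suminf_of_real[OF summable_real_J[OF mu], symmetric])
  finally show ?thesis .
qed

lemma cnj_measurable [measurable]: "cnj \<in> borel_measurable borel"
  by (intro borel_measurable_continuous_onI continuous_intros)

definition bessel_term :: "real \<Rightarrow> real \<Rightarrow> nat \<Rightarrow> real \<Rightarrow> real" where
  "bessel_term b \<nu> m y = pow0 y (b * real m) * real_J (b * (real m + \<nu>)) y"

text \<open>The \<open>m\<close>-th term of \<open>script_I\<close> at \<open>w = -2iy\<close>,
  without the common factor \<open>Gamma (b\<nu> + 1)\<close>; the phase of
  \<open>(w/2)^(bm)\<close> is separated from a real remainder.\<close>

definition kernel_term :: "real \<Rightarrow> real \<Rightarrow> nat \<Rightarrow> real \<Rightarrow> real \<Rightarrow> complex" where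
  "kernel_term b \<nu> m y t = cis (- (pi / 2) * (b * real m)) * of_real (bessel_term b \<nu> m y * gegenbauer_check \<nu> m t)"

lemma script_I_neg_ii:
  assumes "b > 0" "b * \<nu> > -1" "y \<ge> 0" "w / 2 = - \<i> * of_real y"
  shows "script_I b \<nu> w t = of_real (Gamma (b * \<nu> + 1)) * (\<Sum>m. kernel_term b \<nu> m y t)"
  unfolding script_I_def kernel_term_def bessel_term_def assms(4) principal_power_neg_ii[OF assms(3)]
    I_tilde_neg_ii[OF bessel_index_gt[OF assms(1,2)] assms(4)]
  by (simp add: mult_ac)

lemma pow0_measurable [measurable]: "(\<lambda>y. pow0 y s) \<in> borel_measurable borel"
  unfolding pow0_def by (cases "s = 0") auto

lemma real_J_measurable: "\<mu> > -1 \<Longrightarrow> real_J \<mu> \<in> borel_measurable borel"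
  by (rule borel_measurable_LIMSEQ_metric[OF _ real_J_partial_tendsto]) measurable

lemma bessel_term_measurable:
  assumes "b > 0" "b * \<nu> > -1"
  shows "bessel_term b \<nu> m \<in> borel_measurable borel"
  using real_J_measurable[OF bessel_index_gt[OF assms]] unfolding bessel_term_def by measurable

definition zeta_sum :: real where "zeta_sum = (\<Sum>m. 1 / (1 + real m)\<^sup>2)"

lemma summable_zeta: "summable (\<lambda>m. 1 / (1 + real m)\<^sup>2)"
proof -
  have "summable (\<lambda>n. inverse (real n ^ 2))" by (rule inverse_power_summable) simp
  then have "summable (\<lambda>n. inverse (real (Suc n) ^ 2))" by (subst summable_Suc_iff)
  then show ?thesis by (simp add: divide_inverse add.commute)
qed

text \<open>The \<open>N\<close> powers of \<open>1 + m\<close> in the Bessel estimate pay for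
  \<open>C_m(1)\<close>, which bounds the zonal function, and leave the summable factor
  \<open>(1 + m)^(-2)\<close>.\<close>

lemma gegenbauer_bessel_bound:
  fixes \<omega> \<eta> :: "'a::euclidean_space"
  assumes nu: "real DIM('a) = 2 * \<nu> + 2" and u: "norm \<omega> = 1" "norm \<eta> = 1"
    and I: "(1 + real m) ^ DIM('a) * I \<le> D" "I \<ge> 0"
  shows "\<bar>gegenbauer_check \<nu> m (\<omega> \<bullet> \<eta>)\<bar> * I \<le> 2 * D * (1 / (1 + real m)\<^sup>2)"
proof -
  have "(1 + real m)\<^sup>2 * (\<bar>gegenbauer_check \<nu> m (\<omega> \<bullet> \<eta>)\<bar> * I) \<le> (gegenbauer_check \<nu> m 1 * (1 + real m)\<^sup>2) * I"
    using abs_gegenbauer_check_le[OF nu u, of m] I by (simp add: mult_ac mult_left_mono mult_right_mono)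
  also have "\<dots> \<le> (2 * (1 + real m) ^ DIM('a)) * I"
    using gegenbauer_check_one_bound[OF nu, of m] I by (intro mult_right_mono) auto
  also have "\<dots> \<le> 2 * D" using I by simp
  finally show ?thesis by (simp add: field_simps)
qed

lemma kernel_term_bound:
  assumes b: "b > 0" and lam: "b * \<nu> > -1" and nu: "real DIM('a::euclidean_space) = 2 * \<nu> + 2"
  shows "\<exists>C>0. \<forall>m y. \<forall>\<omega> \<eta> :: 'a. y \<ge> 0 \<longrightarrow> norm \<omega> = 1 \<longrightarrow> norm \<eta> = 1 \<longrightarrow>
    norm (kernel_term b \<nu> m y (\<omega> \<bullet> \<eta>)) \<le> C * exp (3 * y) * (1 / (1 + real m)\<^sup>2)"
proof -
  obtain C where C: "C > 0" "\<And>m y. y \<ge> 0 \<Longrightarrow> (1 + real m) ^ DIM('a) * (pow0 y (b * m) * real_I (b * (m + \<nu>)) y) \<le> C * exp (3 * y)"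
    using bessel_term_bound_exp[OF b lam nu] by auto
  have "norm (kernel_term b \<nu> m y (\<omega> \<bullet> \<eta>)) \<le> 2 * C * exp (3 * y) * (1 / (1 + real m)\<^sup>2)"
    if y: "y \<ge> 0" and u: "norm \<omega> = 1" "norm \<eta> = 1" for m y and \<omega> \<eta> :: 'a
  proof -
    have mu: "b * (real m + \<nu>) > -1" by (rule bessel_index_gt[OF b lam])
    have "norm (kernel_term b \<nu> m y (\<omega> \<bullet> \<eta>)) = \<bar>gegenbauer_check \<nu> m (\<omega> \<bullet> \<eta>)\<bar> * (pow0 y (b * m) * \<bar>real_J (b * (real m + \<nu>)) y\<bar>)"
      by (simp add: kernel_term_def bessel_term_def norm_mult abs_mult pow0_nonneg mult_ac)
    also have "\<dots> \<le> \<bar>gegenbauer_check \<nu> m (\<omega> \<bullet> \<eta>)\<bar> * (pow0 y (b * m) * real_I (b * (real m + \<nu>)) y)"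
      by (intro mult_left_mono abs_real_J_le mu pow0_nonneg) auto
    also have "\<dots> \<le> 2 * (C * exp (3 * y)) * (1 / (1 + real m)\<^sup>2)"
      by (intro gegenbauer_bessel_bound[OF nu u] C y mult_nonneg_nonneg pow0_nonneg real_I_nonneg mu)
    finally show ?thesis by (simp add: mult_ac)
  qed
  then show ?thesis using C(1) by (intro exI[of _ "2 * C"]) auto
qed

definition radial_weight :: "real \<Rightarrow> real \<Rightarrow> 'a::euclidean_space \<Rightarrow> real" where
  "radial_weight a \<tau> x = norm x powr (a - 2) * exp (- \<tau> * norm x powr a)"

lemma radial_weight_nonneg: "radial_weight a \<tau> x \<ge> 0"
  by (simp add: radial_weight_def)

lemma radial_weight_measurable [measurable]: "radial_weight a \<tau> \<in> borel_measurable borel"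
  unfolding radial_weight_def by measurable

lemma integrable_exp_radial_weight:
  fixes a \<tau> \<kappa> :: real
  assumes a: "a > 0" and tau: "\<tau> > 0" and kap: "a - 2 + DIM('a::euclidean_space) > 0"
  shows "integrable lborel (\<lambda>x::'a. exp (\<kappa> * norm x powr (a / 2)) * radial_weight a \<tau> x)"
proof (rule Bochner_Integration.integrable_bound)
  show "integrable lborel (\<lambda>x::'a. exp (\<kappa>\<^sup>2 / (2 * \<tau>)) * (norm x powr (a - 2) * exp (- (\<tau> / 2) * norm x powr a)))"
    by (rule integrable_mult_right, rule integrable_norm_powr_exp) (use a tau kap in auto)
  show "AE x::'a in lborel. norm (exp (\<kappa> * norm x powr (a / 2)) * radial_weight a \<tau> x) \<le>
    norm (exp (\<kappa>\<^sup>2 / (2 * \<tau>)) * (norm x powr (a - 2) * exp (- (\<tau> / 2) * norm x powr a)))"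
  proof (rule AE_I2)
    fix x :: 'a
    have u2: "(norm x powr (a / 2))\<^sup>2 = norm x powr a"
      by (cases "x = 0") (simp_all add: powr_realpow[symmetric] powr_powr)
    have "norm x powr (a - 2) * (exp (\<kappa> * norm x powr (a / 2)) * exp (- \<tau> * (norm x powr (a / 2))\<^sup>2)) \<le>
      norm x powr (a - 2) * (exp (\<kappa>\<^sup>2 / (2 * \<tau>)) * exp (- (\<tau> / 2) * (norm x powr (a / 2))\<^sup>2))"
      by (intro mult_left_mono exp_linear_minus_square_le tau) auto
    then show "norm (exp (\<kappa> * norm x powr (a / 2)) * radial_weight a \<tau> x) \<le>
      norm (exp (\<kappa>\<^sup>2 / (2 * \<tau>)) * (norm x powr (a - 2) * exp (- (\<tau> / 2) * norm x powr a)))"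
      unfolding u2 by (simp add: radial_weight_def mult_ac)
  qed
qed measurable

text \<open>
  Orthogonality leaves only the diagonal terms of the double series, in which the phases cancel.
\<close>

lemma kernel_integral:
  fixes a b \<nu> \<tau> R S :: real and \<omega> \<eta> :: "'a::euclidean_space"
  assumes a: "a > 0" "b = 2 / a" and nu: "real DIM('a) = 2 * \<nu> + 2" and lam: "b * \<nu> > -1"
    and RS: "R \<ge> 0" "S \<ge> 0" and tau: "\<tau> > 0" and un: "norm \<omega> = 1" "norm \<eta> = 1"
  defines "u \<equiv> \<lambda>x::'a. norm x powr (a / 2)"
    and "q \<equiv> \<lambda>m. gegenbauer_check \<nu> m (\<omega> \<bullet> \<eta>) * (pow0 (R * S / \<tau>) (b * real m) * real_I (b * (real m + \<nu>)) (R * S / \<tau>))"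
    and "c \<equiv> unit_ball_vol DIM('a) * DIM('a) / a * \<tau> powr (- (b * \<nu> + 1)) * exp (- (R\<^sup>2 / \<tau>)) * exp (- (S\<^sup>2 / \<tau>))"
  shows "summable q"
    and "(LINT x|lborel. cnj (\<Sum>m. kernel_term b \<nu> m (R * u x) (\<omega> \<bullet> sgn x)) * (\<Sum>m. kernel_term b \<nu> m (S * u x) (\<eta> \<bullet> sgn x)) *
       complex_of_real (radial_weight a \<tau> x)) = complex_of_real (c * suminf q)" (is "(LINT x|lborel. ?F x) = _")
proof -
  have b: "b > 0" using a by simp
  have mu: "b * (real m + \<nu>) > -1" for m by (rule bessel_index_gt[OF b lam])
  have kap: "a - 2 + DIM('a) > 0" by (rule dimension_condition[OF a nu lam])
  obtain C where C: "C > 0" "\<And>m y (\<omega>::'a) \<eta>. y \<ge> 0 \<Longrightarrow> norm \<omega> = 1 \<Longrightarrow> norm \<eta> = 1 \<Longrightarrow>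
    norm (kernel_term b \<nu> m y (\<omega> \<bullet> \<eta>)) \<le> C * exp (3 * y) * (1 / (1 + real m)\<^sup>2)"
    using kernel_term_bound[OF b lam nu] by metis
  obtain C' where C': "C' > 0" "\<And>m y. y \<ge> 0 \<Longrightarrow> (1 + real m) ^ DIM('a) * (pow0 y (b * m) * real_I (b * (m + \<nu>)) y) \<le> C' * exp (3 * y)"
    using bessel_term_bound_exp[OF b lam nu] by auto
  have z0: "zeta_sum \<ge> 0" unfolding zeta_sum_def by (intro suminf_nonneg summable_zeta) auto
  have u0: "u x \<ge> 0" for x by (simp add: u_def)
  have um [measurable]: "u \<in> borel_measurable borel" unfolding u_def by measurable
  note bm [measurable] = bessel_term_measurable[OF b lam]

  show sq: "summable q"
  proof (rule summable_comparison_test'[where N = 0])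
    let ?y = "R * S / \<tau>"
    have y: "?y \<ge> 0" using RS tau by simp
    show "summable (\<lambda>m. 2 * (C' * exp (3 * ?y)) * (1 / (1 + real m)\<^sup>2))"
      by (intro summable_mult summable_zeta)
    fix m :: nat
    have "\<bar>gegenbauer_check \<nu> m (\<omega> \<bullet> \<eta>)\<bar> * (pow0 ?y (b * m) * real_I (b * (real m + \<nu>)) ?y) \<le> 2 * (C' * exp (3 * ?y)) * (1 / (1 + real m)\<^sup>2)"
      by (intro gegenbauer_bessel_bound[OF nu un] C' y mult_nonneg_nonneg pow0_nonneg real_I_nonneg mu)
    then show "norm (q m) \<le> 2 * (C' * exp (3 * ?y)) * (1 / (1 + real m)\<^sup>2)"
      by (simp add: q_def abs_mult pow0_nonneg real_I_nonneg mu)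
  qed

  define e where "e Q \<zeta> m x = kernel_term b \<nu> m (Q * u x) (\<zeta> \<bullet> sgn x)" for Q \<zeta> m and x :: 'a
  have em [measurable]: "e Q \<zeta> m \<in> borel_measurable borel" for Q \<zeta> m
    unfolding e_def kernel_term_def by measurable
  \<comment> \<open>\<open>sgn 0 = 0\<close> is not a unit vector, so the bound on the zonal
    functions is available only for \<open>x \<noteq> 0\<close>; the origin is a null set.\<close>
  have ebd: "norm (e Q \<zeta> m x) \<le> C * exp (3 * (Q * u x)) * (1 / (1 + real m)\<^sup>2)"
    if "Q \<ge> 0" "norm \<zeta> = 1" "x \<noteq> 0" for Q \<zeta> m x
    unfolding e_def using that u0 by (intro C) (auto simp: norm_sgn)
  have esum: "summable (\<lambda>m. e Q \<zeta> m x)" if "Q \<ge> 0" "norm \<zeta> = 1" "x \<noteq> 0" for Q \<zeta> x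
    by (rule summable_comparison_test'[where N = 0, OF _ ebd[OF that]]) (intro summable_mult summable_zeta)
  have epart: "norm (\<Sum>m<K. e Q \<zeta> m x) \<le> C * zeta_sum * exp (3 * (Q * u x))"
    if "Q \<ge> 0" "norm \<zeta> = 1" "x \<noteq> 0" for Q \<zeta> x K
  proof -
    have "norm (\<Sum>m<K. e Q \<zeta> m x) \<le> (\<Sum>m<K. C * exp (3 * (Q * u x)) * (1 / (1 + real m)\<^sup>2))"
      by (rule sum_norm_le) (rule ebd[OF that])
    also have "\<dots> = C * exp (3 * (Q * u x)) * (\<Sum>m<K. 1 / (1 + real m)\<^sup>2)"
      by (rule sum_distrib_left[symmetric])
    also have "\<dots> \<le> C * exp (3 * (Q * u x)) * zeta_sum"
      unfolding zeta_sum_def using C by (intro mult_left_mono sum_le_suminf summable_zeta) auto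
    finally show ?thesis by (simp add: mult_ac)
  qed
  have expRS: "exp (3 * (R * u x)) * exp (3 * (S * u x)) = exp (3 * (R + S) * norm x powr (a / 2))" for x
    by (simp add: u_def algebra_simps flip: exp_add)

  let ?W = "\<lambda>x::'a. complex_of_real (radial_weight a \<tau> x)"
  let ?s = "\<lambda>K x. cnj (\<Sum>m<K. e R \<omega> m x) * (\<Sum>m<K. e S \<eta> m x) * ?W x"
  have "(\<lambda>K. LINT x|lborel. ?s K x) \<longlonglongrightarrow> (LINT x|lborel. ?F x)"
  proof (rule integral_dominated_convergence)
    show "?F \<in> borel_measurable lborel"
    proof -
      have [measurable]: "(\<lambda>x. \<Sum>m. e Q \<zeta> m x) \<in> borel_measurable borel" for Q \<zeta>
        by (rule borel_measurable_suminf) measurable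
      show ?thesis unfolding e_def[symmetric] by measurable
    qed
    show "?s K \<in> borel_measurable lborel" for K by measurable
    show "integrable lborel (\<lambda>x::'a. (C * zeta_sum) * (C * zeta_sum) * (exp (3 * (R + S) * norm x powr (a / 2)) * radial_weight a \<tau> x))"
      by (rule integrable_mult_right, rule integrable_exp_radial_weight[OF a(1) tau kap])
    show "AE x in lborel. (\<lambda>K. ?s K x) \<longlonglongrightarrow> ?F x"
      using AE_lborel_singleton[of "0::'a"]
    proof eventually_elim
      case (elim x)
      show ?case
        using summable_LIMSEQ[OF esum[OF RS(1) un(1) elim]] summable_LIMSEQ[OF esum[OF RS(2) un(2) elim]]
        unfolding e_def by (intro tendsto_mult tendsto_const tendsto_cnj)
    qed
    show "AE x in lborel. norm (?s K x) \<le> (C * zeta_sum) * (C * zeta_sum) * (exp (3 * (R + S) * norm x powr (a / 2)) * radial_weight a \<tau> x)" for K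
      using AE_lborel_singleton[of "0::'a"]
    proof eventually_elim
      case (elim x)
      have "norm (?s K x) = norm (\<Sum>m<K. e R \<omega> m x) * norm (\<Sum>m<K. e S \<eta> m x) * radial_weight a \<tau> x"
        by (simp only: norm_mult complex_mod_cnj norm_of_real abs_of_nonneg[OF radial_weight_nonneg])
      also have "\<dots> \<le> (C * zeta_sum * exp (3 * (R * u x))) * (C * zeta_sum * exp (3 * (S * u x))) * radial_weight a \<tau> x"
        using C z0 by (intro mult_right_mono mult_mono epart RS un elim radial_weight_nonneg) auto
      also have "\<dots> = (C * zeta_sum) * (C * zeta_sum) * ((exp (3 * (R * u x)) * exp (3 * (S * u x))) * radial_weight a \<tau> x)"
        by (simp only: mult_ac)
      finally show ?case unfolding expRS .
    qed
  qed
  moreover have "(LINT x|lborel. ?s K x) = complex_of_real (c * (\<Sum>m<K. q m))" for K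
  proof -
    \<comment> \<open>The phases do not depend on \<open>x\<close>; pulling them out leaves the real
      integrands \<open>d m n\<close>, to which orthogonality applies.\<close>
    define ph where "ph m = cis (- (pi / 2) * (b * real m))" for m
    define g where "g m n x = bessel_term b \<nu> m (R * u x) * bessel_term b \<nu> n (S * u x) * radial_weight a \<tau> x" for m n x
    define d where "d m n x = gegenbauer_check \<nu> m (\<omega> \<bullet> sgn x) * gegenbauer_check \<nu> n (\<eta> \<bullet> sgn x) * g m n x" for m n x
    have gm [measurable]: "g m n \<in> borel_measurable borel" for m n unfolding g_def by measurable
    have btb: "\<bar>bessel_term b \<nu> m y\<bar> \<le> C' * exp (3 * y)" if y: "y \<ge> 0" for m y
    proof -
      have "\<bar>bessel_term b \<nu> m y\<bar> \<le> 1 * (pow0 y (b * m) * real_I (b * (m + \<nu>)) y)"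
        using abs_real_J_le[OF mu[of m], of y] pow0_nonneg[of y "b * m"]
        by (simp add: bessel_term_def abs_mult mult_left_mono)
      also have "\<dots> \<le> (1 + real m) ^ DIM('a) * (pow0 y (b * m) * real_I (b * (m + \<nu>)) y)"
        by (intro mult_right_mono one_le_power mult_nonneg_nonneg pow0_nonneg real_I_nonneg mu) auto
      finally show ?thesis using C'(2)[OF y, of m] by linarith
    qed
    have gint: "integrable lborel (g m n)" for m n
    proof (rule Bochner_Integration.integrable_bound)
      show "integrable lborel (\<lambda>x::'a. C' * C' * (exp (3 * (R + S) * norm x powr (a / 2)) * radial_weight a \<tau> x))"
        by (rule integrable_mult_right, rule integrable_exp_radial_weight[OF a(1) tau kap])
      show "AE x in lborel. norm (g m n x) \<le> norm (C' * C' * (exp (3 * (R + S) * norm x powr (a / 2)) * radial_weight a \<tau> x))"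
      proof (rule AE_I2)
        fix x :: 'a
        have "norm (g m n x) \<le> (C' * exp (3 * (R * u x))) * (C' * exp (3 * (S * u x))) * radial_weight a \<tau> x"
          unfolding g_def real_norm_def abs_mult abs_of_nonneg[OF radial_weight_nonneg]
          using C' RS u0 by (intro mult_right_mono mult_mono btb radial_weight_nonneg) auto
        also have "\<dots> = C' * C' * ((exp (3 * (R * u x)) * exp (3 * (S * u x))) * radial_weight a \<tau> x)"
          by (simp only: mult_ac)
        finally show "norm (g m n x) \<le> norm (C' * C' * (exp (3 * (R + S) * norm x powr (a / 2)) * radial_weight a \<tau> x))"
          unfolding expRS using C' radial_weight_nonneg[of a \<tau> x] by simp
      qed
    qed measurable
    have dval: "(LINT x|lborel. d m n x) = (if m = n then gegenbauer_check \<nu> m (\<omega> \<bullet> \<eta>) * (LINT x|lborel. g m n x) else 0)" for m n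
    proof -
      define G where "G \<rho> = bessel_term b \<nu> m (R * \<rho> powr (a / 2)) * bessel_term b \<nu> n (S * \<rho> powr (a / 2)) * (\<rho> powr (a - 2) * exp (- \<tau> * \<rho> powr a))" for \<rho> :: real
      have Gg: "g m n x = G (norm x)" for x
        by (simp add: g_def G_def u_def radial_weight_def)
      have "G \<in> borel_measurable borel" unfolding G_def by measurable
      moreover have "integrable lborel (\<lambda>x::'a. G (norm x))" using gint[of m n] by (simp only: Gg[abs_def] cong: Bochner_Integration.integrable_cong)
      ultimately show ?thesis
        unfolding d_def Gg by (rule integral_gegenbauer_radial[OF nu un])
    qed
    have dint: "integrable lborel (d m n)" for m n
    proof -
      obtain Km where Km: "\<And>t. \<bar>t\<bar> \<le> 1 \<Longrightarrow> \<bar>gegenbauer_check \<nu> m t\<bar> \<le> Km" using gegenbauer_check_bounded by blast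
      obtain Kn where Kn: "\<And>t. \<bar>t\<bar> \<le> 1 \<Longrightarrow> \<bar>gegenbauer_check \<nu> n t\<bar> \<le> Kn" using gegenbauer_check_bounded by blast
      have K0: "Km \<ge> 0" "Kn \<ge> 0" using Km[of 0] Kn[of 0] by linarith+
      show ?thesis
      proof (rule Bochner_Integration.integrable_bound)
        show "integrable lborel (\<lambda>x. Km * Kn * g m n x)" by (rule integrable_mult_right[OF gint])
        show "AE x in lborel. norm (d m n x) \<le> norm (Km * Kn * g m n x)"
        proof (rule AE_I2)
          fix x :: 'a
          have "norm (d m n x) \<le> (Km * Kn) * \<bar>g m n x\<bar>"
            unfolding d_def real_norm_def abs_mult using K0
            by (intro mult_right_mono mult_mono Km Kn abs_inner_sgn_le un) auto
          then show "norm (d m n x) \<le> norm (Km * Kn * g m n x)" using K0 by (simp add: abs_mult)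
        qed
        show "d m n \<in> borel_measurable lborel" unfolding d_def by measurable
      qed
    qed
    have "(LINT x|lborel. ?s K x) = (LINT x|lborel. (\<Sum>m<K. \<Sum>n<K. cnj (ph m) * ph n * complex_of_real (d m n x)))"
    proof (rule Bochner_Integration.integral_cong[OF refl])
      fix x :: 'a
      have "?s K x = (\<Sum>m<K. \<Sum>n<K. cnj (e R \<omega> m x) * e S \<eta> n x * ?W x)"
        unfolding cnj_sum sum_product by (simp only: sum_distrib_right)
      also have "\<dots> = (\<Sum>m<K. \<Sum>n<K. cnj (ph m) * ph n * complex_of_real (d m n x))"
        by (simp add: e_def kernel_term_def d_def g_def ph_def mult_ac)
      finally show "?s K x = (\<Sum>m<K. \<Sum>n<K. cnj (ph m) * ph n * complex_of_real (d m n x))" .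
    qed
    also have "\<dots> = (\<Sum>m<K. \<Sum>n<K. cnj (ph m) * ph n * complex_of_real (LINT x|lborel. d m n x))"
    proof -
      have "has_bochner_integral lborel (\<lambda>x. complex_of_real (d m n x)) (complex_of_real (LINT x|lborel. d m n x))" for m n
        using dint[of m n] by (intro has_bochner_integral_of_real has_bochner_integral_integrable)
      then show ?thesis
        by (intro has_bochner_integral_integral_eq has_bochner_integral_sum has_bochner_integral_mult_right)
    qed
    also have "\<dots> = (\<Sum>m<K. \<Sum>n<K. if n = m then complex_of_real (c * q m) else 0)"
    proof (intro sum.cong refl)
      fix m n
      have "cnj (ph m) * ph m = 1" by (simp add: ph_def cis_cnj cis_mult)
      moreover have "gegenbauer_check \<nu> m (\<omega> \<bullet> \<eta>) * (LINT x|lborel. g m m x) = c * q m"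
        using weber_integral[OF a nu lam RS tau, of m]
        by (simp add: g_def bessel_term_def radial_weight_def u_def c_def q_def mult_ac)
      ultimately show "cnj (ph m) * ph n * complex_of_real (LINT x|lborel. d m n x) = (if n = m then complex_of_real (c * q m) else 0)"
        unfolding dval by simp
    qed
    also have "\<dots> = complex_of_real (c * (\<Sum>m<K. q m))"
      by (simp add: sum_distrib_left)
    finally show ?thesis .
  qed
  ultimately have "(\<lambda>K. complex_of_real (c * (\<Sum>m<K. q m))) \<longlonglongrightarrow> (LINT x|lborel. ?F x)" by simp
  moreover have "(\<lambda>K. complex_of_real (c * (\<Sum>m<K. q m))) \<longlonglongrightarrow> complex_of_real (c * suminf q)"
    by (intro tendsto_of_real tendsto_mult tendsto_const summable_LIMSEQ sq)
  ultimately show "(LINT x|lborel. ?F x) = complex_of_real (c * suminf q)" by (rule LIMSEQ_unique)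
qed

text \<open>The argument of \<open>script_I\<close> is \<open>-2iy\<close> with
  \<open>y = (r|\<xi>|)^(a/2)/a = R |\<xi>|^(a/2)\<close>, whence the division by \<open>a\<close>
  in \<open>R\<close> and \<open>S\<close>. Consequently \<open>R^2/\<tau> = r^a/(at)\<close> and
  \<open>RS/\<tau> = (rs)^(a/2)/(at)\<close>.\<close>

lemma heat_kernel_polar:
  fixes a t r s :: real and \<omega> \<eta> :: "real ^ 'n::finite"
  assumes a: "a > max 0 (2 - real CARD('n))" and rs: "r \<ge> 0" "s \<ge> 0" and t: "t > 0"
    and un: "norm \<omega> = 1" "norm \<eta> = 1"
  defines "\<nu> \<equiv> (real CARD('n) - 2) / 2" and "b \<equiv> 2 / a" and "R \<equiv> r powr (a / 2) / a" and "S \<equiv> s powr (a / 2) / a"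
    and "\<tau> \<equiv> t / a"
  shows "heat_kernel a (r *\<^sub>R \<omega>) (s *\<^sub>R \<eta>) t = complex_of_real
    (c_const TYPE('n) a * (Gamma (b * \<nu> + 1))\<^sup>2 *
     (unit_ball_vol CARD('n) * CARD('n) / a * \<tau> powr (- (b * \<nu> + 1)) * exp (- (R\<^sup>2 / \<tau>)) * exp (- (S\<^sup>2 / \<tau>)) *
      (\<Sum>m. gegenbauer_check \<nu> m (\<omega> \<bullet> \<eta>) * (pow0 (R * S / \<tau>) (b * real m) * real_I (b * (real m + \<nu>)) (R * S / \<tau>)))))"
proof -
  have a0: "a > 0" "a > 2 - real CARD('n)" using a by auto
  have "x = 2 * ((x - 2) / 2) + 2" for x :: real by (simp add: field_simps)
  then have nu: "real DIM(real ^ 'n) = 2 * \<nu> + 2" unfolding \<nu>_def DIM_cart DIM_real mult_1_right .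
  have b: "b > 0" using a0 by (simp add: b_def)
  have lam: "b * \<nu> > -1" using a0 by (simp add: b_def \<nu>_def field_simps)
  have RS: "R \<ge> 0" "S \<ge> 0" using a0 by (simp_all add: R_def S_def)
  have tau: "\<tau> > 0" using a0 t by (simp add: \<tau>_def)
  define u where "u \<xi> = norm \<xi> powr (a / 2)" for \<xi> :: "real ^ 'n"
  define T where "T Q \<zeta> \<xi> = (\<Sum>m. kernel_term b \<nu> m (Q * u \<xi>) (\<zeta> \<bullet> sgn \<xi>))" for Q \<zeta> and \<xi> :: "real ^ 'n"
  have B: "B_kernel a (q *\<^sub>R \<zeta>) \<xi> = of_real (Gamma (b * \<nu> + 1)) * T (q powr (a / 2) / a) \<zeta> \<xi>"
    if q: "q \<ge> 0" and \<zeta>: "norm \<zeta> = 1" and \<xi>: "\<xi> \<noteq> 0" for q \<zeta> and \<xi> :: "real ^ 'n"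
  proof -
    have "\<xi> = norm \<xi> *\<^sub>R sgn \<xi>" using \<xi> by (simp add: sgn_div_norm)
    then have "B_kernel a (q *\<^sub>R \<zeta>) \<xi> = B_kernel a (q *\<^sub>R \<zeta>) (norm \<xi> *\<^sub>R sgn \<xi>)" by simp
    also have "\<dots> = script_I (2 / a) ((real CARD('n) - 2) / 2)
      (complex_of_real (2 * (q * norm \<xi>) powr (a / 2)) / (complex_of_real a * \<i>)) (\<zeta> \<bullet> sgn \<xi>)"
      by (rule B_kernel_polar) (use a0 q \<zeta> \<xi> in \<open>auto simp: norm_sgn\<close>)
    also have "\<dots> = of_real (Gamma (b * \<nu> + 1)) * T (q powr (a / 2) / a) \<zeta> \<xi>"
      unfolding T_def b_def[symmetric] \<nu>_def[symmetric]
    proof (rule script_I_neg_ii[OF b lam])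
      show "q powr (a / 2) / a * u \<xi> \<ge> 0" using a0 by (simp add: u_def)
      show "complex_of_real (2 * (q * norm \<xi>) powr (a / 2)) / (complex_of_real a * \<i>) / 2 = - \<i> * complex_of_real (q powr (a / 2) / a * u \<xi>)"
        using a0 q by (simp add: u_def powr_mult field_simps)
    qed
    finally show ?thesis .
  qed
  have "(LINT \<xi>|lborel. cnj (B_kernel a (r *\<^sub>R \<omega>) \<xi>) * B_kernel a (s *\<^sub>R \<eta>) \<xi> *
     complex_of_real (exp (- (t / a) * norm \<xi> powr a) / norm \<xi> powr (2 - a))) =
    (LINT \<xi>|lborel. complex_of_real ((Gamma (b * \<nu> + 1))\<^sup>2) * (cnj (T R \<omega> \<xi>) * T S \<eta> \<xi> * complex_of_real (radial_weight a \<tau> \<xi>)))"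
  proof (rule Bochner_Integration.integral_cong[OF refl])
    fix \<xi> :: "real ^ 'n"
    have w: "exp (- (t / a) * norm \<xi> powr a) / norm \<xi> powr (2 - a) = radial_weight a \<tau> \<xi>"
      using powr_minus[of "norm \<xi>" "2 - a"] by (simp add: radial_weight_def \<tau>_def divide_inverse)
    show "cnj (B_kernel a (r *\<^sub>R \<omega>) \<xi>) * B_kernel a (s *\<^sub>R \<eta>) \<xi> *
       complex_of_real (exp (- (t / a) * norm \<xi> powr a) / norm \<xi> powr (2 - a)) =
      complex_of_real ((Gamma (b * \<nu> + 1))\<^sup>2) * (cnj (T R \<omega> \<xi>) * T S \<eta> \<xi> * complex_of_real (radial_weight a \<tau> \<xi>))"
    \<comment> \<open>At the origin both weights are zero, by \<open>0 powr p = 0\<close> and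
      division by zero, so the integrands agree at every point.\<close>
    proof (cases "\<xi> = 0")
      case False
      show ?thesis
        unfolding w B[OF rs(1) un(1) False] B[OF rs(2) un(2) False] R_def S_def
        by (simp add: power2_eq_square)
    qed (simp add: radial_weight_def)
  qed
  also have "\<dots> = complex_of_real ((Gamma (b * \<nu> + 1))\<^sup>2) * (LINT \<xi>|lborel. cnj (T R \<omega> \<xi>) * T S \<eta> \<xi> * complex_of_real (radial_weight a \<tau> \<xi>))"
    by (rule integral_mult_right_zero)
  finally have I: "(LINT \<xi>|lborel. cnj (B_kernel a (r *\<^sub>R \<omega>) \<xi>) * B_kernel a (s *\<^sub>R \<eta>) \<xi> *
     complex_of_real (exp (- (t / a) * norm \<xi> powr a) / norm \<xi> powr (2 - a))) =
    complex_of_real ((Gamma (b * \<nu> + 1))\<^sup>2) * (LINT \<xi>|lborel. cnj (T R \<omega> \<xi>) * T S \<eta> \<xi> * complex_of_real (radial_weight a \<tau> \<xi>))" .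
  have "b = 2 / a" by (simp add: b_def)
  note K = kernel_integral(2)[OF a0(1) this nu lam RS tau un]
  show ?thesis
    unfolding heat_kernel_def I
    unfolding T_def u_def K
    by (simp only: of_real_mult mult.assoc DIM_cart DIM_real mult_1_right)
qed

lemma ex_polar: "\<exists>\<omega>::real ^ 'n::finite. norm \<omega> = 1 \<and> x = norm x *\<^sub>R \<omega>"
proof (cases "x = 0")
  case True
  then show ?thesis by (intro exI[of _ "axis undefined 1"]) (simp add: norm_axis_1)
next
  case False
  then show ?thesis by (intro exI[of _ "sgn x"]) (simp add: norm_sgn sgn_div_norm)
qed

theorem corollary4p7:
  fixes a lam M :: real
  assumes "a > max 0 (2 - real CARD('n::finite))"
    and "lam = (real CARD('n) - 2) / a"
    and "M = (a - 1) * ((real CARD('n) - 2) / 2) + a"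
  shows "(\<forall>(x :: real ^ 'n) (y :: real ^ 'n) t. t > 0 \<longrightarrow>
            heat_kernel a x y t \<in> \<real> \<and> heat_kernel a x y t = heat_kernel a y x t)
       \<and> (\<exists>C>0. \<forall>(x :: real ^ 'n) (y :: real ^ 'n) t. t > 0 \<longrightarrow>
            cmod (heat_kernel a x y t) \<le>
              C * t powr (- (lam + 1)) *
              exp (- ((norm x powr (a / 2) - norm y powr (a / 2))\<^sup>2 / (a * t))) *
              (1 + ((norm x * norm y) powr (a / 2) / (a * t)) powr (2 * M / a)))"
proof (intro conjI allI impI)
  fix x y :: "real ^ 'n" and t :: real
  assume t: "t > 0"
  obtain \<omega> where \<omega>: "norm \<omega> = 1" "x = norm x *\<^sub>R \<omega>" using ex_polar by blast
  obtain \<eta> where \<eta>: "norm \<eta> = 1" "y = norm y *\<^sub>R \<eta>" using ex_polar by blast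
  note hk = heat_kernel_polar[OF assms(1) norm_ge_zero norm_ge_zero t]
  \<comment> \<open>Every quantity in the polar formula is real, and exchanging the points exchanges
    \<open>R\<close> and \<open>S\<close> and the two directions, all of which enter
    symmetrically.\<close>
  show "heat_kernel a x y t \<in> \<real>"
    using hk[OF \<omega>(1) \<eta>(1), of x y] \<omega>(2) \<eta>(2) by simp
  show "heat_kernel a x y t = heat_kernel a y x t"
    using hk[OF \<omega>(1) \<eta>(1), of x y] hk[OF \<eta>(1) \<omega>(1), of y x] \<omega>(2) \<eta>(2)
    by (simp add: inner_commute mult.commute mult.left_commute)
next
  define \<nu> where "\<nu> = (real CARD('n) - 2) / 2"
  define b where "b = 2 / a"
  have a0: "a > 0" "a > 2 - real CARD('n)" using assms(1) by auto
  have "x = 2 * ((x - 2) / 2) + 2" for x :: real by (simp add: field_simps)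
  then have nu: "real DIM(real ^ 'n) = 2 * \<nu> + 2" unfolding \<nu>_def DIM_cart DIM_real mult_1_right .
  have b: "b > 0" using a0 by (simp add: b_def)
  have lam: "b * \<nu> > -1" using a0 by (simp add: b_def \<nu>_def field_simps)
  have bnu: "b * \<nu> = lam" using a0 by (simp add: b_def \<nu>_def assms(2) field_simps)
  \<comment> \<open>\<open>N - (N - 2)/a = ((a - 1)(N - 2) + 2a)/a\<close>, which is where
    \<open>M\<close> comes from.\<close>
  have p: "real DIM(real ^ 'n) - b * \<nu> = 2 * M / a"
    using a0 by (simp add: assms(3) b_def \<nu>_def field_simps)
  obtain C where C: "C > 0" "\<And>m y. y \<ge> 0 \<Longrightarrow> (1 + real m) ^ DIM(real ^ 'n) * (pow0 y (b * m) * real_I (b * (m + \<nu>)) y) \<le>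
     C * exp (2 * y) * (1 + y powr (2 * M / a))"
    using bessel_term_bound[OF b lam nu] unfolding p by auto
  have z0: "zeta_sum \<ge> 0" unfolding zeta_sum_def by (intro suminf_nonneg summable_zeta) auto
  define V where "V = unit_ball_vol CARD('n) * CARD('n) / a"
  have V: "V \<ge> 0" using a0 by (simp add: V_def)
  \<comment> \<open>\<open>A\<close> collects the factors free of \<open>x\<close>, \<open>y\<close>
    and \<open>t\<close>; the division by a power of \<open>a\<close> comes from
    \<open>\<tau> = t/a\<close>.\<close>
  define A where "A = \<bar>c_const TYPE('n) a\<bar> * (Gamma (lam + 1))\<^sup>2 * V / a powr (- (lam + 1))"
  have A: "A \<ge> 0" using V by (simp add: A_def)
  \<comment> \<open>\<open>A\<close> is only shown to be nonnegative; the summand \<open>1\<close>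
    makes \<open>C1\<close> positive.\<close>
  define C1 where "C1 = A * (2 * C * zeta_sum) + 1"
  have bound: "cmod (heat_kernel a x y t) \<le>
              C1 * t powr (- (lam + 1)) *
              exp (- ((norm x powr (a / 2) - norm y powr (a / 2))\<^sup>2 / (a * t))) *
              (1 + ((norm x * norm y) powr (a / 2) / (a * t)) powr (2 * M / a))"
    if t: "t > 0" for x y :: "real ^ 'n" and t
  proof -
    obtain \<omega> where \<omega>: "norm \<omega> = 1" "x = norm x *\<^sub>R \<omega>" using ex_polar by blast
    obtain \<eta> where \<eta>: "norm \<eta> = 1" "y = norm y *\<^sub>R \<eta>" using ex_polar by blast
    define r s \<tau> where "r = norm x powr (a / 2)" and "s = norm y powr (a / 2)" and "\<tau> = t / a"
    define Y where "Y = (norm x * norm y) powr (a / 2) / (a * t)"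
    define q where "q m = gegenbauer_check \<nu> m (\<omega> \<bullet> \<eta>) * (pow0 Y (b * real m) * real_I (b * (real m + \<nu>)) Y)" for m
    have tau: "\<tau> > 0" using t a0 by (simp add: \<tau>_def)
    have Y: "r / a * (s / a) / \<tau> = Y" "Y \<ge> 0"
      using a0 t by (simp_all add: r_def s_def \<tau>_def Y_def powr_mult field_simps)
    have hk: "heat_kernel a x y t = complex_of_real (c_const TYPE('n) a * (Gamma (lam + 1))\<^sup>2 *
      (V * \<tau> powr (- (lam + 1)) * exp (- ((r / a)\<^sup>2 / \<tau>)) * exp (- ((s / a)\<^sup>2 / \<tau>)) * suminf q))"
      using heat_kernel_polar[OF assms(1) norm_ge_zero norm_ge_zero t \<omega>(1) \<eta>(1), of x y,
          folded b_def \<nu>_def r_def s_def \<tau>_def, unfolded Y bnu] \<omega>(2) \<eta>(2)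
      by (simp add: q_def[abs_def] V_def)
    define D where "D = C * exp (2 * Y) * (1 + Y powr (2 * M / a))"
    have qb: "\<bar>q m\<bar> \<le> 2 * D * (1 / (1 + real m)\<^sup>2)" for m
    proof -
      have mu: "b * (real m + \<nu>) > -1" by (rule bessel_index_gt[OF b lam])
      have "\<bar>gegenbauer_check \<nu> m (\<omega> \<bullet> \<eta>)\<bar> * (pow0 Y (b * m) * real_I (b * (real m + \<nu>)) Y) \<le> 2 * D * (1 / (1 + real m)\<^sup>2)"
        unfolding D_def by (intro gegenbauer_bessel_bound[OF nu \<omega>(1) \<eta>(1)] C Y mult_nonneg_nonneg pow0_nonneg real_I_nonneg mu)
      then show ?thesis by (simp add: q_def abs_mult pow0_nonneg real_I_nonneg mu)
    qed
    have sD: "summable (\<lambda>m. 2 * D * (1 / (1 + real m)\<^sup>2))" by (intro summable_mult summable_zeta)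
    have sq: "summable (\<lambda>m. \<bar>q m\<bar>)"
      by (rule summable_comparison_test'[OF sD, where N = 0]) (use qb in simp)
    have "\<bar>suminf q\<bar> \<le> (\<Sum>m. \<bar>q m\<bar>)" by (rule summable_rabs[OF sq])
    also have "\<dots> \<le> (\<Sum>m. 2 * D * (1 / (1 + real m)\<^sup>2))" by (rule suminf_le[OF qb sq sD])
    also have "\<dots> = 2 * D * zeta_sum" unfolding zeta_sum_def by (rule suminf_mult[OF summable_zeta])
    finally have qs: "\<bar>suminf q\<bar> \<le> 2 * D * zeta_sum" .
    \<comment> \<open>Here \<open>r\<close> and \<open>s\<close> are the norms raised to the power
      \<open>a/2\<close>, so the exponents add up to \<open>-(r^2 + s^2 - 2rs)/(at)\<close>: the
      growth \<open>e^(2Y)\<close> of the Bessel series is exactly what completes the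
      square.\<close>
    have ex: "exp (- ((r / a)\<^sup>2 / \<tau>)) * exp (- ((s / a)\<^sup>2 / \<tau>)) * exp (2 * Y) = exp (- ((r - s)\<^sup>2 / (a * t)))"
    proof -
      have "- ((r / a)\<^sup>2 / \<tau>) + - ((s / a)\<^sup>2 / \<tau>) + 2 * Y = - ((r - s)\<^sup>2 / (a * t))"
        unfolding Y(1)[symmetric] \<tau>_def using a0 t by (simp add: power2_eq_square field_simps)
      then show ?thesis by (simp only: exp_add[symmetric])
    qed
    have "cmod (heat_kernel a x y t) = \<bar>c_const TYPE('n) a\<bar> * (Gamma (lam + 1))\<^sup>2 *
      (V * \<tau> powr (- (lam + 1)) * exp (- ((r / a)\<^sup>2 / \<tau>)) * exp (- ((s / a)\<^sup>2 / \<tau>)) * \<bar>suminf q\<bar>)"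
      unfolding hk norm_of_real using V by (simp add: abs_mult)
    also have "\<dots> \<le> \<bar>c_const TYPE('n) a\<bar> * (Gamma (lam + 1))\<^sup>2 *
      (V * \<tau> powr (- (lam + 1)) * exp (- ((r / a)\<^sup>2 / \<tau>)) * exp (- ((s / a)\<^sup>2 / \<tau>)) * (2 * D * zeta_sum))"
      using V by (intro mult_left_mono qs mult_nonneg_nonneg) auto
    also have "\<tau> powr (- (lam + 1)) = t powr (- (lam + 1)) / a powr (- (lam + 1))"
      using t a0 by (simp add: \<tau>_def powr_divide)
    also have "\<bar>c_const TYPE('n) a\<bar> * (Gamma (lam + 1))\<^sup>2 *
      (V * (t powr (- (lam + 1)) / a powr (- (lam + 1))) * exp (- ((r / a)\<^sup>2 / \<tau>)) * exp (- ((s / a)\<^sup>2 / \<tau>)) * (2 * D * zeta_sum)) =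
      (A * (2 * C * zeta_sum)) * t powr (- (lam + 1)) *
        (exp (- ((r / a)\<^sup>2 / \<tau>)) * exp (- ((s / a)\<^sup>2 / \<tau>)) * exp (2 * Y)) * (1 + Y powr (2 * M / a))"
      unfolding A_def D_def by (simp add: divide_inverse mult_ac)
    also have "\<dots> \<le> C1 * t powr (- (lam + 1)) *
        (exp (- ((r / a)\<^sup>2 / \<tau>)) * exp (- ((s / a)\<^sup>2 / \<tau>)) * exp (2 * Y)) * (1 + Y powr (2 * M / a))"
      unfolding C1_def by (intro mult_right_mono) auto
    finally show ?thesis unfolding ex unfolding r_def s_def Y_def .
  qed
  moreover have "C1 > 0" unfolding C1_def using A C z0 by (intro add_nonneg_pos mult_nonneg_nonneg) auto
  ultimately show "\<exists>C>0. \<forall>(x :: real ^ 'n) (y :: real ^ 'n) t. t > 0 \<longrightarrow>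
            cmod (heat_kernel a x y t) \<le>
              C * t powr (- (lam + 1)) *
              exp (- ((norm x powr (a / 2) - norm y powr (a / 2))\<^sup>2 / (a * t))) *
              (1 + ((norm x * norm y) powr (a / 2) / (a * t)) powr (2 * M / a))"
    by blast
qed

end
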